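(* Let $\mathcal{L}_1,\ldots,\mathcal{L}_k$ be special ample line bundles on $V$. Then the ring $\bigoplus_{m\ge0}H^0(V,\operatorname{Sym}^m(\mathcal{L}_1\oplus\cdots\oplus\mathcal{L}_k))$ is quadratic.
   Context: Let $\Phi$ be an irreducible, reduced (finite, crystallographic) root system of rank $n$, with set of roots $\Delta$, root lattice $Y$, weight lattice $X \supseteq Y$, coroot lattice $X^\vee$ and coweight lattice $Y^\vee\supseteq X^\vee$, and pairing $\langle\,,\rangle : X \times X^\vee \to \mathbb{Z}$ extended to $(X\otimes_{\mathbb Z}\mathbb{R})\times X^\vee$. Let $F$ be the Weyl fan in $Y^\vee \otimes_{\mathbb Z} \mathbb{R}$ (cut out by the root hyperplanes) and $F_n$ the set of its maximal cones (Weyl chambers). For $\sigma\in F_n$ let $\{\alpha_{i,\sigma} : 1\le i\le n\}$ be the corresponding simple roots; $x \in X\otimes_{\mathbb Z}\mathbb{R}$ is $\sigma$-dominant if $\langle x, \alpha_{i,\sigma}^\vee\rangle \ge 0$ for all $i$. For adjacent chambers $\sigma,\sigma'$, $\alpha_{\sigma,\sigma'}\in\Delta$ is the unique root positive on $\sigma$ and negative on $\sigma'$. $V$ is the complex toric variety with fan $F$ and lattice $Y^\vee$; it is smooth and projective, with torus $T_1 = \operatorname{Spec}\mathbb{C}[Y]$. The torus $T = \operatorname{Spec}\mathbb{C}[X]$ acts on $V$ via the projection $T \twoheadrightarrow T_1$. Isomorphism classes of $T$-equivariant ample line bundles on $V$ correspond bijectively, in the usual way, to ample polytopes: convex polytopes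 $P \subset X\otimes_{\mathbb Z}\mathbb{R}$ with vertices given by a set $\{\mu_\sigma : \sigma\in F_n\} \subset X$ such that for adjacent $\sigma,\sigma'$, $\mu_\sigma - \mu_{\sigma'} = r_{\sigma,\sigma'}\alpha_{\sigma,\sigma'}$ with $r_{\sigma,\sigma'} \in \mathbb{Z}_{>0}$. Put $\Lambda(P) := P \cap (\mu_\sigma + Y)$ (independent of $\sigma$). The sign conventions are such that, if $\mathcal{L}$ corresponds to $P$, a character $x\in X$ occurs in $H^0(V,\mathcal{L})$ iff $x\in\Lambda(P)$, and then with multiplicity one. The line bundle is called special ample if its polytope is special, i.e. $\mu_\sigma$ is $\sigma$-dominant for every $\sigma\in F_n$. For a vector bundle $\mathcal{U}$, $\operatorname{Sym}^m(\mathcal{U})$ is its $m$-th symmetric power. A commutative graded ring $A=\bigoplus_{m\ge0}A_m$ with $A_0=\mathbb{C}$ is quadratic if it is generated over $\mathbb{C}$ by $A_1$ and the kernel of $\operatorname{Sym}(A_1)\to A$ is generated as an ideal by its degree-two part. *)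

theory Defs
  imports
    "HOL-Analysis.Analysis"
    "HOL-Library.Poly_Mapping"
    "HOL-Library.Function_Algebras"
begin

section \<open>Root systems and lattices\<close>

text \<open>
  The root system lives in a Euclidean space \<^typ>\<open>'a::euclidean_space\<close>, whose dimension is its rank.
  This space is \<open>X \<otimes> \<real>\<close>; it is identified with its dual \<open>Y\<^sup>\<or> \<otimes> \<real>\<close> by the
  inner product, so that the pairing is the inner product, and the coroot of \<open>\<alpha>\<close> is
  \<open>2 \<alpha> / (\<alpha>, \<alpha>)\<close>.
\<close>

definition coroot :: "'a::euclidean_space \<Rightarrow> 'a" where
  "coroot \<alpha> = (2 / (\<alpha> \<bullet> \<alpha>)) *\<^sub>R \<alpha>"

definition root_system :: "'a::euclidean_space set \<Rightarrow> bool" where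
  "root_system \<Delta> \<longleftrightarrow>
     finite \<Delta> \<and> 0 \<notin> \<Delta> \<and> span \<Delta> = UNIV \<and>
     (\<forall>\<alpha>\<in>\<Delta>. \<forall>\<beta>\<in>\<Delta>. \<beta> - (\<beta> \<bullet> coroot \<alpha>) *\<^sub>R \<alpha> \<in> \<Delta>) \<and>
     (\<forall>\<alpha>\<in>\<Delta>. \<forall>\<beta>\<in>\<Delta>. \<beta> \<bullet> coroot \<alpha> \<in> \<int>)"

definition reduced_root_system :: "'a::euclidean_space set \<Rightarrow> bool" where
  "reduced_root_system \<Delta> \<longleftrightarrow>
     root_system \<Delta> \<and> (\<forall>\<alpha>\<in>\<Delta>. \<forall>t::real. t *\<^sub>R \<alpha> \<in> \<Delta> \<longrightarrow> t = 1 \<or> t = -1)"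

definition irreducible_root_system :: "'a::euclidean_space set \<Rightarrow> bool" where
  "irreducible_root_system \<Delta> \<longleftrightarrow>
     root_system \<Delta> \<and> \<Delta> \<noteq> {} \<and>
     \<not> (\<exists>A B. A \<noteq> {} \<and> B \<noteq> {} \<and> A \<union> B = \<Delta> \<and> A \<inter> B = {} \<and>
            (\<forall>\<alpha>\<in>A. \<forall>\<beta>\<in>B. \<alpha> \<bullet> \<beta> = 0))"

definition root_lattice :: "'a::euclidean_space set \<Rightarrow> 'a set" where
  "root_lattice \<Delta> = {\<Sum>\<alpha>\<in>\<Delta>. of_int (c \<alpha>) *\<^sub>R \<alpha> | c :: 'a \<Rightarrow> int. True}"

definition weight_lattice :: "'a::euclidean_space set \<Rightarrow> 'a set" where
  "weight_lattice \<Delta> = {x. \<forall>\<alpha>\<in>\<Delta>. x \<bullet> coroot \<alpha> \<in> \<int>}"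


section \<open>Weyl chambers\<close>

text \<open>The maximal cones of the Weyl fan are the closed Weyl chambers.\<close>

definition chambers :: "'a::euclidean_space set \<Rightarrow> 'a set set" where
  "chambers \<Delta> = closure ` components (UNIV - (\<Union>\<alpha>\<in>\<Delta>. {v. \<alpha> \<bullet> v = 0}))"

definition positive_roots :: "'a::euclidean_space set \<Rightarrow> 'a set \<Rightarrow> 'a set" where
  "positive_roots \<Delta> \<sigma> = {\<alpha> \<in> \<Delta>. \<forall>v\<in>interior \<sigma>. 0 < \<alpha> \<bullet> v}"

definition simple_roots :: "'a::euclidean_space set \<Rightarrow> 'a set \<Rightarrow> 'a set" where
  "simple_roots \<Delta> \<sigma> =
     {\<alpha> \<in> positive_roots \<Delta> \<sigma>.
        \<not> (\<exists>\<beta>\<in>positive_roots \<Delta> \<sigma>. \<exists>\<gamma>\<in>positive_roots \<Delta> \<sigma>. \<alpha> = \<beta> + \<gamma>)}"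

definition dominant :: "'a::euclidean_space set \<Rightarrow> 'a set \<Rightarrow> 'a \<Rightarrow> bool" where
  "dominant \<Delta> \<sigma> x \<longleftrightarrow> (\<forall>\<alpha>\<in>simple_roots \<Delta> \<sigma>. 0 \<le> x \<bullet> coroot \<alpha>)"

definition adjacent :: "'a::euclidean_space set \<Rightarrow> 'a set \<Rightarrow> 'a set \<Rightarrow> bool" where
  "adjacent \<Delta> \<sigma> \<sigma>' \<longleftrightarrow>
     \<sigma> \<in> chambers \<Delta> \<and> \<sigma>' \<in> chambers \<Delta> \<and> \<sigma> \<noteq> \<sigma>' \<and>
     aff_dim (\<sigma> \<inter> \<sigma>') = int DIM('a) - 1"

definition wall_root :: "'a::euclidean_space set \<Rightarrow> 'a set \<Rightarrow> 'a set \<Rightarrow> 'a" where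
  "wall_root \<Delta> \<sigma> \<sigma>' =
     (THE \<alpha>. \<alpha> \<in> \<Delta> \<and> (\<forall>v\<in>interior \<sigma>. 0 < \<alpha> \<bullet> v) \<and> (\<forall>v\<in>interior \<sigma>'. \<alpha> \<bullet> v < 0))"

text \<open>\<open>P\<close> is an ample polytope whose vertex belonging to the chamber \<open>\<sigma>\<close> is \<open>\<mu> \<sigma>\<close>.\<close>

definition ample_polytope ::
    "'a::euclidean_space set \<Rightarrow> ('a set \<Rightarrow> 'a) \<Rightarrow> 'a set \<Rightarrow> bool" where
  "ample_polytope \<Delta> \<mu> P \<longleftrightarrow>
     P = convex hull (\<mu> ` chambers \<Delta>) \<and>
     {x. x extreme_point_of P} = \<mu> ` chambers \<Delta> \<and>
     (\<forall>\<sigma>\<in>chambers \<Delta>. \<mu> \<sigma> \<in> weight_lattice \<Delta>) \<and>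
     (\<forall>\<sigma> \<sigma>'. adjacent \<Delta> \<sigma> \<sigma>' \<longrightarrow>
        (\<exists>r::nat. 0 < r \<and> \<mu> \<sigma> - \<mu> \<sigma>' = real r *\<^sub>R wall_root \<Delta> \<sigma> \<sigma>'))"

definition special_polytope ::
    "'a::euclidean_space set \<Rightarrow> ('a set \<Rightarrow> 'a) \<Rightarrow> 'a set \<Rightarrow> bool" where
  "special_polytope \<Delta> \<mu> P \<longleftrightarrow>
     ample_polytope \<Delta> \<mu> P \<and> (\<forall>\<sigma>\<in>chambers \<Delta>. dominant \<Delta> \<sigma> (\<mu> \<sigma>))"


section \<open>The toric variety and its vector bundles\<close>

text \<open>
  \<open>'a \<Rightarrow>\<^sub>0 complex\<close> is the group algebra of the additive group \<open>'a\<close>; its multiplication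
  is convolution, and \<open>Poly_Mapping.single y 1\<close> is the character \<open>\<chi>\<^sup>y\<close>.

  The toric variety \<open>V\<close> is glued from the affine charts
  \<open>U\<^sub>\<tau> = Spec \<complex>[\<tau>\<^sup>\<or> \<inter> Y]\<close>, where \<open>\<tau>\<close> runs over the chambers, with
  \<open>U\<^sub>\<sigma> \<inter> U\<^sub>\<sigma>\<^sub>' = U\<^sub>\<tau>\<close> for \<open>\<tau> = \<sigma> \<inter> \<sigma>'\<close>. All the rings of
  functions are subrings of \<open>\<complex>[Y]\<close>, and the restriction maps are the inclusions.
\<close>

definition dual_cone :: "'a::euclidean_space set \<Rightarrow> 'a set" where
  "dual_cone \<tau> = {x. \<forall>v\<in>\<tau>. 0 \<le> x \<bullet> v}"

definition chart_ring ::
    "'a::euclidean_space set \<Rightarrow> 'a set \<Rightarrow> ('a \<Rightarrow>\<^sub>0 complex) set" where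
  "chart_ring \<Delta> \<tau> = {f. Poly_Mapping.keys f \<subseteq> dual_cone \<tau> \<inter> root_lattice \<Delta>}"

text \<open>
  A vector bundle on \<open>V\<close> is given by a frame \<open>e\<^sub>\<sigma>\<^sub>,\<^sub>0, \<dots>, e\<^sub>\<sigma>\<^sub>,\<^sub>r\<^sub>-\<^sub>1\<close>
  over each chart \<open>U\<^sub>\<sigma>\<close> and by transition matrices over the overlaps: the frame vector with
  index \<open>j\<close> over \<open>U\<^sub>\<sigma>\<^sub>'\<close> is the sum over \<open>i\<close> of \<open>trans \<sigma> \<sigma>' i j\<close> times
  the frame vector with index \<open>i\<close> over \<open>U\<^sub>\<sigma>\<close>. Every vector bundle on \<open>V\<close> is of this
  form, as vector bundles on \<open>U\<^sub>\<sigma>\<close>, an affine space, are trivial.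
\<close>

record 'a vector_bundle_data =
  rank :: nat
  trans :: "'a set \<Rightarrow> 'a set \<Rightarrow> nat \<Rightarrow> nat \<Rightarrow> ('a \<Rightarrow>\<^sub>0 complex)"

definition vector_bundle ::
    "'a::euclidean_space set \<Rightarrow> ('a, 'm) vector_bundle_data_scheme \<Rightarrow> bool" where
  "vector_bundle \<Delta> E \<longleftrightarrow>
     (\<forall>\<sigma>\<in>chambers \<Delta>. \<forall>\<sigma>'\<in>chambers \<Delta>. \<forall>i<rank E. \<forall>j<rank E.
        trans E \<sigma> \<sigma>' i j \<in> chart_ring \<Delta> (\<sigma> \<inter> \<sigma>')) \<and>
     (\<forall>\<sigma>\<in>chambers \<Delta>. \<forall>i<rank E. \<forall>j<rank E.
        trans E \<sigma> \<sigma> i j = (if i = j then 1 else 0)) \<and>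
     (\<forall>\<sigma>\<in>chambers \<Delta>. \<forall>\<sigma>'\<in>chambers \<Delta>. \<forall>\<sigma>''\<in>chambers \<Delta>. \<forall>i<rank E. \<forall>j<rank E.
        (\<Sum>l<rank E. trans E \<sigma> \<sigma>' i l * trans E \<sigma>' \<sigma>'' l j) = trans E \<sigma> \<sigma>'' i j)"

text \<open>
  For a \<open>T\<close>-equivariant line bundle the frame over \<open>U\<^sub>\<sigma>\<close> is a \<open>T\<close>-eigenvector (it is unique
  up to a scalar), and \<open>weight \<sigma>\<close> is its weight. The torus acts on functions by
  \<open>(t f)(p) = f (t\<^sup>-\<^sup>1 p)\<close>, so the function \<open>\<chi>\<^sup>y\<close> has weight \<open>-y\<close>; this gives the exponent
  in the equivariance condition. With these signs a section of weight \<open>x\<close> is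
  a multiple of \<open>\<chi>\<^sup>y\<close> times the frame over \<open>U\<^sub>\<sigma>\<close>, with \<open>y = weight \<sigma> - x\<close>, and it is
  regular if and only if \<open>weight \<sigma> - x\<close> lies in \<open>\<sigma>\<^sup>\<or> \<inter> Y\<close>. Thus for an ample bundle \<open>x\<close>
  occurs if and only if it lies in the polytope with vertices \<open>weight \<sigma>\<close> and in
  \<open>weight \<sigma> + Y\<close>.
\<close>

record 'a line_bundle_data = "'a vector_bundle_data" +
  weight :: "'a set \<Rightarrow> 'a"

definition equivariant_line_bundle ::
    "'a::euclidean_space set \<Rightarrow> 'a line_bundle_data \<Rightarrow> bool" where
  "equivariant_line_bundle \<Delta> L \<longleftrightarrow>
     vector_bundle \<Delta> L \<and> rank L = 1 \<and>
     (\<forall>\<sigma>\<in>chambers \<Delta>. weight L \<sigma> \<in> weight_lattice \<Delta>) \<and>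
     (\<forall>\<sigma>\<in>chambers \<Delta>. \<forall>\<sigma>'\<in>chambers \<Delta>.
        \<exists>c::complex. trans L \<sigma> \<sigma>' 0 0 = Poly_Mapping.single (weight L \<sigma> - weight L \<sigma>') c)"

definition line_bundle_polytope ::
    "'a::euclidean_space set \<Rightarrow> 'a line_bundle_data \<Rightarrow> 'a set" where
  "line_bundle_polytope \<Delta> L = convex hull (weight L ` chambers \<Delta>)"

definition special_ample_line_bundle ::
    "'a::euclidean_space set \<Rightarrow> 'a line_bundle_data \<Rightarrow> bool" where
  "special_ample_line_bundle \<Delta> L \<longleftrightarrow>
     equivariant_line_bundle \<Delta> L \<and>
     special_polytope \<Delta> (weight L) (line_bundle_polytope \<Delta> L)"

definition direct_sum_line_bundles ::
    "nat \<Rightarrow> (nat \<Rightarrow> 'a line_bundle_data) \<Rightarrow> 'a vector_bundle_data" where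
  "direct_sum_line_bundles k L =
     \<lparr>rank = k,
      trans = (\<lambda>\<sigma> \<sigma>' i j. if i = j then trans (L i) \<sigma> \<sigma>' 0 0 else 0)\<rparr>"


section \<open>Sections of symmetric powers\<close>

text \<open>
  The symmetric algebra of the free module with basis \<open>e\<^sub>0, \<dots>, e\<^sub>r\<^sub>-\<^sub>1\<close> over a ring \<open>R\<close>
  is the polynomial ring in these basis elements: \<open>'v \<Rightarrow>\<^sub>0 nat\<close> is the monoid of monomials in
  variables from \<open>'v\<close>, and \<open>('v \<Rightarrow>\<^sub>0 nat) \<Rightarrow>\<^sub>0 'r\<close> its monoid algebra.
\<close>

definition monom_degree :: "('v \<Rightarrow>\<^sub>0 nat) \<Rightarrow> nat" where
  "monom_degree a = (\<Sum>i\<in>Poly_Mapping.keys a. Poly_Mapping.lookup a i)"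

definition sym_free_module :: "'r::zero set \<Rightarrow> nat \<Rightarrow> nat \<Rightarrow> ((nat \<Rightarrow>\<^sub>0 nat) \<Rightarrow>\<^sub>0 'r) set" where
  "sym_free_module R r m =
     {f. \<forall>a\<in>Poly_Mapping.keys f.
           Poly_Mapping.keys a \<subseteq> {..<r} \<and> monom_degree a = m \<and> Poly_Mapping.lookup f a \<in> R}"

text \<open>The map on symmetric algebras induced by the linear map with matrix \<open>g\<close>.\<close>

definition sym_map ::
    "nat \<Rightarrow> (nat \<Rightarrow> nat \<Rightarrow> 'r::comm_ring_1) \<Rightarrow>
     ((nat \<Rightarrow>\<^sub>0 nat) \<Rightarrow>\<^sub>0 'r) \<Rightarrow> ((nat \<Rightarrow>\<^sub>0 nat) \<Rightarrow>\<^sub>0 'r)" where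
  "sym_map r g f =
     (\<Sum>a\<in>Poly_Mapping.keys f. Poly_Mapping.single 0 (Poly_Mapping.lookup f a) *
        (\<Prod>j\<in>Poly_Mapping.keys a.
           (\<Sum>i<r. Poly_Mapping.single (Poly_Mapping.single i 1) (g i j)) ^ Poly_Mapping.lookup a j))"

type_synonym 'a sym_section = "'a set \<Rightarrow> ((nat \<Rightarrow>\<^sub>0 nat) \<Rightarrow>\<^sub>0 ('a \<Rightarrow>\<^sub>0 complex))"

text \<open>
  \<open>H\<^sup>0(V, Sym\<^sup>m(E))\<close>: families of sections over the charts that agree on the overlaps, extended
  by \<open>0\<close> to the sets that are not chambers. They are added and multiplied pointwise.
\<close>

definition H0_Sym ::
    "'a::euclidean_space set \<Rightarrow> ('a, 'm) vector_bundle_data_scheme \<Rightarrow> nat \<Rightarrow> 'a sym_section set" where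
  "H0_Sym \<Delta> E m =
     {s. (\<forall>\<sigma>\<in>chambers \<Delta>. s \<sigma> \<in> sym_free_module (chart_ring \<Delta> \<sigma>) (rank E) m) \<and>
         (\<forall>\<sigma>\<in>chambers \<Delta>. \<forall>\<sigma>'\<in>chambers \<Delta>. s \<sigma> = sym_map (rank E) (trans E \<sigma> \<sigma>') (s \<sigma>')) \<and>
         (\<forall>\<sigma>. \<sigma> \<notin> chambers \<Delta> \<longrightarrow> s \<sigma> = 0)}"

definition constant_section :: "'a::euclidean_space set \<Rightarrow> complex \<Rightarrow> 'a sym_section" where
  "constant_section \<Delta> z =
     (\<lambda>\<sigma>. if \<sigma> \<in> chambers \<Delta> then Poly_Mapping.single 0 (Poly_Mapping.single 0 z) else 0)"


section \<open>Quadratic algebras\<close>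

text \<open>
  A graded \<open>\<complex>\<close>-algebra with \<open>A\<^sub>0 = \<complex>\<close> is given by its graded pieces inside an ambient
  commutative ring and by its structure map \<open>\<iota>\<close> from \<open>\<complex>\<close>. Its unit is \<open>\<iota> 1\<close>, which need
  not be the unit of the ambient ring: the unit of the ring of sections is extended by \<open>0\<close> to
  the sets that are not chambers.
\<close>

definition connected_graded_algebra ::
    "(complex \<Rightarrow> 'b::comm_ring_1) \<Rightarrow> (nat \<Rightarrow> 'b set) \<Rightarrow> bool" where
  "connected_graded_algebra \<iota> A \<longleftrightarrow>
     inj \<iota> \<and> (\<forall>z w. \<iota> (z + w) = \<iota> z + \<iota> w) \<and> (\<forall>z w. \<iota> (z * w) = \<iota> z * \<iota> w) \<and>
     A 0 = range \<iota> \<and>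
     (\<forall>m. 0 \<in> A m) \<and>
     (\<forall>m. \<forall>a\<in>A m. \<forall>b\<in>A m. a + b \<in> A m) \<and>
     (\<forall>m l. \<forall>a\<in>A m. \<forall>b\<in>A l. a * b \<in> A (m + l)) \<and>
     (\<forall>m. \<forall>a\<in>A m. \<iota> 1 * a = a) \<and>
     (\<forall>M a. finite M \<and> (\<forall>m\<in>M. a m \<in> A m) \<and> (\<Sum>m\<in>M. a m) = 0 \<longrightarrow> (\<forall>m\<in>M. a m = 0))"

text \<open>
  \<open>free_alg W\<close> is the polynomial ring over \<open>\<complex>\<close> with one variable \<open>x\<^sub>w\<close> for each \<open>w \<in> W\<close>.
  For a vector space \<open>W\<close>, the symmetric algebra \<open>Sym(W)\<close> is its quotient by the ideal generated
  by \<open>linear_relations\<close>, which identify the linear operations on the variables with those of \<open>W\<close>.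
\<close>

definition free_alg :: "'b set \<Rightarrow> (('b \<Rightarrow>\<^sub>0 nat) \<Rightarrow>\<^sub>0 complex) set" where
  "free_alg W = {f. \<forall>a\<in>Poly_Mapping.keys f. Poly_Mapping.keys a \<subseteq> W}"

definition variable :: "'b \<Rightarrow> (('b \<Rightarrow>\<^sub>0 nat) \<Rightarrow>\<^sub>0 complex)" where
  "variable w = Poly_Mapping.single (Poly_Mapping.single w 1) 1"

definition linear_relations ::
    "(complex \<Rightarrow> 'b::comm_ring_1) \<Rightarrow> 'b set \<Rightarrow> (('b \<Rightarrow>\<^sub>0 nat) \<Rightarrow>\<^sub>0 complex) set" where
  "linear_relations \<iota> W =
     {variable (v + w) - variable v - variable w | v w. v \<in> W \<and> w \<in> W} \<union>
     {variable (\<iota> z * w) - Poly_Mapping.single 0 z * variable w | z w. w \<in> W}"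

definition eval_alg ::
    "(complex \<Rightarrow> 'b::comm_ring_1) \<Rightarrow> (('b \<Rightarrow>\<^sub>0 nat) \<Rightarrow>\<^sub>0 complex) \<Rightarrow> 'b" where
  "eval_alg \<iota> f =
     (\<Sum>a\<in>Poly_Mapping.keys f. \<iota> (Poly_Mapping.lookup f a) *
        (\<Prod>w\<in>Poly_Mapping.keys a. w ^ Poly_Mapping.lookup a w))"

definition ideal_in :: "'r::comm_ring_1 set \<Rightarrow> 'r set \<Rightarrow> 'r set" where
  "ideal_in R S = {\<Sum>g\<in>G. q g * g | G q. finite G \<and> G \<subseteq> S \<and> (\<forall>g\<in>G. q g \<in> R)}"

text \<open>
  In the last clause, the kernel of \<open>Sym(A\<^sub>1) \<rightarrow> A\<close> and the ideal generated by its part of degree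
  two are replaced by their preimages in \<open>free_alg (A 1)\<close>.
\<close>

definition quadratic_algebra ::
    "(complex \<Rightarrow> 'b::comm_ring_1) \<Rightarrow> (nat \<Rightarrow> 'b set) \<Rightarrow> bool" where
  "quadratic_algebra \<iota> A \<longleftrightarrow>
     connected_graded_algebra \<iota> A \<and>
     (\<forall>m. A m \<subseteq> eval_alg \<iota> ` free_alg (A 1)) \<and>
     {f \<in> free_alg (A 1). eval_alg \<iota> f = 0} =
       ideal_in (free_alg (A 1))
         (linear_relations \<iota> (A 1) \<union>
          {f \<in> free_alg (A 1). (\<forall>a\<in>Poly_Mapping.keys f. monom_degree a = 2) \<and> eval_alg \<iota> f = 0})"

end

theory Submission
  imports Defs
begin

text \<open>
  The section of weight \<open>x\<close> of a line bundle with vertices \<open>\<mu>\<close> exists iff \<open>\<mu> \<sigma> - x\<close> is a sum of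
  \<open>\<sigma>\<close>-positive roots for every chamber \<open>\<sigma>\<close>, so the section ring is a semigroup algebra, and it is
  quadratic as soon as (a) every weight of a product of the bundles is a sum of weights of the factors
  and (b) any two decompositions \<open>s = x\<^sub>0 + \<dots> + x\<^sub>m\<^sub>-\<^sub>1\<close> are linked by changing two summands at a time.

  The key fact is that the weights of a special ample bundle are saturated: if \<open>x\<close> is a weight and
  \<open>\<langle>x, \<alpha>\<^sup>\<or>\<rangle> > 0\<close>, then \<open>x - \<alpha>\<close> is a weight. Hence the set of sums in (a) is saturated too, and (a)
  follows by descending from the vertex of the chamber in which \<open>s\<close> is dominant. For (b), let \<open>\<gamma>\<close> be a
  shortest simple root (for that chamber) such that \<open>s\<close> lies strictly below the vertex in direction
  \<open>\<gamma>\<close>. Every decomposition of \<open>s\<close> can be moved to one in which \<open>\<gamma>\<close> can be added to some summand;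
  by induction the resulting decompositions of \<open>s + \<gamma>\<close> are linked, and by saturation a chain of
  moves for \<open>s + \<gamma>\<close> can be pushed down to one for \<open>s\<close>.
\<close>

section \<open>Reflections and chambers\<close>

text \<open>The Weyl group itself never appears: a vector stays fixed and a chamber is chosen in
  which it is dominant, neighbouring chambers being related by one simple reflection. A dominant
  vector is a weight as soon as it lies below the vertex of its own chamber, so saturation has to be
  checked in a single chamber, one where x - \<alpha> is dominant. Only the case of \<alpha>
  negative on that chamber resists, and there the dominance of the vertices on both sides of a wall
  is used. The root \<gamma> in (b) is shortest so that its sums with simple roots meet further
  simple roots with pairing -1, never -2 or -3: a reflection then adds exactly one simple root. The
  induction in (b) ends because adding \<gamma> to a dominant s lengthens it, while a product has
  finitely many weights. A product may repeat a bundle, since Sym^m of the direct sum splits into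
  products indexed by the monomials of degree m in k frame vectors. Two words are compared after
  ordering their factors by bundle index.\<close>

definition reflect :: "'a::euclidean_space \<Rightarrow> 'a \<Rightarrow> 'a" where
  "reflect \<alpha> v = v - (v \<bullet> coroot \<alpha>) *\<^sub>R \<alpha>"

lemma inner_coroot: "v \<bullet> coroot \<alpha> = 2 * (v \<bullet> \<alpha>) / (\<alpha> \<bullet> \<alpha>)"
  by (simp add: coroot_def)

lemma inner_coroot_pos_iff: "\<alpha> \<noteq> 0 \<Longrightarrow> 0 < v \<bullet> coroot \<alpha> \<longleftrightarrow> 0 < v \<bullet> \<alpha>"
  unfolding inner_coroot using pos_less_divide_eq[of "\<alpha> \<bullet> \<alpha>" 0 "2 * (v \<bullet> \<alpha>)"] by simp

lemma inner_coroot_nonneg_iff: "\<alpha> \<noteq> 0 \<Longrightarrow> 0 \<le> v \<bullet> coroot \<alpha> \<longleftrightarrow> 0 \<le> v \<bullet> \<alpha>"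
  unfolding inner_coroot using pos_le_divide_eq[of "\<alpha> \<bullet> \<alpha>" 0 "2 * (v \<bullet> \<alpha>)"] by simp

lemma coroot_self: "\<alpha> \<noteq> 0 \<Longrightarrow> \<alpha> \<bullet> coroot \<alpha> = 2"
  by (simp add: inner_coroot)

lemma coroot_minus: "coroot (- \<alpha>) = - coroot \<alpha>"
  by (simp add: coroot_def)

lemma reflect_minus_root: "reflect (- \<alpha>) v = reflect \<alpha> v"
  by (simp add: reflect_def coroot_minus)

lemma reflect_alt: "reflect \<alpha> v = v - (v \<bullet> \<alpha>) *\<^sub>R coroot \<alpha>"
  by (simp add: reflect_def coroot_def)

lemma reflect_add: "reflect \<alpha> (u + v) = reflect \<alpha> u + reflect \<alpha> v"
  by (simp add: reflect_def algebra_simps)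

lemma reflect_diff: "reflect \<alpha> (u - v) = reflect \<alpha> u - reflect \<alpha> v"
  by (simp add: reflect_def algebra_simps)

lemma reflect_minus: "reflect \<alpha> (- v) = - reflect \<alpha> v"
  by (simp add: reflect_def)

lemma reflect_scaleR: "reflect \<alpha> (r *\<^sub>R v) = r *\<^sub>R reflect \<alpha> v"
  by (simp add: reflect_def algebra_simps)

lemma reflect_self: "\<alpha> \<noteq> 0 \<Longrightarrow> reflect \<alpha> \<alpha> = - \<alpha>"
  by (simp add: reflect_def coroot_self scaleR_2)

lemma reflect_reflect: "\<alpha> \<noteq> 0 \<Longrightarrow> reflect \<alpha> (reflect \<alpha> v) = v"
  by (simp add: reflect_def inner_diff_left coroot_self algebra_simps scaleR_2)

lemma inner_reflect: "u \<bullet> reflect \<alpha> v = reflect \<alpha> u \<bullet> v"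
  by (simp add: reflect_def inner_coroot inner_diff inner_commute)

lemma inner_reflect_reflect: "\<alpha> \<noteq> 0 \<Longrightarrow> reflect \<alpha> u \<bullet> reflect \<alpha> v = u \<bullet> v"
  by (simp add: inner_reflect reflect_reflect)

lemma coroot_reflect: "\<alpha> \<noteq> 0 \<Longrightarrow> coroot (reflect \<alpha> \<beta>) = reflect \<alpha> (coroot \<beta>)"
  by (simp add: coroot_def[of "reflect \<alpha> \<beta>"] coroot_def[of \<beta>] inner_reflect_reflect reflect_scaleR)

lemma Ints_pos_ge_1: "(r::real) \<in> \<int> \<Longrightarrow> 0 < r \<Longrightarrow> 1 \<le> r"
  by (metis Ints_cases of_int_0_less_iff of_int_1_le_iff zless_imp_add1_zle add.left_neutral)

locale reduced_roots =
  fixes \<Delta> :: "'a::euclidean_space set"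
  assumes reduced: "reduced_root_system \<Delta>"
begin

lemma finite_roots: "finite \<Delta>" and zero_not_root: "0 \<notin> \<Delta>" and span_roots: "span \<Delta> = UNIV"
  using reduced by (auto simp: reduced_root_system_def root_system_def)

lemma reflect_root: "\<alpha> \<in> \<Delta> \<Longrightarrow> \<beta> \<in> \<Delta> \<Longrightarrow> reflect \<alpha> \<beta> \<in> \<Delta>"
  using reduced by (auto simp: reduced_root_system_def root_system_def reflect_def)

lemma root_coroot_Ints: "\<alpha> \<in> \<Delta> \<Longrightarrow> \<beta> \<in> \<Delta> \<Longrightarrow> \<beta> \<bullet> coroot \<alpha> \<in> \<int>"
  using reduced by (auto simp: reduced_root_system_def root_system_def)

lemma root_nonzero: "\<alpha> \<in> \<Delta> \<Longrightarrow> \<alpha> \<noteq> 0"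
  using zero_not_root by auto

lemma minus_root: "\<alpha> \<in> \<Delta> \<Longrightarrow> - \<alpha> \<in> \<Delta>"
  using reflect_root[of \<alpha> \<alpha>] reflect_self[of \<alpha>] root_nonzero by fastforce

lemma minus_root_iff: "- \<alpha> \<in> \<Delta> \<longleftrightarrow> \<alpha> \<in> \<Delta>"
  using minus_root[of \<alpha>] minus_root[of "- \<alpha>"] by auto

lemma proportional_roots: "\<alpha> \<in> \<Delta> \<Longrightarrow> t *\<^sub>R \<alpha> \<in> \<Delta> \<Longrightarrow> t = 1 \<or> t = -1"
  using reduced by (auto simp: reduced_root_system_def)

text \<open>A chamber is handled through a regular vector c in its interior, so that sides of
  hyperplanes become signs and reflections act on c. Different c may give the same chamber; positive
  roots, chamber and base depend only on the signs of the roots at c.\<close>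

definition regular :: "'a \<Rightarrow> bool" where
  "regular c \<longleftrightarrow> (\<forall>\<alpha>\<in>\<Delta>. \<alpha> \<bullet> c \<noteq> 0)"

definition pos :: "'a \<Rightarrow> 'a set" where
  "pos c = {\<alpha> \<in> \<Delta>. 0 < \<alpha> \<bullet> c}"

definition chamber :: "'a \<Rightarrow> 'a set" where
  "chamber c = {v. \<forall>\<alpha>\<in>pos c. 0 \<le> \<alpha> \<bullet> v}"

definition open_chamber :: "'a \<Rightarrow> 'a set" where
  "open_chamber c = {v. \<forall>\<alpha>\<in>pos c. 0 < \<alpha> \<bullet> v}"

definition base :: "'a \<Rightarrow> 'a set" where
  "base c = {\<alpha> \<in> pos c. \<not> (\<exists>\<beta>\<in>pos c. \<exists>\<gamma>\<in>pos c. \<alpha> = \<beta> + \<gamma>)}"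

lemma pos_root: "\<alpha> \<in> pos c \<Longrightarrow> \<alpha> \<in> \<Delta>"
  by (simp add: pos_def)

lemma base_pos: "\<alpha> \<in> base c \<Longrightarrow> \<alpha> \<in> pos c"
  by (simp add: base_def)

lemma base_root: "\<alpha> \<in> base c \<Longrightarrow> \<alpha> \<in> \<Delta>"
  by (simp add: base_def pos_def)

lemma finite_pos: "finite (pos c)" and finite_base: "finite (base c)"
  using finite_roots by (auto simp: pos_def base_def)

lemma pos_or_neg: "regular c \<Longrightarrow> \<alpha> \<in> \<Delta> \<Longrightarrow> \<alpha> \<in> pos c \<or> - \<alpha> \<in> pos c"
  by (cases "0 < \<alpha> \<bullet> c") (auto simp: regular_def pos_def minus_root not_less less_le)

lemma not_pos_and_neg: "\<alpha> \<in> pos c \<Longrightarrow> - \<alpha> \<notin> pos c"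
  by (simp add: pos_def)

lemma open_chamber_mem: "c \<in> open_chamber c"
  by (simp add: open_chamber_def pos_def)

lemma open_chamber_subset: "open_chamber c \<subseteq> chamber c"
  by (auto simp: open_chamber_def chamber_def less_imp_le)

lemma open_chamber_Inter: "open_chamber c = (\<Inter>\<alpha>\<in>pos c. {v. 0 < \<alpha> \<bullet> v})"
  by (auto simp: open_chamber_def)

lemma chamber_Inter: "chamber c = (\<Inter>\<alpha>\<in>pos c. {v. 0 \<le> \<alpha> \<bullet> v})"
  by (auto simp: chamber_def)

lemma open_open_chamber: "open (open_chamber c)"
  unfolding open_chamber_Inter by (intro open_INT finite_pos ballI open_halfspace_gt)

lemma closed_chamber: "closed (chamber c)"
  unfolding chamber_Inter by (intro closed_INT ballI closed_halfspace_ge)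

lemma convex_open_chamber: "convex (open_chamber c)"
  unfolding open_chamber_Inter by (intro convex_INT convex_halfspace_gt)

lemma interior_chamber: "interior (chamber c) = open_chamber c"
proof
  show "interior (chamber c) \<subseteq> open_chamber c"
  proof
    fix v assume v: "v \<in> interior (chamber c)"
    have "0 < \<alpha> \<bullet> v" if a: "\<alpha> \<in> pos c" for \<alpha>
    proof -
      have "chamber c \<subseteq> {v. \<alpha> \<bullet> v \<ge> 0}" using a by (auto simp: chamber_def)
      then have "v \<in> interior {v. \<alpha> \<bullet> v \<ge> 0}" using v interior_mono by blast
      then show ?thesis using interior_halfspace_ge[OF root_nonzero[OF pos_root[OF a]]] by simp
    qed
    then show "v \<in> open_chamber c" by (simp add: open_chamber_def)
  qed
next
  show "open_chamber c \<subseteq> interior (chamber c)"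
    by (simp add: interior_maximal open_chamber_subset open_open_chamber)
qed

lemma closure_open_chamber: "closure (open_chamber c) = chamber c"
proof
  show "closure (open_chamber c) \<subseteq> chamber c"
    by (simp add: closure_minimal open_chamber_subset closed_chamber)
next
  show "chamber c \<subseteq> closure (open_chamber c)"
  proof
    fix v assume v: "v \<in> chamber c"
    define f where "f n = v + (1 / real (Suc n)) *\<^sub>R c" for n
    have "f n \<in> open_chamber c" for n
    proof -
      have "0 < \<alpha> \<bullet> v + (1 / real (Suc n)) * (\<alpha> \<bullet> c)" if "\<alpha> \<in> pos c" for \<alpha>
      proof -
        have "0 < \<alpha> \<bullet> c" "0 \<le> \<alpha> \<bullet> v" using that v by (auto simp: pos_def chamber_def)
        then show ?thesis by (intro add_nonneg_pos) (auto intro!: divide_pos_pos)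
      qed
      then show ?thesis by (simp add: open_chamber_def f_def inner_add_right)
    qed
    moreover have "f \<longlonglongrightarrow> v + 0 *\<^sub>R c" unfolding f_def
      by (intro tendsto_add tendsto_const tendsto_scaleR LIMSEQ_Suc[OF lim_1_over_n])
    ultimately show "v \<in> closure (open_chamber c)"
      by (auto simp: closure_sequential)
  qed
qed

text \<open>A connected set avoiding the hyperplanes cannot change the sign of a root, by the
  intermediate value theorem; conversely the open chamber is convex and avoids them because c is
  regular.\<close>

lemma connected_component_regular:
  assumes c: "regular c"
  shows "connected_component_set (UNIV - (\<Union>\<alpha>\<in>\<Delta>. {v. \<alpha> \<bullet> v = 0})) c = open_chamber c"
    (is "connected_component_set ?U c = _")
proof
  show "connected_component_set ?U c \<subseteq> open_chamber c"
  proof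
    fix v assume "v \<in> connected_component_set ?U c"
    then obtain t where t: "connected t" "t \<subseteq> ?U" "c \<in> t" "v \<in> t"
      by (auto simp: connected_component_def)
    have "0 < \<alpha> \<bullet> v" if a: "\<alpha> \<in> pos c" for \<alpha>
    proof (rule ccontr)
      assume "\<not> 0 < \<alpha> \<bullet> v"
      then obtain z where "z \<in> t" "\<alpha> \<bullet> z = 0"
        using connected_ivt_hyperplane[OF t(1,4,3), of \<alpha> 0] a by (auto simp: pos_def)
      then show False using t(2) a by (auto simp: pos_def)
    qed
    then show "v \<in> open_chamber c" by (simp add: open_chamber_def)
  qed
next
  have "open_chamber c \<subseteq> ?U"
  proof
    fix v assume v: "v \<in> open_chamber c"
    have "\<alpha> \<bullet> v \<noteq> 0" if "\<alpha> \<in> \<Delta>" for \<alpha>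
      using pos_or_neg[OF c that] v by (force simp: open_chamber_def)
    then show "v \<in> ?U" by auto
  qed
  then show "open_chamber c \<subseteq> connected_component_set ?U c"
    using connected_component_maximal[OF open_chamber_mem convex_connected[OF convex_open_chamber]]
    by blast
qed

lemma chambers_eq: "chambers \<Delta> = chamber ` {c. regular c}"
proof -
  let ?U = "UNIV - (\<Union>\<alpha>\<in>\<Delta>. {v. \<alpha> \<bullet> v = 0})"
  have U: "?U = {c. regular c}" by (auto simp: regular_def)
  have "components ?U = (\<lambda>c. connected_component_set ?U c) ` {c. regular c}"
    unfolding components_def U[symmetric] by blast
  also have "\<dots> = open_chamber ` {c. regular c}"
    by (intro image_cong refl connected_component_regular) simp
  finally have "components ?U = open_chamber ` {c. regular c}" .
  then show ?thesis unfolding chambers_def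
    by (simp only: image_image closure_open_chamber)
qed

lemma positive_roots_chamber: "positive_roots \<Delta> (chamber c) = pos c"
proof
  show "positive_roots \<Delta> (chamber c) \<subseteq> pos c"
    unfolding positive_roots_def interior_chamber pos_def using open_chamber_mem by blast
  show "pos c \<subseteq> positive_roots \<Delta> (chamber c)"
    unfolding positive_roots_def interior_chamber open_chamber_def using pos_root by blast
qed

lemma simple_roots_chamber: "simple_roots \<Delta> (chamber c) = base c"
  by (simp add: simple_roots_def positive_roots_chamber base_def)

end

section \<open>Simple roots\<close>

text \<open>Real values are not well founded, but on a finite set the number of elements of smaller
  value is a natural number. It is the measure of several inductions below, over roots and over
  weights.\<close>

lemma card_filter_less:
  fixes f :: "'b \<Rightarrow> 'c::linorder"
  assumes "finite A" "x \<in> A" "f x < t"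
  shows "card {a \<in> A. f a < f x} < card {a \<in> A. f a < t}"
proof (rule psubset_card_mono)
  have "x \<in> {a \<in> A. f a < t}" "x \<notin> {a \<in> A. f a < f x}" using assms by auto
  moreover have "{a \<in> A. f a < f x} \<subseteq> {a \<in> A. f a < t}" using assms by auto
  ultimately show "{a \<in> A. f a < f x} \<subset> {a \<in> A. f a < t}" by blast
qed (use assms in simp)

context reduced_roots begin

text \<open>One of the integers \<open>\<alpha> \<bullet> coroot \<beta>\<close> and
  \<open>\<beta> \<bullet> coroot \<alpha>\<close> is 1, and the corresponding reflection gives the
  difference up to sign. If both were at least 2, Cauchy-Schwarz would be an equality, the roots
  proportional, and reducedness would make them equal.\<close>

lemma root_diff:
  assumes "\<alpha> \<in> \<Delta>" "\<beta> \<in> \<Delta>" "\<alpha> \<noteq> \<beta>" "0 < \<alpha> \<bullet> \<beta>"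
  shows "\<alpha> - \<beta> \<in> \<Delta>"
proof -
  have nz: "\<alpha> \<noteq> 0" "\<beta> \<noteq> 0" using assms root_nonzero by auto
  then have sq: "0 < \<alpha> \<bullet> \<alpha>" "0 < \<beta> \<bullet> \<beta>" by auto
  have a: "\<alpha> \<bullet> coroot \<beta> \<in> \<int>" "0 < \<alpha> \<bullet> coroot \<beta>"
    and b: "\<beta> \<bullet> coroot \<alpha> \<in> \<int>" "0 < \<beta> \<bullet> coroot \<alpha>"
    using assms nz root_coroot_Ints by (auto simp: inner_coroot_pos_iff inner_commute)
  consider "\<alpha> \<bullet> coroot \<beta> = 1" | "\<beta> \<bullet> coroot \<alpha> = 1" | "2 \<le> \<alpha> \<bullet> coroot \<beta>" "2 \<le> \<beta> \<bullet> coroot \<alpha>"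
  proof -
    have "r = 1 \<or> 2 \<le> r" if "r \<in> \<int>" "0 < r" for r :: real
      using that by (auto elim!: Ints_cases)
    then show ?thesis using that a b by blast
  qed
  then show ?thesis
  proof cases
    case 1
    then have "reflect \<beta> \<alpha> = \<alpha> - \<beta>" by (simp add: reflect_def)
    then show ?thesis using reflect_root assms by metis
  next
    case 2
    then have "reflect \<alpha> \<beta> = \<beta> - \<alpha>" by (simp add: reflect_def)
    then show ?thesis using reflect_root assms minus_root by (metis minus_diff_eq)
  next
    case 3
    have "\<beta> \<bullet> \<beta> \<le> \<alpha> \<bullet> \<beta>" "\<alpha> \<bullet> \<alpha> \<le> \<alpha> \<bullet> \<beta>"
      using 3 sq by (auto simp: inner_coroot field_simps inner_commute)
    then have "norm \<alpha> ^ 2 * norm \<beta> ^ 2 \<le> (\<alpha> \<bullet> \<beta>) * (\<alpha> \<bullet> \<beta>)"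
      using assms(4) sq by (intro mult_mono) (auto simp: dot_square_norm)
    then have "(norm \<alpha> * norm \<beta>) ^ 2 \<le> (\<alpha> \<bullet> \<beta>) ^ 2"
      by (simp add: power2_eq_square algebra_simps)
    then have "norm \<alpha> * norm \<beta> \<le> \<alpha> \<bullet> \<beta>"
      using assms(4) power2_le_imp_le by fastforce
    then have "\<alpha> \<bullet> \<beta> = norm \<alpha> * norm \<beta>"
      using norm_cauchy_schwarz[of \<alpha> \<beta>] by linarith
    then have eq: "norm \<alpha> *\<^sub>R \<beta> = norm \<beta> *\<^sub>R \<alpha>" by (simp add: norm_cauchy_schwarz_eq)
    then have "(norm \<beta> / norm \<alpha>) *\<^sub>R \<alpha> = (1 / norm \<alpha>) *\<^sub>R (norm \<alpha> *\<^sub>R \<beta>)" by (simp add: divide_inverse mult.commute)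
    also have "\<dots> = \<beta>" using nz by simp
    finally have p: "(norm \<beta> / norm \<alpha>) *\<^sub>R \<alpha> = \<beta>" .
    then have "norm \<beta> / norm \<alpha> = 1 \<or> norm \<beta> / norm \<alpha> = -1"
      using proportional_roots[of \<alpha> "norm \<beta> / norm \<alpha>"] assms by simp
    moreover have "0 < norm \<beta> / norm \<alpha>" using nz by simp
    ultimately have "norm \<beta> / norm \<alpha> = 1" by linarith
    then have "\<alpha> = \<beta>" using p by (metis scaleR_one)
    then show ?thesis using assms(3) by blast
  qed
qed

text \<open>Otherwise the difference would be a root, hence plus or minus a positive one, and one of
  the two simple roots would split as a sum of positive roots.\<close>

lemma base_obtuse:
  assumes c: "regular c" and "\<gamma> \<in> base c" "\<delta> \<in> base c" "\<gamma> \<noteq> \<delta>"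
  shows "\<gamma> \<bullet> \<delta> \<le> 0"
proof (rule ccontr)
  assume "\<not> \<gamma> \<bullet> \<delta> \<le> 0"
  then have "\<gamma> - \<delta> \<in> \<Delta>" using root_diff assms base_root by auto
  then consider "\<gamma> - \<delta> \<in> pos c" | "\<delta> - \<gamma> \<in> pos c"
    using pos_or_neg[OF c] by fastforce
  then show False
  proof cases
    case 1
    moreover have "\<gamma> = (\<gamma> - \<delta>) + \<delta>" by simp
    ultimately show False using assms base_pos unfolding base_def by blast
  next
    case 2
    moreover have "\<delta> = (\<delta> - \<gamma>) + \<gamma>" by simp
    ultimately show False using assms base_pos unfolding base_def by blast
  qed
qed

text \<open>A positive root that is not simple is a sum of two positive roots, both with smaller
  value at c.\<close>

lemma pos_nat_comb:
  assumes "\<beta> \<in> pos c"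
  shows "\<exists>n::'a \<Rightarrow> nat. \<beta> = (\<Sum>\<gamma>\<in>base c. real (n \<gamma>) *\<^sub>R \<gamma>)"
  using assms
proof (induction "card {\<alpha> \<in> pos c. \<alpha> \<bullet> c < \<beta> \<bullet> c}" arbitrary: \<beta> rule: less_induct)
  case less
  show ?case
  proof (cases "\<beta> \<in> base c")
    case True
    have "(\<Sum>\<gamma>\<in>base c. real (if \<gamma> = \<beta> then 1 else 0) *\<^sub>R \<gamma>) = (\<Sum>\<gamma>\<in>base c. if \<gamma> = \<beta> then \<gamma> else 0)"
      by (intro sum.cong) auto
    also have "\<dots> = \<beta>" using True finite_base by simp
    finally show ?thesis by (intro exI[of _ "\<lambda>\<gamma>. if \<gamma> = \<beta> then 1 else 0"]) simp
  next
    case False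
    then obtain \<delta> \<epsilon> where d: "\<delta> \<in> pos c" "\<epsilon> \<in> pos c" "\<beta> = \<delta> + \<epsilon>"
      using less.prems by (auto simp: base_def)
    have sm: "card {\<alpha> \<in> pos c. \<alpha> \<bullet> c < \<eta> \<bullet> c} < card {\<alpha> \<in> pos c. \<alpha> \<bullet> c < \<beta> \<bullet> c}"
      if "\<eta> \<in> pos c" "\<eta> \<bullet> c < \<beta> \<bullet> c" for \<eta>
      using card_filter_less[OF finite_pos that(1), of "\<lambda>\<alpha>. \<alpha> \<bullet> c"] that(2) by blast
    have "\<delta> \<bullet> c < \<beta> \<bullet> c" "\<epsilon> \<bullet> c < \<beta> \<bullet> c"
      using d by (auto simp: inner_add_left pos_def)
    then obtain m n :: "'a \<Rightarrow> nat" where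
      "\<delta> = (\<Sum>\<gamma>\<in>base c. real (m \<gamma>) *\<^sub>R \<gamma>)" "\<epsilon> = (\<Sum>\<gamma>\<in>base c. real (n \<gamma>) *\<^sub>R \<gamma>)"
      using less.hyps[OF sm[OF d(1)] d(1)] less.hyps[OF sm[OF d(2)] d(2)] by blast
    then have "\<beta> = (\<Sum>\<gamma>\<in>base c. real (m \<gamma> + n \<gamma>) *\<^sub>R \<gamma>)"
      using d by (simp add: scaleR_add_left sum.distrib)
    then show ?thesis by (intro exI)
  qed
qed

text \<open>\<open>uv\<close> says that the two combinations have disjoint supports, so only
  products of distinct simple roots contribute. It is applied to the positive and negative parts of
  one vector.\<close>

lemma obtuse_sum:
  assumes c: "regular c" and u: "\<And>\<gamma>. \<gamma> \<in> base c \<Longrightarrow> 0 \<le> u \<gamma>" and v: "\<And>\<gamma>. \<gamma> \<in> base c \<Longrightarrow> 0 \<le> v \<gamma>"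
    and uv: "\<And>\<gamma>. \<gamma> \<in> base c \<Longrightarrow> u \<gamma> * v \<gamma> = (0::real)"
  shows "(\<Sum>\<gamma>\<in>base c. u \<gamma> *\<^sub>R \<gamma>) \<bullet> (\<Sum>\<gamma>\<in>base c. v \<gamma> *\<^sub>R \<gamma>) \<le> 0"
proof -
  have "u \<gamma> * (v \<delta> * (\<gamma> \<bullet> \<delta>)) \<le> 0" if "\<gamma> \<in> base c" "\<delta> \<in> base c" for \<gamma> \<delta>
  proof (cases "\<gamma> = \<delta>")
    case True
    then show ?thesis using uv[OF that(1)] by auto
  next
    case False
    then show ?thesis using u[OF that(1)] v[OF that(2)] base_obtuse[OF c that]
      by (intro mult_nonneg_nonpos)
  qed
  then have "(\<Sum>\<gamma>\<in>base c. \<Sum>\<delta>\<in>base c. u \<gamma> * (v \<delta> * (\<gamma> \<bullet> \<delta>))) \<le> 0"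
    by (intro sum_nonpos)
  then show ?thesis
    by (subst (asm) sum.swap) (simp add: inner_sum_left inner_sum_right sum_distrib_left mult.left_commute)
qed

text \<open>The positive and negative parts of a relation are equal and, having disjoint supports,
  have nonpositive product, so both vanish; pairing with c, where all simple roots are positive,
  then kills the coefficients.\<close>

lemma base_independent:
  assumes c: "regular c"
  shows "independent (base c)"
proof (rule independent_if_scalars_zero[OF finite_base])
  fix f :: "'a \<Rightarrow> real" and x
  assume f: "(\<Sum>\<gamma>\<in>base c. f \<gamma> *\<^sub>R \<gamma>) = 0" and x: "x \<in> base c"
  let ?u = "\<lambda>\<gamma>. max 0 (f \<gamma>)" and ?v = "\<lambda>\<gamma>. max 0 (- f \<gamma>)"
  let ?U = "\<Sum>\<gamma>\<in>base c. ?u \<gamma> *\<^sub>R \<gamma>" and ?V = "\<Sum>\<gamma>\<in>base c. ?v \<gamma> *\<^sub>R \<gamma>"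
  have "?U - ?V = (\<Sum>\<gamma>\<in>base c. f \<gamma> *\<^sub>R \<gamma>)"
    unfolding sum_subtractf[symmetric] by (intro sum.cong) (auto simp: max_def)
  then have UV: "?U = ?V" using f by simp
  have "?U \<bullet> ?V \<le> 0"
    by (rule obtuse_sum[OF c]) (auto simp: max_def)
  then have "?U \<bullet> ?U \<le> 0" using UV by simp
  then have "?U \<bullet> ?U = 0" using inner_ge_zero[of ?U] by (rule antisym)
  then have "?U = 0" by (simp only: inner_eq_zero_iff)
  have z: "w x = 0" if w: "\<And>\<gamma>. 0 \<le> w \<gamma>" and W: "(\<Sum>\<gamma>\<in>base c. w \<gamma> *\<^sub>R \<gamma>) = 0" for w :: "'a \<Rightarrow> real"
  proof -
    have p: "0 < \<gamma> \<bullet> c" if "\<gamma> \<in> base c" for \<gamma> using that by (simp add: base_def pos_def)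
    have "(\<Sum>\<gamma>\<in>base c. w \<gamma> * (\<gamma> \<bullet> c)) = (\<Sum>\<gamma>\<in>base c. w \<gamma> *\<^sub>R \<gamma>) \<bullet> c"
      by (simp add: inner_sum_left)
    also have "\<dots> = 0" using W by simp
    finally have "w x * (x \<bullet> c) = 0"
      using sum_nonneg_eq_0_iff[OF finite_base, of c "\<lambda>\<gamma>. w \<gamma> * (\<gamma> \<bullet> c)"] w p x
      by (simp add: less_imp_le)
    then show ?thesis using p[OF x] by simp
  qed
  have "?u x = 0" "?v x = 0" using z[of ?u] z[of ?v] \<open>?U = 0\<close> UV by (simp_all del: max_less_iff_conj)
  then show "f x = 0" by (auto simp: max_def split: if_splits)
qed

lemma base_span:
  assumes c: "regular c"
  shows "span (base c) = UNIV"
proof -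
  have pos: "\<beta> \<in> span (base c)" if "\<beta> \<in> pos c" for \<beta>
    using pos_nat_comb[OF that] by (auto intro: span_sum span_scale span_base)
  have "\<beta> \<in> span (base c)" if "\<beta> \<in> \<Delta>" for \<beta>
    using pos_or_neg[OF c that] pos[of \<beta>] pos[of "- \<beta>"] span_neg[of "- \<beta>" "base c"]
    by (metis minus_minus)
  then have "span \<Delta> \<subseteq> span (base c)"
    by (intro span_minimal) (auto simp: subspace_span)
  then show ?thesis using span_roots by auto
qed

text \<open>The fundamental coweights, seen through the inner product: the basis dual to the simple
  roots. Thus \<open>coord c x \<gamma>\<close> is the coefficient of \<gamma> in x.\<close>

definition coweight :: "'a \<Rightarrow> 'a \<Rightarrow> 'a" where
  "coweight c \<gamma> = (SOME v. \<forall>\<delta>\<in>base c. \<delta> \<bullet> v = (if \<delta> = \<gamma> then 1 else 0))"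

abbreviation coord :: "'a \<Rightarrow> 'a \<Rightarrow> 'a \<Rightarrow> real" where
  "coord c x \<gamma> \<equiv> x \<bullet> coweight c \<gamma>"

lemma base_coweight:
  assumes c: "regular c" and d: "\<delta> \<in> base c"
  shows "coord c \<delta> \<gamma> = (if \<delta> = \<gamma> then 1 else 0)"
proof -
  obtain g where g: "linear g" "\<And>x. x \<in> base c \<Longrightarrow> g x = (if x = \<gamma> then 1 else (0::real))"
    using linear_independent_extend[OF base_independent[OF c], of "\<lambda>x. if x = \<gamma> then 1 else 0"] by blast
  have "\<exists>v. \<forall>\<delta>\<in>base c. \<delta> \<bullet> v = (if \<delta> = \<gamma> then 1 else 0)"
  proof (intro exI ballI)
    fix \<delta> assume "\<delta> \<in> base c"
    then show "\<delta> \<bullet> adjoint g 1 = (if \<delta> = \<gamma> then 1 else 0)"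
      using adjoint_works[OF g(1), of \<delta> 1] g(2)[of \<delta>] by simp
  qed
  from someI_ex[OF this] show ?thesis using d unfolding coweight_def by (rule bspec)
qed

lemma base_sum_coweight:
  assumes c: "regular c" and d: "\<delta> \<in> base c"
  shows "coord c (\<Sum>\<gamma>\<in>base c. u \<gamma> *\<^sub>R \<gamma>) \<delta> = u \<delta>"
proof -
  have "coord c (\<Sum>\<gamma>\<in>base c. u \<gamma> *\<^sub>R \<gamma>) \<delta> = (\<Sum>\<gamma>\<in>base c. u \<gamma> * (coord c \<gamma> \<delta>))"
    by (simp add: inner_sum_left)
  also have "\<dots> = (\<Sum>\<gamma>\<in>base c. if \<gamma> = \<delta> then u \<gamma> else 0)"
    by (intro sum.cong) (auto simp: base_coweight[OF c])
  also have "\<dots> = u \<delta>" using d finite_base by simp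
  finally show ?thesis .
qed

lemma base_expansion:
  assumes c: "regular c"
  shows "x = (\<Sum>\<gamma>\<in>base c. coord c x \<gamma> *\<^sub>R \<gamma>)"
proof -
  have "x \<in> span (base c)" using base_span[OF c] by simp
  then obtain u where x: "x = (\<Sum>\<gamma>\<in>base c. u \<gamma> *\<^sub>R \<gamma>)"
    by (auto simp: span_finite[OF finite_base])
  have "coord c x \<delta> = u \<delta>" if "\<delta> \<in> base c" for \<delta>
    unfolding x by (rule base_sum_coweight[OF c that])
  then show ?thesis using x by simp
qed

lemma inner_base_expansion:
  assumes c: "regular c"
  shows "x \<bullet> y = (\<Sum>\<gamma>\<in>base c. coord c x \<gamma> * (\<gamma> \<bullet> y))"
proof -
  have "x \<bullet> y = (\<Sum>\<gamma>\<in>base c. coord c x \<gamma> *\<^sub>R \<gamma>) \<bullet> y"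
    using base_expansion[OF c, of x] by simp
  then show ?thesis by (simp add: inner_sum_left)
qed

lemma eq_0_if_coords_0:
  assumes c: "regular c" and "\<And>\<gamma>. \<gamma> \<in> base c \<Longrightarrow> coord c x \<gamma> = 0"
  shows "x = 0"
  using base_expansion[OF c, of x] assms(2) by simp

lemma pos_coords:
  assumes c: "regular c" and b: "\<beta> \<in> pos c" and g: "\<gamma> \<in> base c"
  shows "0 \<le> coord c \<beta> \<gamma>" "coord c \<beta> \<gamma> \<in> \<int>"
proof -
  obtain n :: "'a \<Rightarrow> nat" where n: "\<beta> = (\<Sum>\<gamma>\<in>base c. real (n \<gamma>) *\<^sub>R \<gamma>)"
    using pos_nat_comb[OF b] by blast
  have "coord c \<beta> \<gamma> = real (n \<gamma>)" unfolding n by (rule base_sum_coweight[OF c g])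
  then show "0 \<le> coord c \<beta> \<gamma>" "coord c \<beta> \<gamma> \<in> \<int>" by auto
qed

lemma root_coords_Ints:
  assumes c: "regular c" and b: "\<beta> \<in> \<Delta>" and g: "\<gamma> \<in> base c"
  shows "coord c \<beta> \<gamma> \<in> \<int>"
  using pos_or_neg[OF c b] pos_coords(2)[OF c _ g, of \<beta>] pos_coords(2)[OF c _ g, of "- \<beta>"]
  by (metis inner_minus_left minus_in_Ints_iff)

section \<open>The root lattice and the dual cone of a chamber in simple root coordinates\<close>

lemma root_latticeI: "(\<Sum>\<alpha>\<in>\<Delta>. of_int (n \<alpha>) *\<^sub>R \<alpha>) \<in> root_lattice \<Delta>"
  unfolding root_lattice_def by blast

text \<open>The simple roots of any one chamber form a basis of the root lattice over the integers,
  because every root has integral coordinates.\<close>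

lemma root_lattice_iff:
  assumes c: "regular c"
  shows "x \<in> root_lattice \<Delta> \<longleftrightarrow> (\<forall>\<gamma>\<in>base c. coord c x \<gamma> \<in> \<int>)"
proof
  assume "x \<in> root_lattice \<Delta>"
  then obtain n :: "'a \<Rightarrow> int" where x: "x = (\<Sum>\<alpha>\<in>\<Delta>. of_int (n \<alpha>) *\<^sub>R \<alpha>)"
    by (auto simp: root_lattice_def)
  show "\<forall>\<gamma>\<in>base c. coord c x \<gamma> \<in> \<int>"
    unfolding x using root_coords_Ints[OF c] by (auto simp: inner_sum_left intro!: Ints_sum Ints_mult)
next
  assume a: "\<forall>\<gamma>\<in>base c. coord c x \<gamma> \<in> \<int>"
  define n where "n \<alpha> = (if \<alpha> \<in> base c then \<lfloor>coord c x \<alpha>\<rfloor> else 0)" for \<alpha>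
  have "(\<Sum>\<alpha>\<in>\<Delta>. of_int (n \<alpha>) *\<^sub>R \<alpha>) = (\<Sum>\<alpha>\<in>base c. of_int (n \<alpha>) *\<^sub>R \<alpha>)"
    by (intro sum.mono_neutral_right) (auto simp: finite_roots base_root n_def)
  also have "\<dots> = (\<Sum>\<alpha>\<in>base c. coord c x \<alpha> *\<^sub>R \<alpha>)"
    using a by (intro sum.cong) (auto simp: n_def)
  also have "\<dots> = x" using base_expansion[OF c, of x] by simp
  finally show "x \<in> root_lattice \<Delta>" using root_latticeI[of n] by simp
qed

lemma root_lattice_add: "x \<in> root_lattice \<Delta> \<Longrightarrow> y \<in> root_lattice \<Delta> \<Longrightarrow> x + y \<in> root_lattice \<Delta>"
proof -
  assume "x \<in> root_lattice \<Delta>" "y \<in> root_lattice \<Delta>"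
  then obtain m n :: "'a \<Rightarrow> int" where
    "x = (\<Sum>\<alpha>\<in>\<Delta>. of_int (m \<alpha>) *\<^sub>R \<alpha>)" "y = (\<Sum>\<alpha>\<in>\<Delta>. of_int (n \<alpha>) *\<^sub>R \<alpha>)"
    by (auto simp: root_lattice_def)
  then have "x + y = (\<Sum>\<alpha>\<in>\<Delta>. of_int (m \<alpha> + n \<alpha>) *\<^sub>R \<alpha>)"
    by (simp add: scaleR_add_left sum.distrib)
  then show ?thesis by (simp only: root_latticeI)
qed

lemma root_lattice_scale: "x \<in> root_lattice \<Delta> \<Longrightarrow> of_int k *\<^sub>R x \<in> root_lattice \<Delta>"
proof -
  assume "x \<in> root_lattice \<Delta>"
  then obtain m :: "'a \<Rightarrow> int" where "x = (\<Sum>\<alpha>\<in>\<Delta>. of_int (m \<alpha>) *\<^sub>R \<alpha>)"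
    by (auto simp: root_lattice_def)
  then have "of_int k *\<^sub>R x = (\<Sum>\<alpha>\<in>\<Delta>. of_int (k * m \<alpha>) *\<^sub>R \<alpha>)"
    by (simp add: scaleR_sum_right)
  then show ?thesis by (simp only: root_latticeI)
qed

lemma root_lattice_0: "0 \<in> root_lattice \<Delta>"
  unfolding root_lattice_def by (rule CollectI, rule exI[of _ "\<lambda>_. 0"]) simp

lemma root_lattice_minus: "x \<in> root_lattice \<Delta> \<Longrightarrow> - x \<in> root_lattice \<Delta>"
  using root_lattice_scale[of x "-1"] by simp

lemma root_lattice_diff: "x \<in> root_lattice \<Delta> \<Longrightarrow> y \<in> root_lattice \<Delta> \<Longrightarrow> x - y \<in> root_lattice \<Delta>"
  using root_lattice_add[of x "- y"] root_lattice_minus[of y] by simp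

lemma root_in_root_lattice: "\<alpha> \<in> \<Delta> \<Longrightarrow> \<alpha> \<in> root_lattice \<Delta>"
proof -
  assume a: "\<alpha> \<in> \<Delta>"
  have "(\<Sum>\<beta>\<in>\<Delta>. of_int (if \<beta> = \<alpha> then 1 else 0) *\<^sub>R \<beta>) = (\<Sum>\<beta>\<in>\<Delta>. if \<beta> = \<alpha> then \<beta> else 0)"
    by (intro sum.cong) auto
  also have "\<dots> = \<alpha>" using a finite_roots by simp
  finally show ?thesis unfolding root_lattice_def
    by (intro CollectI exI[of _ "\<lambda>\<beta>. if \<beta> = \<alpha> then 1 else 0"]) simp
qed

lemma root_lattice_coroot_Ints: "x \<in> root_lattice \<Delta> \<Longrightarrow> \<alpha> \<in> \<Delta> \<Longrightarrow> x \<bullet> coroot \<alpha> \<in> \<int>"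
  using root_coroot_Ints unfolding root_lattice_def
  by (auto simp: inner_sum_left intro!: Ints_sum Ints_mult)

lemma weight_lattice_diff_root_lattice:
  assumes "x \<in> weight_lattice \<Delta>" "x - y \<in> root_lattice \<Delta>"
  shows "y \<in> weight_lattice \<Delta>"
proof -
  have "y \<bullet> coroot \<alpha> \<in> \<int>" if "\<alpha> \<in> \<Delta>" for \<alpha>
  proof -
    have "y \<bullet> coroot \<alpha> = x \<bullet> coroot \<alpha> - (x - y) \<bullet> coroot \<alpha>" by (simp add: inner_diff_left)
    then show ?thesis
      using assms that root_lattice_coroot_Ints by (auto simp: weight_lattice_def)
  qed
  then show ?thesis by (simp add: weight_lattice_def)
qed

lemma pos_base_inner_nonneg:
  assumes c: "regular c" and "\<And>\<gamma>. \<gamma> \<in> base c \<Longrightarrow> 0 \<le> \<gamma> \<bullet> v" and "\<beta> \<in> pos c"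
  shows "0 \<le> \<beta> \<bullet> v"
proof -
  have "0 \<le> (\<Sum>\<gamma>\<in>base c. coord c \<beta> \<gamma> * (\<gamma> \<bullet> v))"
    using assms(2) pos_coords(1)[OF c assms(3)] by (intro sum_nonneg mult_nonneg_nonneg)
  then show ?thesis using inner_base_expansion[OF c, of \<beta> v] by simp
qed

lemma chamber_base: "regular c \<Longrightarrow> v \<in> chamber c \<longleftrightarrow> (\<forall>\<gamma>\<in>base c. 0 \<le> \<gamma> \<bullet> v)"
  using pos_base_inner_nonneg base_pos by (auto simp: chamber_def)

text \<open>The coweights lie in the chamber and test the coordinates one by one; conversely simple
  roots are nonnegative on the chamber. The dual cone is thus generated by the simple roots.\<close>

lemma dual_cone_chamber:
  assumes c: "regular c"
  shows "x \<in> dual_cone (chamber c) \<longleftrightarrow> (\<forall>\<gamma>\<in>base c. 0 \<le> coord c x \<gamma>)"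
proof
  assume x: "x \<in> dual_cone (chamber c)"
  have "coweight c \<gamma> \<in> chamber c" if "\<gamma> \<in> base c" for \<gamma>
    using that by (simp add: chamber_base[OF c] base_coweight[OF c])
  then show "\<forall>\<gamma>\<in>base c. 0 \<le> coord c x \<gamma>" using x by (simp add: dual_cone_def)
next
  assume "\<forall>\<gamma>\<in>base c. 0 \<le> coord c x \<gamma>"
  then have "0 \<le> (\<Sum>\<gamma>\<in>base c. coord c x \<gamma> * (\<gamma> \<bullet> v))" if "v \<in> chamber c" for v
    using that by (intro sum_nonneg mult_nonneg_nonneg) (simp_all add: chamber_base[OF c])
  then have "0 \<le> x \<bullet> v" if "v \<in> chamber c" for v
    using that inner_base_expansion[OF c, of x v] by simp
  then show "x \<in> dual_cone (chamber c)" by (simp add: dual_cone_def)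
qed

text \<open>By reducedness a positive root other than \<gamma> involves a second simple root; its
  positive coefficient survives the reflection, and the coefficients of a root never have opposite
  signs.\<close>

lemma reflect_pos:
  assumes c: "regular c" and g: "\<gamma> \<in> base c" and b: "\<beta> \<in> pos c" "\<beta> \<noteq> \<gamma>"
  shows "reflect \<gamma> \<beta> \<in> pos c"
proof -
  have "\<exists>\<delta>\<in>base c. \<delta> \<noteq> \<gamma> \<and> 0 < coord c \<beta> \<delta>"
  proof (rule ccontr)
    assume "\<not> ?thesis"
    then have z: "coord c \<beta> \<delta> = 0" if "\<delta> \<in> base c" "\<delta> \<noteq> \<gamma>" for \<delta>
      using that pos_coords(1)[OF c b(1), of \<delta>] by force
    have "\<beta> = (\<Sum>\<delta>\<in>base c. coord c \<beta> \<delta> *\<^sub>R \<delta>)" by (rule base_expansion[OF c])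
    also have "\<dots> = (\<Sum>\<delta>\<in>base c. if \<delta> = \<gamma> then (coord c \<beta> \<gamma>) *\<^sub>R \<gamma> else 0)"
      by (intro sum.cong refl) (simp add: z)
    finally have eq: "\<beta> = coord c \<beta> \<gamma> *\<^sub>R \<gamma>" using g finite_base by (simp only: sum.delta if_True)
    then have "coord c \<beta> \<gamma> = 1 \<or> coord c \<beta> \<gamma> = -1"
      using proportional_roots[OF base_root[OF g], of "coord c \<beta> \<gamma>"] pos_root[OF b(1)] by simp
    then have "coord c \<beta> \<gamma> = 1" using pos_coords(1)[OF c b(1) g] by auto
    then have "\<beta> = \<gamma>" using eq by (metis scaleR_one)
    then show False using b(2) by blast
  qed
  then obtain \<delta> where d: "\<delta> \<in> base c" "\<delta> \<noteq> \<gamma>" "0 < coord c \<beta> \<delta>" by blast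
  have eq: "coord c (reflect \<gamma> \<beta>) \<delta> = coord c \<beta> \<delta>"
    using d g by (simp add: reflect_def inner_diff_left base_coweight[OF c])
  have "- reflect \<gamma> \<beta> \<notin> pos c"
    using pos_coords(1)[OF c _ d(1), of "- reflect \<gamma> \<beta>"] eq d(3) by auto
  moreover have "reflect \<gamma> \<beta> \<in> \<Delta>" using reflect_root g b base_root pos_root by blast
  ultimately show ?thesis using pos_or_neg[OF c] by blast
qed

lemma regular_reflect: "regular c \<Longrightarrow> \<gamma> \<in> \<Delta> \<Longrightarrow> regular (reflect \<gamma> c)"
  by (simp add: regular_def inner_reflect reflect_root)

lemma pos_reflect: 
  assumes "\<gamma> \<in> \<Delta>"
  shows "\<alpha> \<in> pos (reflect \<gamma> c) \<longleftrightarrow> reflect \<gamma> \<alpha> \<in> pos c"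
  using reflect_root[OF assms, of \<alpha>] reflect_root[OF assms, of "reflect \<gamma> \<alpha>"]
    reflect_reflect[OF root_nonzero[OF assms]]
  by (auto simp: pos_def inner_reflect)

lemma base_reflect:
  assumes "\<gamma> \<in> \<Delta>"
  shows "\<alpha> \<in> base (reflect \<gamma> c) \<longleftrightarrow> reflect \<gamma> \<alpha> \<in> base c"
proof -
  note rr = reflect_reflect[OF root_nonzero[OF assms]]
  have "(\<exists>\<beta>\<in>pos (reflect \<gamma> c). \<exists>\<delta>\<in>pos (reflect \<gamma> c). \<alpha> = \<beta> + \<delta>) \<longleftrightarrow>
     (\<exists>\<beta>\<in>pos c. \<exists>\<delta>\<in>pos c. reflect \<gamma> \<alpha> = \<beta> + \<delta>)" (is "?l \<longleftrightarrow> ?r")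
  proof
    assume ?l
    then show ?r using pos_reflect[OF assms] by (metis reflect_add)
  next
    assume ?r
    then obtain \<beta> \<delta> where "\<beta> \<in> pos c" "\<delta> \<in> pos c" "reflect \<gamma> \<alpha> = \<beta> + \<delta>" by blast
    then have "\<alpha> = reflect \<gamma> \<beta> + reflect \<gamma> \<delta>" by (metis reflect_add rr)
    then show ?l using \<open>\<beta> \<in> pos c\<close> \<open>\<delta> \<in> pos c\<close> pos_reflect[OF assms] rr by metis
  qed
  then show ?thesis by (simp only: base_def mem_Collect_eq pos_reflect[OF assms])
qed

lemma chamber_reflect:
  assumes "\<gamma> \<in> \<Delta>"
  shows "v \<in> chamber (reflect \<gamma> c) \<longleftrightarrow> reflect \<gamma> v \<in> chamber c"
proof -
  note rr = reflect_reflect[OF root_nonzero[OF assms]]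
  have "(\<forall>\<alpha>\<in>pos (reflect \<gamma> c). 0 \<le> \<alpha> \<bullet> v) \<longleftrightarrow> (\<forall>\<alpha>\<in>pos c. 0 \<le> reflect \<gamma> \<alpha> \<bullet> v)"
    using pos_reflect[OF assms] rr by metis
  then show ?thesis by (simp add: chamber_def inner_reflect)
qed

lemma dual_cone_chamber_reflect:
  assumes "\<gamma> \<in> \<Delta>"
  shows "x \<in> dual_cone (chamber (reflect \<gamma> c)) \<longleftrightarrow> reflect \<gamma> x \<in> dual_cone (chamber c)"
proof -
  note rr = reflect_reflect[OF root_nonzero[OF assms]]
  have "(\<forall>v\<in>chamber (reflect \<gamma> c). 0 \<le> x \<bullet> v) \<longleftrightarrow> (\<forall>v\<in>chamber c. 0 \<le> x \<bullet> reflect \<gamma> v)"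
    using chamber_reflect[OF assms] rr by metis
  then show ?thesis by (simp add: dual_cone_def inner_reflect)
qed

text \<open>Crossing a wall changes the sign of exactly one pair of roots. Hence the number of roots
  separating two distinct chambers drops when a suitable wall is crossed.\<close>

lemma pos_reflect_base:
  assumes c: "regular c" and g: "\<gamma> \<in> base c"
  shows "pos (reflect \<gamma> c) = insert (- \<gamma>) (pos c - {\<gamma>})"
proof -
  have gD: "\<gamma> \<in> \<Delta>" and gp: "\<gamma> \<in> pos c" using g base_root base_pos by auto
  note nz = root_nonzero[OF gD] and rr = reflect_reflect[OF root_nonzero[OF gD]]
  have 1: "reflect \<gamma> \<alpha> \<in> pos c" if "\<alpha> \<in> insert (- \<gamma>) (pos c - {\<gamma>})" for \<alpha>
    using that reflect_pos[OF c g] gp by (auto simp: reflect_minus reflect_self[OF nz])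
  have 2: "\<alpha> \<in> insert (- \<gamma>) (pos c - {\<gamma>})" if a: "reflect \<gamma> \<alpha> \<in> pos c" for \<alpha>
  proof (cases "reflect \<gamma> \<alpha> = \<gamma>")
    case True
    then have "\<alpha> = - \<gamma>" using rr reflect_self[OF nz] by metis
    then show ?thesis by simp
  next
    case False
    then have "\<alpha> \<in> pos c" using reflect_pos[OF c g a] rr by simp
    moreover have "\<alpha> \<noteq> \<gamma>" using a not_pos_and_neg[OF gp] reflect_self[OF nz] by auto
    ultimately show ?thesis by simp
  qed
  show ?thesis using 1 2 pos_reflect[OF gD] by blast
qed

lemma exists_regular: "\<exists>g. regular g"
proof -
  have "negligible (\<Union>\<alpha>\<in>\<Delta>. {v. \<alpha> \<bullet> v = 0})"
  proof (rule negligible_Union)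
    show "finite ((\<lambda>\<alpha>. {v. \<alpha> \<bullet> v = 0}) ` \<Delta>)" using finite_roots by simp
    fix t assume "t \<in> (\<lambda>\<alpha>. {v. \<alpha> \<bullet> v = 0}) ` \<Delta>"
    then show "negligible t" using root_nonzero by (auto intro: negligible_hyperplane)
  qed
  then have "(\<Union>\<alpha>\<in>\<Delta>. {v. \<alpha> \<bullet> v = 0}) \<noteq> UNIV" using non_negligible_UNIV by metis
  then show ?thesis by (auto simp: regular_def)
qed

text \<open>Stands in for moving x into a fixed chamber by the Weyl group. The chamber is that of x
  + e g for a regular g and a small e > 0: roots nonzero at x keep their sign, those vanishing at x
  are decided by g.\<close>

lemma exists_dominating_chamber: "\<exists>c. regular c \<and> (\<forall>\<alpha>\<in>pos c. 0 \<le> \<alpha> \<bullet> x)"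
proof -
  obtain g where g: "regular g" using exists_regular by blast
  have "\<forall>\<^sub>F e in at_right (0::real). \<forall>\<alpha>\<in>\<Delta>. \<alpha> \<bullet> x < 0 \<longrightarrow> \<alpha> \<bullet> (x + e *\<^sub>R g) < 0"
  proof (intro eventually_ball_finite[OF finite_roots] ballI)
    fix \<alpha> assume "\<alpha> \<in> \<Delta>"
    have "((\<lambda>e. \<alpha> \<bullet> (x + e *\<^sub>R g)) \<longlongrightarrow> \<alpha> \<bullet> (x + 0 *\<^sub>R g)) (at_right 0)"
      by (intro tendsto_intros)
    then show "\<forall>\<^sub>F e in at_right (0::real). \<alpha> \<bullet> x < 0 \<longrightarrow> \<alpha> \<bullet> (x + e *\<^sub>R g) < 0"
      by (cases "\<alpha> \<bullet> x < 0") (auto dest!: order_tendstoD(2)[where a=0])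
  qed
  moreover have "\<forall>\<^sub>F e in at_right (0::real). 0 < e" by (rule eventually_at_right_less)
  ultimately have "\<forall>\<^sub>F e in at_right (0::real). 0 < e \<and> (\<forall>\<alpha>\<in>\<Delta>. \<alpha> \<bullet> x < 0 \<longrightarrow> \<alpha> \<bullet> (x + e *\<^sub>R g) < 0)"
    by eventually_elim simp
  then obtain e :: real where e: "0 < e" "\<And>\<alpha>. \<alpha> \<in> \<Delta> \<Longrightarrow> \<alpha> \<bullet> x < 0 \<Longrightarrow> \<alpha> \<bullet> (x + e *\<^sub>R g) < 0"
    using eventually_happens'[OF trivial_limit_at_right_real] by blast
  let ?c = "x + e *\<^sub>R g"
  have "\<alpha> \<bullet> ?c \<noteq> 0" if a: "\<alpha> \<in> \<Delta>" for \<alpha>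
  proof (cases "\<alpha> \<bullet> x" "0::real" rule: linorder_cases)
    case less
    then show ?thesis using e(2)[OF a] by simp
  next
    case equal
    then show ?thesis using e(1) g a by (simp add: inner_add_right regular_def)
  next
    case greater
    then show ?thesis using e(2)[OF minus_root[OF a]] by simp
  qed
  moreover have "0 \<le> \<alpha> \<bullet> x" if "\<alpha> \<in> pos ?c" for \<alpha>
    using e(2)[of \<alpha>] that by (force simp: pos_def)
  ultimately show ?thesis unfolding regular_def by blast
qed

text \<open>The common face contains a relatively open piece of the hyperplane orthogonal to
  \<gamma>, hence has codimension one. This makes the edge condition on vertices available for every
  simple root of every chamber.\<close>

lemma adjacent_reflect:
  assumes c: "regular c" and g: "\<gamma> \<in> base c"
  shows "adjacent \<Delta> (chamber c) (chamber (reflect \<gamma> c))"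
    and "wall_root \<Delta> (chamber c) (chamber (reflect \<gamma> c)) = \<gamma>"
proof -
  have gD: "\<gamma> \<in> \<Delta>" and gp: "\<gamma> \<in> pos c" using g base_root base_pos by auto
  note nz = root_nonzero[OF gD]
  let ?c = "reflect \<gamma> c"
  have rc: "regular ?c" using regular_reflect[OF c gD] .
  have pc: "pos ?c = insert (- \<gamma>) (pos c - {\<gamma>})" using pos_reflect_base[OF c g] .
  have eq: "chamber c \<inter> chamber ?c = {v. \<gamma> \<bullet> v = 0} \<inter> {v. \<forall>\<alpha>\<in>pos c - {\<gamma>}. 0 \<le> \<alpha> \<bullet> v}" (is "_ = ?H \<inter> ?K")
    unfolding chamber_def pc using gp by auto
  have ne: "chamber c \<noteq> chamber ?c"
  proof
    assume "chamber c = chamber ?c"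
    then have "pos c = pos ?c" using positive_roots_chamber by metis
    then show False using pc not_pos_and_neg gp by auto
  qed
  define W where "W = (\<Inter>\<alpha>\<in>pos c - {\<gamma>}. {v. 0 < \<alpha> \<bullet> v})"
  have "open W" unfolding W_def using finite_pos by (intro open_INT ballI open_halfspace_gt) auto
  \<comment> \<open>The sum of c and its mirror image lies on the mirror, and every positive root
    other than \<gamma> is positive on both summands.\<close>
  moreover have m: "c + ?c \<in> ?H \<inter> W"
  proof -
    have "\<gamma> \<bullet> (c + ?c) = 0"
      by (simp add: inner_add_right inner_reflect reflect_self[OF nz])
    moreover have "0 < \<alpha> \<bullet> (c + ?c)" if "\<alpha> \<in> pos c - {\<gamma>}" for \<alpha>
      using that pc by (auto simp: inner_add_right pos_def intro!: add_pos_pos)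
    ultimately show ?thesis by (simp add: W_def)
  qed
  ultimately have ad: "aff_dim (?H \<inter> W) = aff_dim ?H"
    by (intro aff_dim_convex_Int_open convex_hyperplane) auto
  have sub: "?H \<inter> W \<subseteq> ?H \<inter> ?K" "?H \<inter> ?K \<subseteq> ?H" unfolding W_def by (blast intro: less_imp_le)+
  have "aff_dim (?H \<inter> ?K) = aff_dim ?H"
    using aff_dim_subset[OF sub(1)] aff_dim_subset[OF sub(2)] ad by simp
  then have "aff_dim (chamber c \<inter> chamber ?c) = int DIM('a) - 1"
    using eq aff_dim_hyperplane[OF nz, of 0] by simp
  then show "adjacent \<Delta> (chamber c) (chamber ?c)"
    unfolding adjacent_def chambers_eq using c rc ne by blast
  have P: "(\<alpha> \<in> \<Delta> \<and> (\<forall>v\<in>interior (chamber c). 0 < \<alpha> \<bullet> v) \<and> (\<forall>v\<in>interior (chamber ?c). \<alpha> \<bullet> v < 0))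
    \<longleftrightarrow> \<alpha> = \<gamma>" for \<alpha>
  proof -
    have "(\<alpha> \<in> \<Delta> \<and> (\<forall>v\<in>interior (chamber c). 0 < \<alpha> \<bullet> v) \<and> (\<forall>v\<in>interior (chamber ?c). \<alpha> \<bullet> v < 0))
      \<longleftrightarrow> \<alpha> \<in> positive_roots \<Delta> (chamber c) \<and> - \<alpha> \<in> positive_roots \<Delta> (chamber ?c)"
      by (auto simp: positive_roots_def minus_root_iff)
    also have "\<dots> \<longleftrightarrow> \<alpha> \<in> pos c \<and> - \<alpha> \<in> insert (- \<gamma>) (pos c - {\<gamma>})"
      by (simp add: positive_roots_chamber pc)
    also have "\<dots> \<longleftrightarrow> \<alpha> = \<gamma>" using gp not_pos_and_neg by auto
    finally show ?thesis .
  qed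
  show "wall_root \<Delta> (chamber c) (chamber ?c) = \<gamma>"
    unfolding wall_root_def P by simp
qed

end

section \<open>Weights of special ample line bundles\<close>

text \<open>For an ample polytope this is the set of lattice points \<Lambda>(P), written as an
  intersection of translated cones: the form in which regularity over the charts presents
  itself.\<close>

definition section_weights :: "'a::euclidean_space set \<Rightarrow> ('a set \<Rightarrow> 'a) \<Rightarrow> 'a set" where
  "section_weights \<Delta> \<mu> = {x. \<forall>\<sigma>\<in>chambers \<Delta>. \<mu> \<sigma> - x \<in> dual_cone \<sigma> \<inter> root_lattice \<Delta>}"

definition special_vertices :: "'a::euclidean_space set \<Rightarrow> ('a set \<Rightarrow> 'a) \<Rightarrow> bool" where
  "special_vertices \<Delta> \<mu> \<longleftrightarrow>
     (\<forall>\<sigma>\<in>chambers \<Delta>. \<mu> \<sigma> \<in> weight_lattice \<Delta> \<and> dominant \<Delta> \<sigma> (\<mu> \<sigma>)) \<and>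
     (\<forall>\<sigma> \<sigma>'. adjacent \<Delta> \<sigma> \<sigma>' \<longrightarrow>
        (\<exists>r::nat. 0 < r \<and> \<mu> \<sigma> - \<mu> \<sigma>' = real r *\<^sub>R wall_root \<Delta> \<sigma> \<sigma>'))"

lemma Ints_between: "(r::real) \<in> \<int> \<Longrightarrow> of_int n < r \<Longrightarrow> r < of_int n + 2 \<Longrightarrow> r = of_int n + 1"
proof (elim Ints_cases)
  fix z assume "r = of_int z" "of_int n < r" "r < of_int n + 2"
  then have "n < z" "z < n + 2" by linarith+
  then have "z = n + 1" by simp
  then show ?thesis using \<open>r = of_int z\<close> by simp
qed

context reduced_roots begin

abbreviation weights :: "('a set \<Rightarrow> 'a) \<Rightarrow> 'a set" where
  "weights \<equiv> section_weights \<Delta>"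

text \<open>The dominance order of the chamber: the difference is a sum of simple roots with
  nonnegative integral coefficients, by \<open>dual_cone_chamber\<close> and
  \<open>root_lattice_iff\<close>.\<close>

definition below :: "'a \<Rightarrow> 'a \<Rightarrow> 'a \<Rightarrow> bool" where
  "below c x y \<longleftrightarrow> y - x \<in> dual_cone (chamber c) \<inter> root_lattice \<Delta>"

lemma below_coords:
  assumes "regular c" "below c x y" "\<gamma> \<in> base c"
  shows "0 \<le> coord c (y - x) \<gamma>" "coord c (y - x) \<gamma> \<in> \<int>"
  using assms dual_cone_chamber[OF assms(1)] root_lattice_iff[OF assms(1)] by (auto simp: below_def)

lemma section_weights_iff: "x \<in> weights \<mu> \<longleftrightarrow> (\<forall>c. regular c \<longrightarrow> below c x (\<mu> (chamber c)))"
  by (auto simp: section_weights_def chambers_eq below_def)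

lemma coroot_Ints: "x \<in> weight_lattice \<Delta> \<Longrightarrow> \<alpha> \<in> \<Delta> \<Longrightarrow> x \<bullet> coroot \<alpha> \<in> \<int>"
  by (simp add: weight_lattice_def)

lemma coroot_ge_1:
  assumes "x \<in> weight_lattice \<Delta>" "\<alpha> \<in> \<Delta>" "0 < x \<bullet> \<alpha>"
  shows "1 \<le> x \<bullet> coroot \<alpha>"
  using coroot_Ints[OF assms(1,2)] assms(3) root_nonzero[OF assms(2)]
  by (intro Ints_pos_ge_1) (simp_all add: inner_coroot_pos_iff)

text \<open>Distinct simple roots have nonpositive product, so only the \<gamma>-term of the
  expansion of K can contribute positively.\<close>

lemma inner_le_coord:
  assumes c: "regular c" and g: "\<gamma> \<in> base c" and K: "\<And>\<delta>. \<delta> \<in> base c \<Longrightarrow> 0 \<le> coord c K \<delta>"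
  shows "K \<bullet> \<gamma> \<le> (coord c K \<gamma>) * (\<gamma> \<bullet> \<gamma>)"
proof -
  have "K \<bullet> \<gamma> = (\<Sum>\<delta>\<in>base c. coord c K \<delta> * (\<delta> \<bullet> \<gamma>))"
    by (rule inner_base_expansion[OF c])
  also have "\<dots> = coord c K \<gamma> * (\<gamma> \<bullet> \<gamma>) + (\<Sum>\<delta>\<in>base c - {\<gamma>}. coord c K \<delta> * (\<delta> \<bullet> \<gamma>))"
    by (rule sum.remove[OF finite_base g])
  also have "(\<Sum>\<delta>\<in>base c - {\<gamma>}. coord c K \<delta> * (\<delta> \<bullet> \<gamma>)) \<le> 0"
    using K base_obtuse[OF c _ g] by (intro sum_nonpos mult_nonneg_nonpos) auto
  finally show ?thesis by simp
qed

lemma reflect_coweight: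
  assumes c: "regular c" and "\<gamma> \<in> base c"
  shows "coord c (reflect \<gamma> x) \<delta> = coord c x \<delta> - (if \<delta> = \<gamma> then x \<bullet> coroot \<gamma> else 0)"
  using assms by (simp add: reflect_def inner_diff_left base_coweight[OF c])

lemma special_dominant:
  assumes m: "special_vertices \<Delta> \<mu>" and c: "regular c" and b: "\<beta> \<in> pos c"
  shows "0 \<le> \<mu> (chamber c) \<bullet> \<beta>"
proof -
  have "dominant \<Delta> (chamber c) (\<mu> (chamber c))"
    using m c by (auto simp: special_vertices_def chambers_eq)
  then have "0 \<le> \<mu> (chamber c) \<bullet> coroot \<gamma>" if "\<gamma> \<in> base c" for \<gamma>
    using that by (simp add: dominant_def simple_roots_chamber)
  then have "0 \<le> \<gamma> \<bullet> \<mu> (chamber c)" if "\<gamma> \<in> base c" for \<gamma>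
    using that inner_coroot_nonneg_iff[OF root_nonzero[OF base_root[OF that]]]
    unfolding inner_commute[of \<gamma>] by blast
  then show ?thesis using pos_base_inner_nonneg[OF c _ b] unfolding inner_commute[of _ \<beta>] by blast
qed

lemma special_weight: "special_vertices \<Delta> \<mu> \<Longrightarrow> regular c \<Longrightarrow> \<mu> (chamber c) \<in> weight_lattice \<Delta>"
  by (auto simp: special_vertices_def chambers_eq)

text \<open>The bound on r is the dominance of the vertex \<mu> - r \<gamma> across the wall:
  -\<gamma> is positive there, so that vertex pairs nonpositively with the coroot of
  \<gamma>.\<close>

lemma special_step:
  assumes m: "special_vertices \<Delta> \<mu>" and c: "regular c" and g: "\<gamma> \<in> base c"
  obtains r :: nat where "0 < r" "\<mu> (chamber (reflect \<gamma> c)) = \<mu> (chamber c) - real r *\<^sub>R \<gamma>"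
    "\<mu> (chamber c) \<bullet> coroot \<gamma> \<le> 2 * real r"
proof -
  obtain r :: nat where r: "0 < r" "\<mu> (chamber c) - \<mu> (chamber (reflect \<gamma> c)) = real r *\<^sub>R \<gamma>"
    using m adjacent_reflect[OF c g] unfolding special_vertices_def by metis
  then have eq: "\<mu> (chamber (reflect \<gamma> c)) = \<mu> (chamber c) - real r *\<^sub>R \<gamma>"
    by (metis add_diff_cancel_left' diff_add_cancel diff_diff_eq2)
  have "- \<gamma> \<in> pos (reflect \<gamma> c)" using pos_reflect_base[OF c g] by simp
  from special_dominant[OF m regular_reflect[OF c base_root[OF g]] this]
  have "\<mu> (chamber c) \<bullet> \<gamma> \<le> real r * (\<gamma> \<bullet> \<gamma>)" unfolding eq by (simp add: inner_diff_left)
  moreover have "0 < \<gamma> \<bullet> \<gamma>" using root_nonzero[OF base_root[OF g]] by simp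
  ultimately have "\<mu> (chamber c) \<bullet> coroot \<gamma> \<le> 2 * real r"
    by (simp add: inner_coroot divide_le_eq)
  then show ?thesis using that r(1) eq by blast
qed

text \<open>The vertices of adjacent chambers being dominant and distinct, no two neighbours in the Dynkin
  diagram of a chamber are both orthogonal to its vertex. This is what makes the sharp case
  \<open>\<langle>x, \<alpha>\<^sup>\<or>\<rangle> = 1\<close> of saturation work.\<close>

lemma special_strict:
  assumes m: "special_vertices \<Delta> \<mu>" and c: "regular c" and g: "\<gamma> \<in> base c" and d: "\<delta> \<in> base c" "\<delta> \<noteq> \<gamma>"
    and z: "\<mu> (chamber c) \<bullet> \<gamma> = 0"
  shows "- (\<gamma> \<bullet> \<delta>) \<le> \<mu> (chamber c) \<bullet> \<delta>"
proof -
  obtain r :: nat where r: "0 < r" "\<mu> (chamber (reflect \<gamma> c)) = \<mu> (chamber c) - real r *\<^sub>R \<gamma>"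
    using special_step[OF m c g] by blast
  note gD = base_root[OF g]
  have "reflect \<gamma> \<delta> \<in> pos (reflect \<gamma> c)"
    using pos_reflect[OF gD, of "reflect \<gamma> \<delta>" c] reflect_reflect[OF root_nonzero[OF gD]] base_pos[OF d(1)] by simp
  from special_dominant[OF m regular_reflect[OF c gD] this]
  have "0 \<le> reflect \<gamma> (\<mu> (chamber c) - real r *\<^sub>R \<gamma>) \<bullet> \<delta>" unfolding r by (simp add: inner_reflect)
  also have "reflect \<gamma> (\<mu> (chamber c) - real r *\<^sub>R \<gamma>) = \<mu> (chamber c) + real r *\<^sub>R \<gamma>"
    using z by (simp add: reflect_diff reflect_scaleR reflect_self[OF root_nonzero[OF gD]]) (simp add: reflect_def inner_coroot)
  finally have "- (real r * (\<gamma> \<bullet> \<delta>)) \<le> \<mu> (chamber c) \<bullet> \<delta>" by (simp add: inner_add_left)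
  moreover have "\<gamma> \<bullet> \<delta> \<le> 0" using base_obtuse[OF c g d(1)] d(2) by simp
  then have "real r * (\<gamma> \<bullet> \<delta>) \<le> 1 * (\<gamma> \<bullet> \<delta>)" using r(1) by (intro mult_right_mono_neg) auto
  ultimately show ?thesis by simp
qed

text \<open>After reflecting back into c, only the \<gamma>-coordinate changes: from k - r it
  becomes k + r - p, where k is the coordinate of K and p its pairing with the coroot of \<gamma>.
  Obtuse angles give p \<le> 2 k, special vertices and the sign of
  \<open>x \<bullet> \<gamma>\<close> give p \<le> 2 r; the mean of both bounds is what is
  required.\<close>

lemma below_reflect:
  assumes m: "special_vertices \<Delta> \<mu>" and c: "regular c" and g: "\<gamma> \<in> base c"
    and x: "below c x (\<mu> (chamber c))" "0 \<le> x \<bullet> \<gamma>"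
  shows "below (reflect \<gamma> c) x (\<mu> (chamber (reflect \<gamma> c)))"
proof -
  obtain r :: nat where r: "0 < r" "\<mu> (chamber (reflect \<gamma> c)) = \<mu> (chamber c) - real r *\<^sub>R \<gamma>"
    "\<mu> (chamber c) \<bullet> coroot \<gamma> \<le> 2 * real r"
    using special_step[OF m c g] by blast
  note gD = base_root[OF g]
  note nz = root_nonzero[OF gD]
  define K where "K = \<mu> (chamber c) - x"
  have K0: "0 \<le> coord c K \<delta>" if "\<delta> \<in> base c" for \<delta>
    using below_coords(1)[OF c x(1) that] by (simp add: K_def)
  have KR: "K \<in> root_lattice \<Delta>" using x(1) by (simp add: below_def K_def)
  have "K \<bullet> \<gamma> \<le> (coord c K \<gamma>) * (\<gamma> \<bullet> \<gamma>)" using inner_le_coord[OF c g] K0 by blast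
  then have k1: "K \<bullet> coroot \<gamma> \<le> 2 * (coord c K \<gamma>)"
    using nz by (simp add: inner_coroot divide_le_eq)
  have "0 \<le> x \<bullet> coroot \<gamma>" using x(2) nz by (simp add: inner_coroot_nonneg_iff)
  then have k2: "K \<bullet> coroot \<gamma> \<le> 2 * real r" using r(3) by (simp add: K_def inner_diff_left)
  have eq: "\<mu> (chamber (reflect \<gamma> c)) - x = K - real r *\<^sub>R \<gamma>" by (simp add: r K_def)
  have "reflect \<gamma> (K - real r *\<^sub>R \<gamma>) \<in> dual_cone (chamber c)"
    unfolding dual_cone_chamber[OF c]
  proof
    fix \<delta> assume d: "\<delta> \<in> base c"
    have "coord c (reflect \<gamma> (K - real r *\<^sub>R \<gamma>)) \<delta> =
      coord c K \<delta> - (if \<delta> = \<gamma> then K \<bullet> coroot \<gamma> - real r else 0)"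
      using g by (auto simp: reflect_coweight[OF c g] inner_diff_left base_coweight[OF c] coroot_self[OF nz])
    then show "0 \<le> coord c (reflect \<gamma> (K - real r *\<^sub>R \<gamma>)) \<delta>"
      using K0[OF d] k1 k2 by (cases "\<delta> = \<gamma>") auto
  qed
  moreover have "K - real r *\<^sub>R \<gamma> \<in> root_lattice \<Delta>"
    using root_lattice_diff[OF KR] root_lattice_scale[OF root_in_root_lattice[OF gD], of "int r"] by simp
  ultimately show ?thesis
    unfolding below_def eq by (simp add: dual_cone_chamber_reflect[OF gD])
qed

text \<open>A dominant x has to be tested only at the vertex of its own chamber: the relation is
  carried across walls from c to any other chamber, by induction on the number of roots separating
  the two.\<close>

lemma dominant_section_weight:
  assumes m: "special_vertices \<Delta> \<mu>" and c: "regular c"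
    and x: "below c x (\<mu> (chamber c))" "\<And>\<beta>. \<beta> \<in> pos c \<Longrightarrow> 0 \<le> x \<bullet> \<beta>"
  shows "x \<in> weights \<mu>"
proof -
  have "below c' x (\<mu> (chamber c'))" if "regular c'" for c'
    using that
  proof (induction "card (pos c - pos c')" arbitrary: c' rule: less_induct)
    case less
    note c' = less.prems
    show ?case
    proof (cases "base c' \<subseteq> pos c")
      case True
      have 1: "\<beta> \<in> pos c" if "\<beta> \<in> pos c'" for \<beta>
      proof -
        have "0 \<le> \<beta> \<bullet> c"
          using True by (intro pos_base_inner_nonneg[OF c' _ that]) (auto simp: pos_def)
        then show ?thesis using that c by (force simp: pos_def regular_def)
      qed
      have "\<beta> \<in> pos c'" if "\<beta> \<in> pos c" for \<beta>
        using pos_or_neg[OF c' pos_root[OF that]] 1[of "- \<beta>"] not_pos_and_neg[OF that] by blast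
      then have "pos c = pos c'" using 1 by blast
      then have "chamber c = chamber c'" by (simp add: chamber_def)
      then show ?thesis using x(1) by (simp add: below_def)
    next
      case False
      \<comment> \<open>Since \<gamma> is negative at c, crossing its wall leads closer to c. The
        relation known there is carried back through the same wall, now that of the simple root
        -\<gamma>, with which x pairs nonnegatively.\<close>
      then obtain \<gamma> where g: "\<gamma> \<in> base c'" "\<gamma> \<notin> pos c" by blast
      note gD = base_root[OF g(1)]
      note nz = root_nonzero[OF gD]
      have ng: "- \<gamma> \<in> pos c" using pos_or_neg[OF c gD] g(2) by blast
      let ?c = "reflect \<gamma> c'"
      have pc: "pos ?c = insert (- \<gamma>) (pos c' - {\<gamma>})" by (rule pos_reflect_base[OF c' g(1)])
      have "pos c - pos ?c \<subset> pos c - pos c'"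
        using ng g(2) not_pos_and_neg[OF base_pos[OF g(1)]] unfolding pc by blast
      then have "card (pos c - pos ?c) < card (pos c - pos c')"
        by (intro psubset_card_mono) (simp add: finite_pos)
      then have IH: "below ?c x (\<mu> (chamber ?c))"
        using less.hyps regular_reflect[OF c' gD] by blast
      have "- \<gamma> \<in> base ?c" using g(1) by (simp add: base_reflect[OF gD] reflect_minus reflect_self[OF nz])
      moreover have "reflect (- \<gamma>) ?c = c'" by (simp add: reflect_minus_root reflect_reflect[OF nz])
      ultimately show ?thesis
        using below_reflect[OF m regular_reflect[OF c' gD] _ IH, of "- \<gamma>"] x(2)[OF ng] by simp
    qed
  qed
  then show ?thesis by (simp add: section_weights_iff)
qed

lemma section_weights_weight:
  assumes m: "special_vertices \<Delta> \<mu>" and x: "x \<in> weights \<mu>"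
  shows "x \<in> weight_lattice \<Delta>"
proof -
  obtain c where "regular c" using exists_regular by blast
  then show ?thesis
    using weight_lattice_diff_root_lattice[OF special_weight[OF m, of c], of x] x
    by (auto simp: section_weights_iff below_def)
qed

text \<open>The number in question is the coefficient of the coroot of \<open>\<gamma>\<close> in the coroot of \<open>\<beta>\<close>.\<close>

lemma coroot_coords_Ints:
  assumes c: "regular c" and "\<beta> \<in> pos c" and g: "\<gamma> \<in> base c"
  shows "coord c (coroot \<beta>) \<gamma> * (\<gamma> \<bullet> \<gamma>) / 2 \<in> \<int>"
  using assms(2)
proof (induction "card {\<alpha> \<in> pos c. \<alpha> \<bullet> c < \<beta> \<bullet> c}" arbitrary: \<beta> rule: less_induct)
  case less
  have base: "coord c (coroot \<delta>) \<gamma> * (\<gamma> \<bullet> \<gamma>) / 2 = (if \<delta> = \<gamma> then 1 else 0)" if "\<delta> \<in> base c" for \<delta>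
    using that root_nonzero[OF base_root[OF that]] by (simp add: coroot_def base_coweight[OF c])
  show ?case
  proof (cases "\<beta> \<in> base c")
    case True
    then show ?thesis using base by simp
  next
    case False
    have "\<exists>\<delta>\<in>base c. 0 < \<delta> \<bullet> \<beta>"
    proof (rule ccontr)
      assume "\<not> ?thesis"
      then have "(\<Sum>\<delta>\<in>base c. coord c \<beta> \<delta> * (\<delta> \<bullet> \<beta>)) \<le> 0"
        using pos_coords(1)[OF c less.prems]
        by (intro sum_nonpos mult_nonneg_nonpos) (auto simp: not_less)
      then have "\<beta> \<bullet> \<beta> \<le> 0" using inner_base_expansion[OF c, of \<beta> \<beta>] by simp
      then show False using root_nonzero[OF pos_root[OF less.prems]]
        by (metis inner_gt_zero_iff not_less)
    qed
    then obtain \<delta> where d: "\<delta> \<in> base c" "0 < \<delta> \<bullet> \<beta>" by blast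
    note dD = base_root[OF d(1)]
    note nz = root_nonzero[OF dD]
    let ?b = "reflect \<delta> \<beta>"
    \<comment> \<open>The reflection lowers \<beta> but keeps it positive, and it changes the coroot
      by an integral multiple of the coroot of \<delta>.\<close>
    have b: "?b \<in> pos c" using reflect_pos[OF c d(1) less.prems] False d(1) by blast
    have "0 < \<beta> \<bullet> coroot \<delta>" using d(2) nz by (simp add: inner_coroot_pos_iff inner_commute)
    moreover have "0 < \<delta> \<bullet> c" using base_pos[OF d(1)] by (simp add: pos_def)
    ultimately have "?b \<bullet> c < \<beta> \<bullet> c" by (simp add: reflect_def inner_diff_left)
    from card_filter_less[OF finite_pos b, of "\<lambda>\<alpha>. \<alpha> \<bullet> c", OF this]
    have IH: "coord c (coroot ?b) \<gamma> * (\<gamma> \<bullet> \<gamma>) / 2 \<in> \<int>" using less.hyps[OF _ b] by blast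
    have "coroot \<beta> = reflect \<delta> (coroot ?b)"
      by (simp add: coroot_reflect[OF nz] reflect_reflect[OF nz])
    also have "\<dots> = coroot ?b - (coroot ?b \<bullet> \<delta>) *\<^sub>R coroot \<delta>" by (rule reflect_alt)
    finally have "coord c (coroot \<beta>) \<gamma> =
        coord c (coroot ?b) \<gamma> - (coroot ?b \<bullet> \<delta>) * (coord c (coroot \<delta>) \<gamma>)"
      by (metis inner_diff_left inner_scaleR_left)
    then have "coord c (coroot \<beta>) \<gamma> * (\<gamma> \<bullet> \<gamma>) / 2 =
      coord c (coroot ?b) \<gamma> * (\<gamma> \<bullet> \<gamma>) / 2 - (coroot ?b \<bullet> \<delta>) * (coord c (coroot \<delta>) \<gamma> * (\<gamma> \<bullet> \<gamma>) / 2)"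
      by (simp only: left_diff_distrib diff_divide_distrib mult.assoc times_divide_eq_right)
    moreover have "coroot ?b \<bullet> \<delta> \<in> \<int>"
      using root_coroot_Ints[OF pos_root[OF b] dD] by (simp add: inner_commute)
    ultimately show ?thesis using IH base[OF d(1)] by (simp only: Ints_diff Ints_mult Ints_0 Ints_1 split: if_split) simp
  qed
qed

text \<open>In a chamber where \<open>y = x - \<alpha>\<close> is dominant, let \<open>D = \<mu> - y\<close> and let \<open>E\<close> be the negative part of
  its coordinates. If \<open>E\<close> is nonzero, then \<open>D\<close> has negative inner product with some \<open>\<gamma>\<^sub>0\<close> in the
  support of \<open>E\<close>; then \<open>\<langle>y, \<alpha>\<^sup>\<or>\<rangle> \<ge> -1\<close> forces \<open>y\<close> to be orthogonal to the rest of the support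
  and \<open>\<mu>\<close> to \<open>\<gamma>\<^sub>0\<close>, and the quadratic form \<open>\<bar>E - \<gamma>\<^sub>0 / 2\<bar>\<^sup>2\<close> would be negative.\<close>

lemma section_weights_diff_root:
  assumes m: "special_vertices \<Delta> \<mu>" and x: "x \<in> weights \<mu>"
    and a: "\<alpha> \<in> \<Delta>" "0 < x \<bullet> \<alpha>"
  shows "x - \<alpha> \<in> weights \<mu>"
proof -
  define y where "y = x - \<alpha>"
  \<comment> \<open>The chamber is adapted to y, not to x: by \<open>dominant_section_weight\<close>
    it then suffices that y is below the vertex of this chamber.\<close>
  obtain c where c: "regular c" and dom: "\<And>\<beta>. \<beta> \<in> pos c \<Longrightarrow> 0 \<le> \<beta> \<bullet> y"
    using exists_dominating_chamber by blast
  let ?m = "\<mu> (chamber c)"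
  define D where "D = ?m - y"
  have xw: "x \<in> weight_lattice \<Delta>" using section_weights_weight[OF m x] .
  have xb: "below c x ?m" using x c by (simp add: section_weights_iff)
  have DR: "D \<in> root_lattice \<Delta>"
    using root_lattice_add[of "?m - x" \<alpha>] xb root_in_root_lattice[OF a(1)]
    by (simp add: below_def D_def y_def algebra_simps)
  have yw: "y \<in> weight_lattice \<Delta>"
    using weight_lattice_diff_root_lattice[OF xw, of y] root_in_root_lattice[OF a(1)] by (simp add: y_def)
  have "0 \<le> coord c D \<gamma>1" if g1: "\<gamma>1 \<in> base c" for \<gamma>1
  proof (cases "\<alpha> \<in> pos c")
    case True
    have "D = (?m - x) + \<alpha>" by (simp add: D_def y_def)
    then show ?thesis
      using below_coords(1)[OF c xb g1] pos_coords(1)[OF c True g1] by (simp add: inner_add_left)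
  next
    case False
    define \<beta> where "\<beta> = - \<alpha>"
    have b: "\<beta> \<in> pos c" using False pos_or_neg[OF c a(1)] by (simp add: \<beta>_def)
    show ?thesis
    proof (rule ccontr)
      assume neg: "\<not> 0 \<le> coord c D \<gamma>1"
      \<comment> \<open>The negative part e and the positive part f give D = F - E with disjoint
        supports. Since D + \<beta> has nonnegative coordinates, the support of E lies in that of
        \<beta>.\<close>
      define e where "e \<gamma> = max 0 (- (coord c D \<gamma>))" for \<gamma>
      define f where "f \<gamma> = max 0 (coord c D \<gamma>)" for \<gamma>
      define E where "E = (\<Sum>\<gamma>\<in>base c. e \<gamma> *\<^sub>R \<gamma>)"
      define F where "F = (\<Sum>\<gamma>\<in>base c. f \<gamma> *\<^sub>R \<gamma>)"
      have e0: "0 \<le> e \<gamma>" for \<gamma> by (simp add: e_def)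
      have eb: "0 < coord c \<beta> \<gamma>" if "\<gamma> \<in> base c" "0 < e \<gamma>" for \<gamma>
      proof -
        have "?m - x = D + \<beta>" by (simp add: D_def y_def \<beta>_def)
        then have "0 \<le> coord c D \<gamma> + coord c \<beta> \<gamma>"
          using below_coords(1)[OF c xb that(1)] by (simp add: inner_add_left)
        then show ?thesis using that(2) by (auto simp: e_def max_def split: if_splits)
      qed
      have "(\<Sum>\<gamma>\<in>base c. coord c D \<gamma> *\<^sub>R \<gamma>) + E = F"
        unfolding E_def F_def sum.distrib[symmetric]
        by (intro sum.cong) (auto simp: e_def f_def max_def)
      then have DE: "D + E = F" using base_expansion[OF c, of D] by simp
      have "F \<bullet> E \<le> 0" unfolding E_def F_def
        by (rule obtuse_sum[OF c]) (auto simp: e_def f_def max_def)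
      then have DEE: "D \<bullet> E \<le> - (E \<bullet> E)" unfolding DE[symmetric] by (simp add: inner_add_left)
      have DEs: "D \<bullet> E = (\<Sum>\<gamma>\<in>base c. e \<gamma> * (D \<bullet> \<gamma>))"
        by (simp add: E_def inner_sum_right)
      have "coord c E \<gamma>1 = e \<gamma>1" unfolding E_def by (rule base_sum_coweight[OF c g1])
      moreover have "0 < e \<gamma>1" using neg by (simp add: e_def)
      ultimately have "E \<noteq> 0" by auto
      then have "0 < E \<bullet> E" by simp
      then have DEneg: "D \<bullet> E < 0" using DEE by linarith
      have "\<exists>\<gamma>\<in>base c. e \<gamma> * (D \<bullet> \<gamma>) < 0"
      proof (rule ccontr)
        assume "\<not> ?thesis"
        then have "0 \<le> (\<Sum>\<gamma>\<in>base c. e \<gamma> * (D \<bullet> \<gamma>))" by (intro sum_nonneg) force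
        then show False using DEneg DEs by simp
      qed
      then obtain \<gamma>0 where g0: "\<gamma>0 \<in> base c" "e \<gamma>0 * (D \<bullet> \<gamma>0) < 0" by blast
      have eg0: "0 < e \<gamma>0" and Dg0: "D \<bullet> \<gamma>0 < 0"
        using g0(2) e0[of \<gamma>0] by (auto simp: mult_less_0_iff)
      note g0D = base_root[OF g0(1)]
      note nz0 = root_nonzero[OF g0D]
      have mu0: "0 \<le> ?m \<bullet> \<gamma>0" using special_dominant[OF m c base_pos[OF g0(1)]] .
      have yg0: "0 < y \<bullet> \<gamma>0" using Dg0 mu0 by (simp add: D_def inner_diff_left)
      have yco: "1 \<le> y \<bullet> coroot \<gamma>" if "\<gamma> \<in> base c" "0 < y \<bullet> \<gamma>" for \<gamma>
        using coroot_ge_1[OF yw base_root that(2)] that(1) by blast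
      have y0: "0 \<le> y \<bullet> \<gamma>" if "\<gamma> \<in> base c" for \<gamma> using dom[OF base_pos[OF that]] by (simp add: inner_commute)
      \<comment> \<open>The coefficients of the coroot of \<beta> in the simple coroots. They are
        integral, hence at least 1 on the support of E.\<close>
      define N where "N \<gamma> = coord c (coroot \<beta>) \<gamma> * (\<gamma> \<bullet> \<gamma>) / 2" for \<gamma>
      have bnz: "\<beta> \<noteq> 0" using root_nonzero[OF pos_root[OF b]] .
      have cob: "coord c (coroot \<beta>) \<gamma> = 2 / (\<beta> \<bullet> \<beta>) * (coord c \<beta> \<gamma>)" for \<gamma> by (simp add: coroot_def)
      have N0: "0 \<le> N \<gamma>" if "\<gamma> \<in> base c" for \<gamma>
        using pos_coords(1)[OF c b that] unfolding N_def cob by simp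
      have N1: "1 \<le> N \<gamma>" if "\<gamma> \<in> base c" "0 < e \<gamma>" for \<gamma>
      proof (rule Ints_pos_ge_1)
        show "N \<gamma> \<in> \<int>" unfolding N_def by (rule coroot_coords_Ints[OF c b that(1)])
        show "0 < N \<gamma>" unfolding N_def cob
          using eb[OF that] bnz root_nonzero[OF base_root[OF that(1)]] by simp
      qed
      have "x \<bullet> coroot \<alpha> \<ge> 1" using coroot_ge_1[OF xw a] .
      then have yb: "y \<bullet> coroot \<beta> \<le> 1"
        by (simp add: y_def \<beta>_def coroot_minus inner_diff_left coroot_self[OF root_nonzero[OF a(1)]])
      have "y \<bullet> coroot \<beta> = (\<Sum>\<gamma>\<in>base c. coord c (coroot \<beta>) \<gamma> * (\<gamma> \<bullet> y))"
        using inner_base_expansion[OF c, of "coroot \<beta>" y] by (simp add: inner_commute)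
      also have "\<dots> = (\<Sum>\<gamma>\<in>base c. N \<gamma> * (y \<bullet> coroot \<gamma>))"
        using root_nonzero[OF base_root] by (intro sum.cong) (auto simp: N_def inner_coroot inner_commute)
      \<comment> \<open>The terms are nonnegative, and on the support of E each is at least the
        integer \<open>y \<bullet> coroot \<gamma>\<close>. So only one simple root of the support,
        with pairing 1, can fail to be orthogonal to y.\<close>
      finally have ysum: "(\<Sum>\<gamma>\<in>base c. N \<gamma> * (y \<bullet> coroot \<gamma>)) \<le> 1" using yb by simp
      have yc0: "0 \<le> y \<bullet> coroot \<gamma>" if "\<gamma> \<in> base c" for \<gamma>
        using y0[OF that] root_nonzero[OF base_root[OF that]] by (simp add: inner_coroot_nonneg_iff)
      have part: "(\<Sum>\<gamma>\<in>S. N \<gamma> * (y \<bullet> coroot \<gamma>)) \<le> 1" if "S \<subseteq> base c" for S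
        using sum_mono2[OF finite_base that, of "\<lambda>\<gamma>. N \<gamma> * (y \<bullet> coroot \<gamma>)"] N0 yc0 ysum by fastforce
      have Ny: "y \<bullet> coroot \<gamma> \<le> N \<gamma> * (y \<bullet> coroot \<gamma>)" if "\<gamma> \<in> base c" "0 < e \<gamma>" for \<gamma>
        using mult_right_mono[OF N1[OF that] yc0[OF that(1)]] by simp
      have y0le: "y \<bullet> coroot \<gamma>0 \<le> 1" using part[of "{\<gamma>0}"] Ny[OF g0(1) eg0] g0(1) by simp
      then have y01: "y \<bullet> coroot \<gamma>0 = 1" using yco[OF g0(1) yg0] by simp
      have yz: "y \<bullet> \<gamma> = 0" if "\<gamma> \<in> base c" "0 < e \<gamma>" "\<gamma> \<noteq> \<gamma>0" for \<gamma>
      proof (rule ccontr)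
        assume "y \<bullet> \<gamma> \<noteq> 0"
        then have "1 \<le> y \<bullet> coroot \<gamma>" using yco[OF that(1)] y0[OF that(1)] by simp
        then have "2 \<le> N \<gamma>0 * (y \<bullet> coroot \<gamma>0) + N \<gamma> * (y \<bullet> coroot \<gamma>)"
          using Ny[OF that(1,2)] Ny[OF g0(1) eg0] y01 by linarith
        then show False using part[of "{\<gamma>0, \<gamma>}"] g0(1) that by simp
      qed
      have y0h: "y \<bullet> \<gamma>0 = (\<gamma>0 \<bullet> \<gamma>0) / 2" using y01 nz0 by (simp add: inner_coroot field_simps)
      have "?m \<bullet> coroot \<gamma>0 = 0"
      proof (rule ccontr)
        assume nz: "?m \<bullet> coroot \<gamma>0 \<noteq> 0"
        have "0 \<le> ?m \<bullet> coroot \<gamma>0" using mu0 nz0 by (simp add: inner_coroot_nonneg_iff)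
        then have "1 \<le> ?m \<bullet> coroot \<gamma>0"
          using nz coroot_Ints[OF special_weight[OF m c] g0D] by (intro Ints_pos_ge_1) auto
        then have "0 \<le> D \<bullet> coroot \<gamma>0" using y01 by (simp add: D_def inner_diff_left)
        then show False using Dg0 nz0 by (simp add: inner_coroot_nonneg_iff)
      qed
      then have m0: "?m \<bullet> \<gamma>0 = 0" using nz0 by (simp add: inner_coroot)
      \<comment> \<open>For other \<gamma> in the support this is \<open>special_strict\<close> at
        \<open>\<gamma>0\<close>. The correction at \<open>\<gamma>0\<close> itself records that
        \<open>D \<bullet> \<gamma>0\<close> is minus half the square of \<open>\<gamma>0\<close>,
        not minus the whole.\<close>
      have bound: "e \<gamma> * (- (\<gamma>0 \<bullet> \<gamma>)) + (if \<gamma> = \<gamma>0 then e \<gamma>0 * (\<gamma>0 \<bullet> \<gamma>0) / 2 else 0) \<le> e \<gamma> * (D \<bullet> \<gamma>)"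
        if "\<gamma> \<in> base c" for \<gamma>
      proof (cases "\<gamma> = \<gamma>0")
        case True
        then show ?thesis using m0 y0h by (simp add: D_def inner_diff_left algebra_simps)
      next
        case False
        show ?thesis
        proof (cases "0 < e \<gamma>")
          case True
          have "- (\<gamma>0 \<bullet> \<gamma>) \<le> ?m \<bullet> \<gamma>" using special_strict[OF m c g0(1) that False m0] .
          then have "- (\<gamma>0 \<bullet> \<gamma>) \<le> D \<bullet> \<gamma>" using yz[OF that True False] by (simp add: D_def inner_diff_left)
          then have "e \<gamma> * (- (\<gamma>0 \<bullet> \<gamma>)) \<le> e \<gamma> * (D \<bullet> \<gamma>)" by (intro mult_left_mono e0)
          then show ?thesis using False by simp
        next
          case ne: False
          then have "e \<gamma> = 0" using e0[of \<gamma>] by simp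
          then show ?thesis using False by simp
        qed
      qed
      have "(\<Sum>\<gamma>\<in>base c. e \<gamma> * (- (\<gamma>0 \<bullet> \<gamma>)) + (if \<gamma> = \<gamma>0 then e \<gamma>0 * (\<gamma>0 \<bullet> \<gamma>0) / 2 else 0)) \<le> D \<bullet> E"
        unfolding DEs by (rule sum_mono) (rule bound)
      also have "(\<Sum>\<gamma>\<in>base c. e \<gamma> * (- (\<gamma>0 \<bullet> \<gamma>)) + (if \<gamma> = \<gamma>0 then e \<gamma>0 * (\<gamma>0 \<bullet> \<gamma>0) / 2 else 0)) =
        - (\<gamma>0 \<bullet> E) + e \<gamma>0 * (\<gamma>0 \<bullet> \<gamma>0) / 2"
        unfolding sum.distrib using g0(1) finite_base by (simp add: E_def inner_sum_right sum_negf)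
      finally have fin: "E \<bullet> E \<le> \<gamma>0 \<bullet> E - e \<gamma>0 * (\<gamma>0 \<bullet> \<gamma>0) / 2" using DEE by linarith
      have "e \<gamma>0 = - (coord c D \<gamma>0)" using eg0 by (simp add: e_def max_def split: if_splits)
      then have "e \<gamma>0 \<in> \<int>" using DR root_lattice_iff[OF c] g0(1) by simp
      \<comment> \<open>Integrality makes the correction at least half the square of
        \<open>\<gamma>0\<close>, which beats the quarter added to complete the square of
        \<open>E - (1/2) *\<^sub>R \<gamma>0\<close>.\<close>
      then have "1 \<le> e \<gamma>0" using eg0 by (rule Ints_pos_ge_1)
      then have "1 * (\<gamma>0 \<bullet> \<gamma>0) \<le> e \<gamma>0 * (\<gamma>0 \<bullet> \<gamma>0)" by (intro mult_right_mono) auto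
      then have "E \<bullet> E - \<gamma>0 \<bullet> E + (\<gamma>0 \<bullet> \<gamma>0) / 4 \<le> - (\<gamma>0 \<bullet> \<gamma>0) / 4" using fin by (simp add: field_simps)
      moreover have "E \<bullet> E - \<gamma>0 \<bullet> E + (\<gamma>0 \<bullet> \<gamma>0) / 4 = (E - (1/2) *\<^sub>R \<gamma>0) \<bullet> (E - (1/2) *\<^sub>R \<gamma>0)"
        by (simp add: inner_diff inner_commute)
      moreover have "0 \<le> (E - (1/2) *\<^sub>R \<gamma>0) \<bullet> (E - (1/2) *\<^sub>R \<gamma>0)" by (rule inner_ge_zero)
      moreover have "0 < \<gamma>0 \<bullet> \<gamma>0" using nz0 by simp
      ultimately show False by linarith
    qed
  qed
  then have "below c y ?m" using DR by (simp add: below_def dual_cone_chamber[OF c] D_def)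
  then have "y \<in> weights \<mu>"
    using dominant_section_weight[OF m c] dom by (simp add: inner_commute)
  then show ?thesis by (simp add: y_def)
qed

lemma section_weights_add_root:
  assumes m: "special_vertices \<Delta> \<mu>" and x: "x \<in> weights \<mu>"
    and a: "\<alpha> \<in> \<Delta>" "x \<bullet> \<alpha> < 0"
  shows "x + \<alpha> \<in> weights \<mu>"
  using section_weights_diff_root[OF m x minus_root[OF a(1)]] a(2) by simp

text \<open>The proof climbs from \<open>\<gamma>\<close> through longer and longer sums \<open>\<beta>\<close> of simple roots until \<open>x + \<beta>\<close> is
  dominant. As \<open>\<gamma>\<close> is shortest, each step is the reflection of a pairing \<open>-1\<close>, so saturation leads
  back down to \<open>x + \<gamma>\<close>.\<close>

lemma section_weights_add_base:
  assumes m: "special_vertices \<Delta> \<mu>" and x: "x \<in> weights \<mu>" and c: "regular c"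
    and dom: "\<And>\<beta>. \<beta> \<in> pos c \<Longrightarrow> 0 \<le> x \<bullet> \<beta>"
    and g: "\<gamma> \<in> base c" "0 < coord c (\<mu> (chamber c) - x) \<gamma>"
    and short: "\<And>\<delta>. \<delta> \<in> base c \<Longrightarrow> 0 < coord c (\<mu> (chamber c) - x) \<delta> \<Longrightarrow> \<gamma> \<bullet> \<gamma> \<le> \<delta> \<bullet> \<delta>"
  shows "x + \<gamma> \<in> weights \<mu>"
proof -
  let ?m = "\<mu> (chamber c)"
  have xb: "below c x ?m" using x c by (simp add: section_weights_iff)
  have xw: "x \<in> weight_lattice \<Delta>" using section_weights_weight[OF m x] .
  \<comment> \<open>The induction runs upwards: the measure counts the positive roots with larger
    value at c, whence the minus signs. The length of \<beta> is kept because each step is a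
    reflection.\<close>
  have gen: "x + \<beta> \<in> weights \<mu>"
    if "\<beta> \<in> pos c" "\<beta> \<bullet> \<beta> = \<gamma> \<bullet> \<gamma>" "below c (x + \<beta>) ?m" for \<beta>
    using that
  proof (induction "card {\<alpha> \<in> pos c. - (\<alpha> \<bullet> c) < - (\<beta> \<bullet> c)}" arbitrary: \<beta> rule: less_induct)
    case less
    show ?case
    proof (cases "\<forall>\<delta>\<in>base c. 0 \<le> (x + \<beta>) \<bullet> \<delta>")
      case True
      then have "0 \<le> \<eta> \<bullet> (x + \<beta>)" if "\<eta> \<in> pos c" for \<eta>
        using pos_base_inner_nonneg[OF c _ that, of "x + \<beta>"] by (simp add: inner_commute)
      then show ?thesis using dominant_section_weight[OF m c less.prems(3)] by (simp add: inner_commute)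
    next
      case False
      then obtain \<delta> where d: "\<delta> \<in> base c" "(x + \<beta>) \<bullet> \<delta> < 0" by force
      note dD = base_root[OF d(1)]
      note nz = root_nonzero[OF dD]
      have bD: "\<beta> \<in> \<Delta>" using pos_root[OF less.prems(1)] .
      have xd: "0 \<le> x \<bullet> \<delta>" using dom[OF base_pos[OF d(1)]] .
      define K where "K = ?m - (x + \<beta>)"
      have K0: "0 \<le> coord c K \<eta>" "coord c K \<eta> \<in> \<int>" if "\<eta> \<in> base c" for \<eta>
        using below_coords[OF c less.prems(3) that] by (auto simp: K_def)
      have "0 < K \<bullet> \<delta>"
        using special_dominant[OF m c base_pos[OF d(1)]] d(2) by (simp add: K_def inner_diff_left)
      also have "\<dots> \<le> (coord c K \<delta>) * (\<delta> \<bullet> \<delta>)" using inner_le_coord[OF c d(1)] K0(1) by blast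
      finally have "0 < coord c K \<delta> * (\<delta> \<bullet> \<delta>)" .
      then have Kd: "0 < coord c K \<delta>" by (rule zero_less_mult_pos2) (simp add: nz)
      have "?m - x = K + \<beta>" by (simp add: K_def)
      then have "0 < coord c (?m - x) \<delta>"
        using Kd pos_coords(1)[OF c less.prems(1) d(1)] by (simp add: inner_add_left)
      then have len: "\<beta> \<bullet> \<beta> \<le> \<delta> \<bullet> \<delta>" using short d(1) less.prems(2) by simp
      have bd: "\<beta> \<bullet> \<delta> < 0" using d(2) xd by (simp add: inner_add_left)
      have dd: "0 < \<delta> \<bullet> \<delta>" using nz by simp
      \<comment> \<open>Comes from the square of \<beta> + \<delta>, as \<delta> is not shorter than
        \<beta>. The pairing of \<beta> with the coroot of \<delta> is then above -2; being negative
        and integral, it is -1.\<close>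
      have "- (\<beta> \<bullet> \<delta>) < \<delta> \<bullet> \<delta>"
      proof -
        have "\<beta> + \<delta> \<noteq> 0"
        proof
          assume "\<beta> + \<delta> = 0"
          then have "\<delta> = - \<beta>" by (simp add: eq_neg_iff_add_eq_0 add.commute)
          then show False using not_pos_and_neg[OF less.prems(1)] base_pos[OF d(1)] by simp
        qed
        then have "0 < (\<beta> + \<delta>) \<bullet> (\<beta> + \<delta>)" by simp
        then have "0 < \<beta> \<bullet> \<beta> + 2 * (\<beta> \<bullet> \<delta>) + \<delta> \<bullet> \<delta>"
          by (simp add: inner_add_left inner_add_right inner_commute)
        then show ?thesis using len by linarith
      qed
      then have "- 2 < \<beta> \<bullet> coroot \<delta>" using dd by (simp add: inner_coroot less_divide_eq)
      moreover have "\<beta> \<bullet> coroot \<delta> < 0" using bd dd by (simp add: inner_coroot divide_less_0_iff)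
      moreover have "\<beta> \<bullet> coroot \<delta> \<in> \<int>" using root_coroot_Ints[OF dD bD] .
      ultimately have b1: "\<beta> \<bullet> coroot \<delta> = - 1" using Ints_between[of "\<beta> \<bullet> coroot \<delta>" "-2"] by simp
      then have rb: "reflect \<delta> \<beta> = \<beta> + \<delta>" by (simp add: reflect_def)
      have "(x + \<beta>) \<bullet> coroot \<delta> < 0" using d(2) dd by (simp add: inner_coroot divide_less_0_iff)
      then have "x \<bullet> coroot \<delta> < 1" using b1 by (simp add: inner_add_left)
      moreover have "0 \<le> x \<bullet> coroot \<delta>" using xd nz by (simp add: inner_coroot_nonneg_iff)
      moreover have "x \<bullet> coroot \<delta> \<in> \<int>" using coroot_Ints[OF xw dD] .
      ultimately have x0: "x \<bullet> coroot \<delta> = 0" by (auto elim!: Ints_cases)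
      have b': "\<beta> + \<delta> \<in> pos c"
        using reflect_root[OF dD bD] less.prems(1) base_pos[OF d(1)] rb by (auto simp: pos_def inner_add_left)
      have n': "(\<beta> + \<delta>) \<bullet> (\<beta> + \<delta>) = \<gamma> \<bullet> \<gamma>"
        using inner_reflect_reflect[OF nz, of \<beta> \<beta>] less.prems(2) rb by simp
      have eq: "?m - (x + (\<beta> + \<delta>)) = K - \<delta>" by (simp add: K_def algebra_simps)
      have "0 \<le> coord c (K - \<delta>) \<eta>" if "\<eta> \<in> base c" for \<eta>
        using K0(1)[OF that] Ints_pos_ge_1[OF K0(2)[OF d(1)] Kd]
        by (auto simp: inner_diff_left base_coweight[OF c d(1)])
      moreover have "K - \<delta> \<in> root_lattice \<Delta>"
        using less.prems(3) root_lattice_diff root_in_root_lattice[OF dD] by (simp add: below_def K_def)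
      ultimately have "below c (x + (\<beta> + \<delta>)) ?m"
        unfolding below_def eq by (simp add: dual_cone_chamber[OF c])
      moreover have "0 < \<delta> \<bullet> c" using base_pos[OF d(1)] by (simp add: pos_def)
      then have "- ((\<beta> + \<delta>) \<bullet> c) < - (\<beta> \<bullet> c)" by (simp add: inner_add_left)
      from card_filter_less[OF finite_pos b', of "\<lambda>\<alpha>. - (\<alpha> \<bullet> c)", OF this]
      have "card {\<alpha> \<in> pos c. - (\<alpha> \<bullet> c) < - ((\<beta> + \<delta>) \<bullet> c)} < card {\<alpha> \<in> pos c. - (\<alpha> \<bullet> c) < - (\<beta> \<bullet> c)}" .
      ultimately have IH: "x + (\<beta> + \<delta>) \<in> weights \<mu>" using less.hyps b' n' by blast
      \<comment> \<open>The contributions are 0 from x, -1 from \<beta> and 2 from \<delta>;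
        saturation therefore leads from x + \<beta> + \<delta> back to x + \<beta>.\<close>
      have "(x + (\<beta> + \<delta>)) \<bullet> coroot \<delta> = 1" using x0 b1 by (simp add: inner_add_left coroot_self[OF nz])
      then have "0 < (x + (\<beta> + \<delta>)) \<bullet> \<delta>" using inner_coroot_pos_iff[OF nz] by (metis zero_less_one)
      from section_weights_diff_root[OF m IH dD this] show ?thesis by (simp add: algebra_simps)
    qed
  qed
  have eq: "?m - (x + \<gamma>) = (?m - x) - \<gamma>" by simp
  have "0 \<le> coord c (?m - (x + \<gamma>)) \<eta>" if "\<eta> \<in> base c" for \<eta>
    using below_coords(1)[OF c xb that] Ints_pos_ge_1[OF below_coords(2)[OF c xb g(1)] g(2)]
    unfolding eq inner_diff_left[of "?m - x" \<gamma>] base_coweight[OF c g(1)] by auto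
  moreover have "?m - (x + \<gamma>) \<in> root_lattice \<Delta>"
    using xb root_lattice_diff root_in_root_lattice[OF base_root[OF g(1)]] unfolding eq by (simp add: below_def)
  ultimately have "below c (x + \<gamma>) ?m" by (simp add: below_def dual_cone_chamber[OF c])
  then show ?thesis using gen base_pos[OF g(1)] by simp
qed

end

section \<open>Decompositions of weights\<close>

lemma sum_fun_upd:
  fixes x :: "'b \<Rightarrow> 'c::ab_group_add"
  assumes "finite A" "i \<in> A"
  shows "sum (x(i := a)) A = sum x A - x i + a"
proof -
  have "sum (x(i := a)) (A - {i}) = sum x (A - {i})" by (intro sum.cong) auto
  then show ?thesis using sum.remove[OF assms, of x] sum.remove[OF assms, of "x(i := a)"] by simp
qed

context reduced_roots begin

text \<open>The vertices of the opposite chambers of c and -c bound the coordinates of a weight from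
  both sides, and these are integral up to a fixed translation.\<close>

lemma finite_section_weights: "finite (weights \<mu>)"
proof -
  obtain c where c: "regular c" using exists_regular by blast
  have mc: "regular (- c)" using c by (simp add: regular_def)
  have pm: "\<alpha> \<in> pos (- c) \<longleftrightarrow> - \<alpha> \<in> pos c" for \<alpha> by (simp add: pos_def minus_root_iff)
  have cm: "v \<in> chamber (- c) \<longleftrightarrow> - v \<in> chamber c" for v
  proof -
    have "v \<in> chamber (- c) \<longleftrightarrow> (\<forall>\<alpha>. - \<alpha> \<in> pos c \<longrightarrow> 0 \<le> \<alpha> \<bullet> v)" by (simp add: chamber_def pm Ball_def)
    also have "\<dots> \<longleftrightarrow> (\<forall>\<alpha>. \<alpha> \<in> pos c \<longrightarrow> 0 \<le> - \<alpha> \<bullet> v)" by (metis minus_minus)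
    finally show ?thesis by (simp add: chamber_def Ball_def)
  qed
  let ?m = "\<mu> (chamber c)" and ?m' = "\<mu> (chamber (- c))"
  define R where "R \<gamma> = {0..\<lfloor>coord c (?m - ?m') \<gamma>\<rfloor>}" for \<gamma>
  have "weights \<mu> \<subseteq> (\<lambda>f. ?m - (\<Sum>\<gamma>\<in>base c. of_int (f \<gamma>) *\<^sub>R \<gamma>)) ` (PiE (base c) R)"
  proof
    fix x assume x: "x \<in> weights \<mu>"
    have xb: "below c x ?m" "below (- c) x ?m'" using x c mc by (auto simp: section_weights_iff)
    define f where "f = (\<lambda>\<gamma>\<in>base c. \<lfloor>coord c (?m - x) \<gamma>\<rfloor>)"
    have int: "of_int \<lfloor>coord c (?m - x) \<gamma>\<rfloor> = coord c (?m - x) \<gamma>" if "\<gamma> \<in> base c" for \<gamma>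
      using below_coords(2)[OF c xb(1) that] by simp
    have "f \<in> PiE (base c) R"
    proof (rule PiE_I)
      fix \<gamma> assume g: "\<gamma> \<in> base c"
      have "coweight c \<gamma> \<in> chamber c" using g by (simp add: chamber_base[OF c] base_coweight[OF c])
      then have "- coweight c \<gamma> \<in> chamber (- c)" by (simp add: cm)
      then have "0 \<le> (?m' - x) \<bullet> (- coweight c \<gamma>)" using xb(2) by (auto simp: below_def dual_cone_def)
      then have "coord c (?m - x) \<gamma> \<le> coord c (?m - ?m') \<gamma>" by (simp add: inner_diff_left)
      then show "f \<gamma> \<in> R \<gamma>" using g below_coords(1)[OF c xb(1) g] by (simp add: f_def R_def floor_mono)
    qed (simp add: f_def)
    moreover have "(\<Sum>\<gamma>\<in>base c. of_int (f \<gamma>) *\<^sub>R \<gamma>) = ?m - x"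
    proof -
      have "(\<Sum>\<gamma>\<in>base c. of_int (f \<gamma>) *\<^sub>R \<gamma>) = (\<Sum>\<gamma>\<in>base c. coord c (?m - x) \<gamma> *\<^sub>R \<gamma>)"
        by (intro sum.cong refl) (simp add: f_def int)
      then show ?thesis using base_expansion[OF c, of "?m - x"] by simp
    qed
    then have "x = ?m - (\<Sum>\<gamma>\<in>base c. of_int (f \<gamma>) *\<^sub>R \<gamma>)" by simp
    ultimately show "x \<in> (\<lambda>f. ?m - (\<Sum>\<gamma>\<in>base c. of_int (f \<gamma>) *\<^sub>R \<gamma>)) ` (PiE (base c) R)" by blast
  qed
  moreover have "finite (PiE (base c) R)" by (intro finite_PiE finite_base) (simp add: R_def)
  ultimately show ?thesis using finite_surj by blast
qed

text \<open>On sums of simple roots the floors are exact and this is the usual height; they only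
  make it a natural number, usable as an induction measure.\<close>

definition height :: "'a \<Rightarrow> 'a \<Rightarrow> nat" where
  "height c x = (\<Sum>\<delta>\<in>base c. nat \<lfloor>coord c x \<delta>\<rfloor>)"

lemma height_diff:
  assumes c: "regular c" and g: "\<gamma> \<in> base c" and ge: "1 \<le> coord c x \<gamma>"
  shows "height c (x - \<gamma>) < height c x"
  unfolding height_def
proof (rule sum_strict_mono_ex1[OF finite_base])
  have eq: "coord c (x - \<gamma>) \<delta> = coord c x \<delta> - (if \<gamma> = \<delta> then 1 else 0)" for \<delta>
    by (simp add: inner_diff_left base_coweight[OF c g])
  show "\<forall>\<delta>\<in>base c. nat \<lfloor>coord c (x - \<gamma>) \<delta>\<rfloor> \<le> nat \<lfloor>coord c x \<delta>\<rfloor>"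
    unfolding eq by (auto intro!: nat_mono floor_mono)
  have "nat \<lfloor>coord c x \<gamma> - 1\<rfloor> < nat \<lfloor>coord c x \<gamma>\<rfloor>" using ge by (simp add: le_floor_iff)
  then show "\<exists>\<delta>\<in>base c. nat \<lfloor>coord c (x - \<gamma>) \<delta>\<rfloor> < nat \<lfloor>coord c x \<delta>\<rfloor>"
    unfolding eq using g by (intro bexI[of _ \<gamma>]) simp_all
qed

end

text \<open>The factors of one product of m bundles: \<open>M i\<close> gives the vertices of the
  i-th factor, and the same bundle may occur several times.\<close>

locale special_family = reduced_roots +
  fixes M :: "nat \<Rightarrow> 'a set \<Rightarrow> 'a" and m :: nat
  assumes special: "\<And>i. i < m \<Longrightarrow> special_vertices \<Delta> (M i)"
begin

definition total :: "'a set \<Rightarrow> 'a" where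
  "total \<sigma> = (\<Sum>i<m. M i \<sigma>)"

definition tuples :: "'a \<Rightarrow> (nat \<Rightarrow> 'a) set" where
  "tuples s = {x. (\<forall>i<m. x i \<in> weights (M i)) \<and> (\<Sum>i<m. x i) = s}"

text \<open>Indices \<open>i\<close> or \<open>j\<close> outside \<open>{..<m}\<close> are allowed, so that tuples agreeing on \<open>{..<m}\<close> are adjacent.\<close>

definition adj :: "'a \<Rightarrow> (nat \<Rightarrow> 'a) \<Rightarrow> (nat \<Rightarrow> 'a) \<Rightarrow> bool" where
  "adj s x y \<longleftrightarrow> x \<in> tuples s \<and> y \<in> tuples s \<and> (\<exists>i j. \<forall>l<m. l \<noteq> i \<longrightarrow> l \<noteq> j \<longrightarrow> x l = y l)"

lemma tuples_weight: "x \<in> tuples s \<Longrightarrow> i < m \<Longrightarrow> x i \<in> weights (M i)"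
  by (simp add: tuples_def)

lemma tuples_sum: "x \<in> tuples s \<Longrightarrow> (\<Sum>i<m. x i) = s"
  by (simp add: tuples_def)

lemma tuples_below:
  assumes "x \<in> tuples s" "i < m" "regular c"
  shows "below c (x i) (M i (chamber c))"
  using tuples_weight[OF assms(1,2)] assms(3) by (simp add: section_weights_iff)

lemma tuples_upd:
  assumes x: "x \<in> tuples s" and "i < m" and "a \<in> weights (M i)"
  shows "x(i := a) \<in> tuples (s - x i + a)"
  using assms sum_fun_upd[of "{..<m}" i x a] by (auto simp: tuples_def)

lemma tuples_move:
  assumes x: "x \<in> tuples s" and "i < m" "j < m" "i \<noteq> j"
    and "x i + v \<in> weights (M i)" "x j - v \<in> weights (M j)"
  shows "adj s x (x(i := x i + v, j := x j - v))"
proof -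
  have "x(i := x i + v) \<in> tuples (s - x i + (x i + v))" using tuples_upd assms by blast
  from tuples_upd[OF this assms(3), of "x j - v"] assms(4,6)
  have "x(i := x i + v, j := x j - v) \<in> tuples s" by simp
  then show ?thesis using x unfolding adj_def by auto
qed

lemma total_coord:
  assumes x: "x \<in> tuples s"
  shows "(total \<sigma> - s) \<bullet> v = (\<Sum>i<m. (M i \<sigma> - x i) \<bullet> v)"
  using tuples_sum[OF x] by (simp add: total_def inner_diff_left inner_sum_left sum_subtractf flip: tuples_sum[OF x])

lemma tuples_section_weights:
  assumes x: "x \<in> tuples s"
  shows "s \<in> weights total"
proof -
  have "below c s (total (chamber c))" if c: "regular c" for c
    using below_coords[OF c tuples_below[OF x _ c]]
    by (auto simp: below_def dual_cone_chamber[OF c] root_lattice_iff[OF c] total_coord[OF x] intro!: sum_nonneg Ints_sum)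
  then show ?thesis by (simp add: section_weights_iff)
qed

lemma vertex_tuple:
  assumes c: "regular c"
  shows "(\<lambda>i. M i (chamber c)) \<in> tuples (total (chamber c))"
proof -
  have "M i (chamber c) \<in> weights (M i)" if "i < m" for i
    using special_dominant[OF special[OF that] c] root_lattice_0
    by (intro dominant_section_weight[OF special[OF that] c]) (auto simp: below_def dual_cone_def)
  then show ?thesis by (simp add: tuples_def total_def)
qed

text \<open>One summand must have a positive product with \<gamma>, and saturation applies to it. In
  this form saturation passes to sums of weights.\<close>

lemma tuples_down:
  assumes u: "u \<in> tuples s" and g: "\<gamma> \<in> \<Delta>" "0 < s \<bullet> \<gamma>"
  shows "\<exists>i<m. 0 < u i \<bullet> \<gamma> \<and> u i - \<gamma> \<in> weights (M i)"
proof -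
  have "\<exists>i<m. 0 < u i \<bullet> \<gamma>"
  proof (rule ccontr)
    assume "\<not> ?thesis"
    then have "(\<Sum>i<m. u i \<bullet> \<gamma>) \<le> 0" by (intro sum_nonpos) (metis lessThan_iff not_less)
    then show False using g(2) tuples_sum[OF u] by (simp flip: inner_sum_left)
  qed
  then show ?thesis using section_weights_diff_root[OF special tuples_weight[OF u] g(1)] by blast
qed

text \<open>On the way down from the vertex, the gap K = u - s has K \<bullet> K > 0, so some simple
  root \<gamma> occurs in K with \<gamma> \<bullet> K > 0. As s is dominant, u \<bullet> \<gamma> is
  positive too and \<gamma> can be subtracted from a summand.\<close>

lemma tuples_nonempty:
  assumes s: "s \<in> weights total"
  shows "tuples s \<noteq> {}"
proof -
  obtain c where c: "regular c" and dom: "\<And>\<beta>. \<beta> \<in> pos c \<Longrightarrow> 0 \<le> \<beta> \<bullet> s"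
    using exists_dominating_chamber by blast
  have "tuples s \<noteq> {}" if "tuples u \<noteq> {}" "below c s u" for u
    using that
  proof (induction "height c (u - s)" arbitrary: u rule: less_induct)
    case less
    define K where "K = u - s"
    have K0: "0 \<le> coord c K \<delta>" "coord c K \<delta> \<in> \<int>" if "\<delta> \<in> base c" for \<delta>
      using below_coords[OF c less.prems(2) that] by (auto simp: K_def)
    show ?case
    proof (cases "K = 0")
      case True
      then show ?thesis using less.prems(1) by (simp add: K_def)
    next
      case False
      then have pos: "0 < K \<bullet> K" by simp
      have "\<exists>\<gamma>\<in>base c. 0 < coord c K \<gamma> * (\<gamma> \<bullet> K)"
      proof (rule ccontr)
        assume "\<not> ?thesis"
        then have "(\<Sum>\<gamma>\<in>base c. coord c K \<gamma> * (\<gamma> \<bullet> K)) \<le> 0" by (intro sum_nonpos) (metis not_less)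
        then show False using pos inner_base_expansion[OF c, of K K] by simp
      qed
      then obtain \<gamma> where g: "\<gamma> \<in> base c" "0 < coord c K \<gamma> * (\<gamma> \<bullet> K)" by blast
      note gD = base_root[OF g(1)]
      have Kg: "0 < coord c K \<gamma>" and gK: "0 < \<gamma> \<bullet> K"
        using g(2) K0(1)[OF g(1)] by (auto simp: zero_less_mult_iff)
      obtain x where x: "x \<in> tuples u" using less.prems(1) by blast
      have "0 < u \<bullet> \<gamma>" using gK dom[OF base_pos[OF g(1)]] by (simp add: K_def inner_diff_right inner_commute)
      then obtain i where i: "i < m" "x i - \<gamma> \<in> weights (M i)"
        using tuples_down[OF x gD] by blast
      have "x(i := x i - \<gamma>) \<in> tuples (u - \<gamma>)" using tuples_upd[OF x i] by simp
      then have ne: "tuples (u - \<gamma>) \<noteq> {}" by blast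
      have K': "coord c (u - \<gamma> - s) \<delta> = coord c K \<delta> - (if \<gamma> = \<delta> then 1 else 0)" for \<delta>
        by (simp add: K_def inner_diff_left base_coweight[OF c g(1)])
      have ge: "1 \<le> coord c K \<gamma>" by (rule Ints_pos_ge_1[OF K0(2)[OF g(1)] Kg])
      have "0 \<le> coord c (u - \<gamma> - s) \<delta>" if "\<delta> \<in> base c" for \<delta>
        using K0(1)[OF that] ge unfolding K' by auto
      moreover have "u - \<gamma> - s \<in> root_lattice \<Delta>"
        using root_lattice_diff[OF _ root_in_root_lattice[OF gD], of "u - s"] less.prems(2)
        by (simp add: below_def algebra_simps)
      ultimately have bel: "below c s (u - \<gamma>)" by (simp add: below_def dual_cone_chamber[OF c])
      have "height c (u - \<gamma> - s) < height c (u - s)"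
        using height_diff[OF c g(1) ge] by (simp add: K_def algebra_simps)
      from less.hyps[OF this ne bel] show ?thesis .
    qed
  qed
  moreover have "below c s (total (chamber c))" using s c by (simp add: section_weights_iff)
  ultimately show ?thesis using vertex_tuple[OF c] by blast
qed

lemma adj_sym: "adj s x y \<Longrightarrow> adj s y x"
  unfolding adj_def by metis

lemma adj_tuples: "adj s x y \<Longrightarrow> x \<in> tuples s" "adj s x y \<Longrightarrow> y \<in> tuples s"
  by (auto simp: adj_def)

lemma adj_rtranclp_sym: "(adj s)\<^sup>*\<^sup>* x y \<Longrightarrow> (adj s)\<^sup>*\<^sup>* y x"
  by (metis adj_sym sympI symp_rtranclp sympD)

lemma adj_rtranclp_tuples: "(adj s)\<^sup>*\<^sup>* x y \<Longrightarrow> x \<in> tuples s \<Longrightarrow> y \<in> tuples s"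
  by (induction rule: rtranclp_induct) (auto dest: adj_tuples)

text \<open>Every tuple on the chain has a summand from which \<gamma> can be subtracted, because
  \<open>(s + \<gamma>) \<bullet> \<gamma>\<close> is positive. Which one is chosen is immaterial:
  two choices give adjacent tuples.\<close>

lemma adj_push_down:
  assumes path: "(adj (s + \<gamma>))\<^sup>*\<^sup>* u w" and u: "u \<in> tuples (s + \<gamma>)"
    and g: "\<gamma> \<in> \<Delta>" "0 < (s + \<gamma>) \<bullet> \<gamma>"
    and a: "a < m" "u a - \<gamma> \<in> weights (M a)"
    and b: "b < m" "w b - \<gamma> \<in> weights (M b)"
  shows "(adj s)\<^sup>*\<^sup>* (u(a := u a - \<gamma>)) (w(b := w b - \<gamma>))"
proof -
  have down: "v(d := v d - \<gamma>) \<in> tuples s"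
    if "v \<in> tuples (s + \<gamma>)" "d < m" "v d - \<gamma> \<in> weights (M d)" for v d
    using tuples_upd[OF that] by simp
  have same: "adj s (v(d := v d - \<gamma>)) (v(e := v e - \<gamma>))"
    if "v \<in> tuples (s + \<gamma>)" "d < m" "v d - \<gamma> \<in> weights (M d)"
      "e < m" "v e - \<gamma> \<in> weights (M e)" for v d e
    using down[OF that(1-3)] down[OF that(1,4,5)] unfolding adj_def
    by (intro conjI exI[of _ d] exI[of _ e]) auto
  show ?thesis
    using path b
  \<comment> \<open>The hypothesis covers every admissible index at the current end of the chain, so
    the index may be changed before each step.\<close>
  proof (induction arbitrary: b rule: rtranclp_induct)
    case base
    then show ?case using same[OF u a] by blast
  next
    case (step w w')
    obtain i j where ij: "\<And>l. l < m \<Longrightarrow> l \<noteq> i \<Longrightarrow> l \<noteq> j \<Longrightarrow> w l = w' l"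
      and w: "w \<in> tuples (s + \<gamma>)" and w': "w' \<in> tuples (s + \<gamma>)"
      using step.hyps(2) by (auto simp: adj_def)
    obtain d where d: "d < m" "w d - \<gamma> \<in> weights (M d)"
      using tuples_down[OF w g] by blast
    have one: "(adj s)\<^sup>*\<^sup>* (u(a := u a - \<gamma>)) (w'(e := w' e - \<gamma>))"
      if e: "e < m" "w e - \<gamma> \<in> weights (M e)" "w' e - \<gamma> \<in> weights (M e)" for e
    proof -
      have "adj s (w(e := w e - \<gamma>)) (w'(e := w' e - \<gamma>))"
        using down[OF w e(1,2)] down[OF w' e(1,3)] ij unfolding adj_def
        by (intro conjI exI[of _ i] exI[of _ j]) auto
      then show ?thesis using step.IH[OF e(1,2)] by (meson rtranclp.rtrancl_into_rtrancl)
    qed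
    \<comment> \<open>The step from w to w' touches only i and j. If b or d is not among them, that
      index can be lowered on both sides; otherwise both lowered indices are among i and j, and the
      results still agree elsewhere.\<close>
    consider "b \<noteq> i" "b \<noteq> j" | "d \<noteq> i" "d \<noteq> j" | "b = i \<or> b = j" "d = i \<or> d = j" by blast
    then show ?case
    proof cases
      case 1
      then have "w b = w' b" using ij[OF step.prems(1)] by blast
      then show ?thesis using one[OF step.prems(1) _ step.prems(2)] step.prems(2) by metis
    next
      case 2
      then have d': "w' d - \<gamma> \<in> weights (M d)" using d(2) ij[OF d(1)] by metis
      show ?thesis
        using one[OF d d'] same[OF w' d(1) d' step.prems] by (meson rtranclp.rtrancl_into_rtrancl)
    next
      case 3
      then have "adj s (w(d := w d - \<gamma>)) (w'(b := w' b - \<gamma>))"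
        using down[OF w d] down[OF w' step.prems] ij unfolding adj_def
        by (intro conjI exI[of _ i] exI[of _ j]) auto
      then show ?thesis using step.IH[OF d] by (meson rtranclp.rtrancl_into_rtrancl)
    qed
  qed
qed

text \<open>Raise the \<open>i\<close>-th summand by simple roots, at the expense of the others, until it is dominant or
  \<open>\<gamma>\<close> is one of the admissible roots; its \<open>\<gamma>\<close>-coordinate stays below that of the vertex.\<close>

lemma exists_liftable:
  assumes x: "x \<in> tuples s" and c: "regular c" and dom: "\<And>\<beta>. \<beta> \<in> pos c \<Longrightarrow> 0 \<le> s \<bullet> \<beta>"
    and g: "\<gamma> \<in> base c"
    and short: "\<And>\<delta>. \<delta> \<in> base c \<Longrightarrow> 0 < coord c (total (chamber c) - s) \<delta> \<Longrightarrow> \<gamma> \<bullet> \<gamma> \<le> \<delta> \<bullet> \<delta>"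
    and i: "i < m" "0 < coord c (M i (chamber c) - x i) \<gamma>"
  shows "\<exists>x' i. (adj s)\<^sup>*\<^sup>* x x' \<and> i < m \<and> x' i + \<gamma> \<in> weights (M i)"
  using x i(2)
proof (induction "height c (M i (chamber c) - x i)" arbitrary: x rule: less_induct)
  case less
  note x = less.prems(1)
  let ?m = "M i (chamber c)"
  show ?case
  proof (cases "\<forall>\<delta>\<in>base c. 0 \<le> \<delta> \<bullet> x i")
    case True
    \<comment> \<open>A simple root occurring between \<open>x i\<close> and its vertex also occurs
      in the total gap, so \<gamma> is no longer than any such root.\<close>
    have "0 < coord c (total (chamber c) - s) \<delta>"
      if d: "\<delta> \<in> base c" "0 < coord c (?m - x i) \<delta>" for \<delta>
    proof -
      have "0 < (\<Sum>j<m. coord c (M j (chamber c) - x j) \<delta>)"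
        using below_coords(1)[OF c tuples_below[OF x _ c] d(1)] d(2) i(1)
        by (intro sum_pos2[of _ i]) auto
      then show ?thesis by (simp add: total_coord[OF x])
    qed
    then have "x i + \<gamma> \<in> weights (M i)"
      using short less.prems(2) pos_base_inner_nonneg[OF c, of "x i"] True
      by (intro section_weights_add_base[OF special[OF i(1)] tuples_weight[OF x i(1)] c _ g])
        (auto simp: inner_commute[of "x i"])
    then show ?thesis using i(1) by blast
  next
    case False
    then obtain \<delta> where d: "\<delta> \<in> base c" "x i \<bullet> \<delta> < 0" by (metis inner_commute not_less)
    note dD = base_root[OF d(1)]
    have up: "x i + \<delta> \<in> weights (M i)"
      by (rule section_weights_add_root[OF special[OF i(1)] tuples_weight[OF x i(1)] dD d(2)])
    show ?thesis
    proof (cases "\<delta> = \<gamma>")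
      case True
      then show ?thesis using up i(1) by blast
    next
      case dg: False
      \<comment> \<open>As s is dominant, the negative product of \<open>x i\<close> with \<delta>
        is made up for by another summand, which can give up \<delta>.\<close>
      have "\<exists>j<m. 0 < x j \<bullet> \<delta>"
      proof (rule ccontr)
        assume "\<not> ?thesis"
        then have "\<forall>j<m. x j \<bullet> \<delta> \<le> 0" by (metis not_less)
        then have "(\<Sum>j<m. x j \<bullet> \<delta>) < (\<Sum>j<m. 0)"
          using d(2) i(1) by (intro sum_strict_mono_ex1) auto
        then show False using dom[OF base_pos[OF d(1)]] tuples_sum[OF x] by (simp flip: inner_sum_left)
      qed
      then obtain j where j: "j < m" "0 < x j \<bullet> \<delta>" by blast
      have ij: "i \<noteq> j" using d(2) j(2) by auto
      have dn: "x j - \<delta> \<in> weights (M j)"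
        by (rule section_weights_diff_root[OF special[OF j(1)] tuples_weight[OF x j(1)] dD j(2)])
      let ?x = "x(i := x i + \<delta>, j := x j - \<delta>)"
      have ad: "adj s x ?x" by (rule tuples_move[OF x i(1) j(1) ij up dn])
      have xi: "?x i = x i + \<delta>" using ij by simp
      have coord: "coord c (?m - ?x i) \<eta> = coord c (?m - x i) \<eta> - (if \<delta> = \<eta> then 1 else 0)" for \<eta>
        unfolding xi by (simp add: inner_diff_left inner_add_left base_coweight[OF c d(1)])
      have "below c (x i + \<delta>) ?m" using up c by (simp add: section_weights_iff)
      from below_coords(1)[OF c this d(1)]
      have ge: "1 \<le> coord c (?m - x i) \<delta>" 
        by (simp add: inner_diff_left inner_add_left base_coweight[OF c d(1)])
      have "?m - ?x i = (?m - x i) - \<delta>" unfolding xi by simp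
      then have "height c (?m - ?x i) < height c (?m - x i)" using height_diff[OF c d(1) ge] by (simp only:)
      moreover have "0 < coord c (?m - ?x i) \<gamma>" unfolding coord using dg less.prems(2) by simp
      ultimately obtain x' k where "(adj s)\<^sup>*\<^sup>* ?x x'" "k < m" "x' k + \<gamma> \<in> weights (M k)"
        using less.hyps[OF _ adj_tuples(2)[OF ad]] by blast
      then show ?thesis using converse_rtranclp_into_rtranclp[of "adj s", OF ad] by blast
    qed
  qed
qed

text \<open>The measure counts the weights of the product that are longer than s. When S is empty, s
  is the vertex and its decomposition is unique: nonnegative gaps with sum zero all vanish.\<close>

theorem tuples_connected:
  assumes "x \<in> tuples s" "y \<in> tuples s"
  shows "(adj s)\<^sup>*\<^sup>* x y"
  using assms
proof (induction "card {t \<in> weights total. - (t \<bullet> t) < - (s \<bullet> s)}" arbitrary: s x y rule: less_induct)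
  case less
  note x = less.prems(1) and y = less.prems(2)
  obtain c where c: "regular c" and dom: "\<And>\<beta>. \<beta> \<in> pos c \<Longrightarrow> 0 \<le> s \<bullet> \<beta>"
    using exists_dominating_chamber[of s] by (metis inner_commute)
  define K where "K = total (chamber c) - s"
  have Ks: "coord c K \<delta> = (\<Sum>i<m. coord c (M i (chamber c) - z i) \<delta>)" if "z \<in> tuples s" for z \<delta>
    unfolding K_def by (rule total_coord[OF that])
  have z0: "0 \<le> coord c (M i (chamber c) - z i) \<delta>" if "z \<in> tuples s" "i < m" "\<delta> \<in> base c" for z i \<delta>
    using below_coords(1)[OF c tuples_below[OF that(1,2) c] that(3)] .
  define S where "S = {\<delta> \<in> base c. 0 < coord c K \<delta>}"
  show ?case
  proof (cases "S = {}")
    case True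
    have "z i = M i (chamber c)" if z: "z \<in> tuples s" "i < m" for z i
    proof -
      have "coord c (M i (chamber c) - z i) \<delta> = 0" if d: "\<delta> \<in> base c" for \<delta>
      proof -
        have "(\<Sum>i<m. coord c (M i (chamber c) - z i) \<delta>) \<le> 0"
          using True d Ks[OF z(1), of \<delta>] by (force simp: S_def)
        moreover have "coord c (M i (chamber c) - z i) \<delta> \<le> (\<Sum>i<m. coord c (M i (chamber c) - z i) \<delta>)"
          using z0[OF z(1) _ d] z(2) by (intro member_le_sum) auto
        ultimately show ?thesis using z0[OF z d] by linarith
      qed
      then show ?thesis using eq_0_if_coords_0[OF c] by fastforce
    qed
    then have "\<forall>l<m. x l = y l" using x y by metis
    then have "adj s x y" using x y unfolding adj_def by blast
    then show ?thesis by blast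
  next
    case False
    have finS: "finite S" using finite_base by (simp add: S_def)
    obtain \<gamma> where g: "\<gamma> \<in> S" "\<And>\<delta>. \<delta> \<in> S \<Longrightarrow> \<gamma> \<bullet> \<gamma> \<le> \<delta> \<bullet> \<delta>"
      using ex_is_arg_min_if_finite[OF finS False, of "\<lambda>\<delta>. \<delta> \<bullet> \<delta>"] by (auto simp: is_arg_min_linorder)
    have gb: "\<gamma> \<in> base c" and Kg: "0 < coord c K \<gamma>" using g(1) by (auto simp: S_def)
    note gD = base_root[OF gb]
    have lift: "\<exists>z' i. (adj s)\<^sup>*\<^sup>* z z' \<and> i < m \<and> z' i + \<gamma> \<in> weights (M i)" if z: "z \<in> tuples s" for z
    proof -
      have "\<exists>i<m. 0 < coord c (M i (chamber c) - z i) \<gamma>"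
      proof (rule ccontr)
        assume "\<not> ?thesis"
        then have "(\<Sum>i<m. coord c (M i (chamber c) - z i) \<gamma>) \<le> 0"
          by (intro sum_nonpos) (metis lessThan_iff not_less)
        then show False using Kg Ks[OF z] by simp
      qed
      then obtain i where i: "i < m" "0 < coord c (M i (chamber c) - z i) \<gamma>" by blast
      show ?thesis using exists_liftable[OF z c dom gb _ i] g(2) by (auto simp: S_def K_def)
    qed
    have sg: "0 \<le> s \<bullet> \<gamma>" using dom[OF base_pos[OF gb]] .
    have gg: "0 < \<gamma> \<bullet> \<gamma>" using root_nonzero[OF gD] by simp
    obtain x' i where x': "(adj s)\<^sup>*\<^sup>* x x'" "i < m" "x' i + \<gamma> \<in> weights (M i)" using lift[OF x] by blast
    obtain y' j where y': "(adj s)\<^sup>*\<^sup>* y y'" "j < m" "y' j + \<gamma> \<in> weights (M j)" using lift[OF y] by blast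
    have x't: "x' \<in> tuples s" and y't: "y' \<in> tuples s" using adj_rtranclp_tuples x' y' x y by auto
    define u where "u = x'(i := x' i + \<gamma>)"
    define w where "w = y'(j := y' j + \<gamma>)"
    have u: "u \<in> tuples (s + \<gamma>)" using tuples_upd[OF x't x'(2,3)] by (simp add: u_def)
    have w: "w \<in> tuples (s + \<gamma>)" using tuples_upd[OF y't y'(2,3)] by (simp add: w_def)
    have "(s + \<gamma>) \<bullet> (s + \<gamma>) = s \<bullet> s + 2 * (s \<bullet> \<gamma>) + \<gamma> \<bullet> \<gamma>"
      by (simp add: inner_add_left inner_add_right inner_commute)
    then have "- ((s + \<gamma>) \<bullet> (s + \<gamma>)) < - (s \<bullet> s)" using sg gg by linarith
    from card_filter_less[OF finite_section_weights tuples_section_weights[OF u], of "\<lambda>t. - (t \<bullet> t)", OF this]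
    have path: "(adj (s + \<gamma>))\<^sup>*\<^sup>* u w" using less.hyps u w by blast
    have "0 < (s + \<gamma>) \<bullet> \<gamma>" unfolding inner_add_left using sg gg by (rule add_nonneg_pos)
    moreover have "u i - \<gamma> = x' i" "w j - \<gamma> = y' j" by (auto simp: u_def w_def)
    ultimately have "(adj s)\<^sup>*\<^sup>* (u(i := u i - \<gamma>)) (w(j := w j - \<gamma>))"
      using adj_push_down[OF path u gD, of i j] x'(2) y'(2) tuples_weight[OF x't x'(2)] tuples_weight[OF y't y'(2)]
      by simp
    moreover have "u(i := u i - \<gamma>) = x'" "w(j := w j - \<gamma>) = y'" by (auto simp: u_def w_def)
    ultimately have "(adj s)\<^sup>*\<^sup>* x' y'" by simp
    then show ?thesis using x'(1) adj_rtranclp_sym[OF y'(1)] by (meson rtranclp_trans)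
  qed
qed

end

section \<open>A criterion for quadratic algebras\<close>

abbreviation keys :: "('k \<Rightarrow>\<^sub>0 'v::zero) \<Rightarrow> 'k set" where
  "keys \<equiv> Poly_Mapping.keys"

abbreviation lookup :: "('k \<Rightarrow>\<^sub>0 'v::zero) \<Rightarrow> 'k \<Rightarrow> 'v" where
  "lookup \<equiv> Poly_Mapping.lookup"

abbreviation single :: "'k \<Rightarrow> 'v \<Rightarrow> 'k \<Rightarrow>\<^sub>0 'v::zero" where
  "single \<equiv> Poly_Mapping.single"

section \<open>Finitely supported functions and monomials\<close>

lemma lookup_sum_singles:
  fixes h :: "'k \<Rightarrow> 'v::comm_monoid_add"
  assumes "finite A" "\<And>a. a \<notin> A \<Longrightarrow> h a = 0"
  shows "lookup (\<Sum>a\<in>A. single a (h a)) b = h b"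
proof -
  have "lookup (\<Sum>a\<in>A. single a (h a)) b = (\<Sum>a\<in>A. if b = a then h a else 0)"
    unfolding lookup_sum by (intro sum.cong) (auto simp: lookup_single when_def)
  then show ?thesis using assms by simp
qed

lemma poly_mapping_sum_singles:
  fixes f :: "'k \<Rightarrow>\<^sub>0 'v::comm_monoid_add"
  shows "(\<Sum>a\<in>keys f. single a (lookup f a)) = f"
  by (intro poly_mapping_eqI lookup_sum_singles) (simp_all add: in_keys_iff)

lemma poly_mapping_add_induct [case_names zero single add]:
  fixes f :: "'k \<Rightarrow>\<^sub>0 'v::comm_monoid_add"
  assumes "P 0" and "\<And>a c. a \<in> keys f \<Longrightarrow> P (single a c)"
    and "\<And>f g. P f \<Longrightarrow> P g \<Longrightarrow> P (f + g)"
  shows "P f"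
proof -
  have "P (\<Sum>a\<in>A. single a (lookup f a))" if "A \<subseteq> keys f" for A
    using that
  proof (induction A rule: infinite_finite_induct)
    case (insert a A)
    then show ?case using assms by auto
  qed (use assms(1) in auto)
  then show ?thesis using poly_mapping_sum_singles[of f] by (metis order_refl)
qed

lemma nat_keys_add: "keys (a + b) = keys a \<union> keys (b :: 'b \<Rightarrow>\<^sub>0 nat)"
  by (auto simp: in_keys_iff lookup_add)

lemma monomial_value_add:
  fixes h :: "'k \<Rightarrow> 'r::comm_semiring_1"
  shows "(\<Prod>w\<in>keys (a + b). h w ^ lookup (a + b) w) =
   (\<Prod>w\<in>keys a. h w ^ lookup a w) *
   (\<Prod>w\<in>keys b. h w ^ lookup b w)"
proof -
  let ?S = "keys a \<union> keys b"
  have ext: "(\<Prod>w\<in>keys c. h w ^ lookup c w) = (\<Prod>w\<in>?S. h w ^ lookup c w)"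
    if "keys c \<subseteq> ?S" for c :: "'k \<Rightarrow>\<^sub>0 nat"
    using that by (intro prod.mono_neutral_left) (auto simp: in_keys_iff)
  show ?thesis
    using ext[of a] ext[of b] ext[of "a + b"] by (simp add: nat_keys_add lookup_add power_add prod.distrib)
qed

lemma monom_degree_superset:
  assumes "finite S" "keys a \<subseteq> S"
  shows "monom_degree a = (\<Sum>i\<in>S. lookup a i)"
  unfolding monom_degree_def using assms by (intro sum.mono_neutral_left) (auto simp: in_keys_iff)

lemma monom_degree_add: "monom_degree (a + b) = monom_degree a + monom_degree b"
proof -
  let ?S = "keys a \<union> keys b"
  have "monom_degree (a + b) = (\<Sum>i\<in>?S. lookup (a + b) i)"
    by (rule monom_degree_superset) (simp_all add: nat_keys_add)
  then show ?thesis
    using monom_degree_superset[of ?S a] monom_degree_superset[of ?S b]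
    by (simp add: lookup_add sum.distrib)
qed

lemma monom_degree_0 [simp]: "monom_degree 0 = 0"
  by (simp add: monom_degree_def)

lemma monom_degree_single [simp]: "monom_degree (single i n) = n"
  by (simp add: monom_degree_def)

lemma nat_monom_split:
  fixes a :: "'v \<Rightarrow>\<^sub>0 nat"
  assumes "j \<in> keys a"
  obtains b where "a = single j 1 + b"
proof
  show "a = single j 1 + (a - single j 1)"
    using assms by (intro poly_mapping_eqI) (auto simp: lookup_add lookup_minus lookup_single when_def in_keys_iff)
qed

section \<open>Polynomials in the variables of a set, and ideals\<close>

lemma free_alg_0: "0 \<in> free_alg W"
  by (simp add: free_alg_def)

lemma free_alg_single: "keys a \<subseteq> W \<Longrightarrow> single a c \<in> free_alg W"
  by (simp add: free_alg_def)

lemma free_alg_1: "1 \<in> free_alg W"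
  by (simp add: free_alg_def)

lemma free_alg_variable: "w \<in> W \<Longrightarrow> variable w \<in> free_alg W"
  by (simp add: variable_def free_alg_single)

lemma free_alg_add: "f \<in> free_alg W \<Longrightarrow> g \<in> free_alg W \<Longrightarrow> f + g \<in> free_alg W"
  unfolding free_alg_def using keys_add[of f g] by blast

lemma free_alg_mult: "f \<in> free_alg W \<Longrightarrow> g \<in> free_alg W \<Longrightarrow> f * g \<in> free_alg W"
  unfolding free_alg_def using keys_mult[of f g] by (fastforce simp: nat_keys_add)

lemma free_alg_uminus: "f \<in> free_alg W \<Longrightarrow> - f \<in> free_alg W"
  by (simp add: free_alg_def)

lemma free_alg_diff: "f \<in> free_alg W \<Longrightarrow> g \<in> free_alg W \<Longrightarrow> f - g \<in> free_alg W"
  using free_alg_add[of f W "- g"] free_alg_uminus[of g W] by simp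

lemma free_alg_sum: "(\<And>i. i \<in> A \<Longrightarrow> f i \<in> free_alg W) \<Longrightarrow> sum f A \<in> free_alg W"
  by (induction A rule: infinite_finite_induct) (auto simp: free_alg_0 free_alg_add)

lemma free_alg_prod_list: "(\<And>f. f \<in> set fs \<Longrightarrow> f \<in> free_alg W) \<Longrightarrow> prod_list fs \<in> free_alg W"
  by (induction fs) (auto simp: free_alg_1 free_alg_mult)

lemma free_alg_induct [consumes 1, case_names const add mult]:
  assumes f: "f \<in> free_alg W"
    and const: "\<And>c. P (single 0 c)"
    and add: "\<And>f g. P f \<Longrightarrow> P g \<Longrightarrow> P (f + g)"
    and mult: "\<And>f w. P f \<Longrightarrow> f \<in> free_alg W \<Longrightarrow> w \<in> W \<Longrightarrow> P (variable w * f)"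
  shows "P f"
proof -
  have single: "P (single a c)" if "keys a \<subseteq> W" for a c
    using that
  proof (induction "monom_degree a" arbitrary: a)
    case 0
    then have "a = 0" by (auto simp: monom_degree_def in_keys_iff intro!: poly_mapping_eqI)
    then show ?case using const by simp
  next
    case (Suc n)
    then obtain w where w: "w \<in> keys a" by (force simp: monom_degree_def)
    obtain b where a: "a = single w 1 + b" using nat_monom_split[OF w] .
    have "monom_degree b = n" using Suc.hyps(2) unfolding a monom_degree_add by simp
    moreover have bW: "keys b \<subseteq> W" using Suc.prems unfolding a nat_keys_add by auto
    ultimately have "P (single b c)" using Suc.hyps(1) by blast
    then have "P (variable w * single b c)"
      using mult free_alg_single[OF bW] w Suc.prems by blast
    then show ?case by (simp add: variable_def mult_single a)
  qed
  show ?thesis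
    by (induction f rule: poly_mapping_add_induct)
      (use f single const[of 0] add in \<open>auto simp: free_alg_def\<close>)
qed

text \<open>In \<open>ideal_in\<close> each generator carries a single coefficient, so the two
  representations are merged over the union of their generators.\<close>

lemma ideal_in_add:
  assumes R: "0 \<in> R" "\<And>f g. f \<in> R \<Longrightarrow> g \<in> R \<Longrightarrow> f + g \<in> R"
    and "f \<in> ideal_in R S" "g \<in> ideal_in R S"
  shows "f + g \<in> ideal_in R S"
proof -
  obtain G p where G: "finite G" "G \<subseteq> S" "\<And>x. x \<in> G \<Longrightarrow> p x \<in> R" "f = (\<Sum>x\<in>G. p x * x)"
    using assms(3) by (auto simp: ideal_in_def)
  obtain H q where H: "finite H" "H \<subseteq> S" "\<And>x. x \<in> H \<Longrightarrow> q x \<in> R" "g = (\<Sum>x\<in>H. q x * x)"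
    using assms(4) by (auto simp: ideal_in_def)
  define r where "r x = (if x \<in> G then p x else 0) + (if x \<in> H then q x else 0)" for x
  have "(\<Sum>x\<in>G \<union> H. (if x \<in> G then p x else 0) * x) = f"
    unfolding G(4) using G(1) H(1) by (intro sum.mono_neutral_cong_right) auto
  moreover have "(\<Sum>x\<in>G \<union> H. (if x \<in> H then q x else 0) * x) = g"
    unfolding H(4) using G(1) H(1) by (intro sum.mono_neutral_cong_right) auto
  ultimately have "f + g = (\<Sum>x\<in>G \<union> H. r x * x)"
    unfolding r_def distrib_right sum.distrib by simp
  moreover have "r x \<in> R" if "x \<in> G \<union> H" for x
    unfolding r_def using G(3) H(3) R by auto
  ultimately show ?thesis unfolding ideal_in_def using G(1,2) H(1,2)
    by (intro CollectI exI[of _ "G \<union> H"] exI[of _ r]) auto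
qed

lemma ideal_in_mult:
  assumes "\<And>f g. f \<in> R \<Longrightarrow> g \<in> R \<Longrightarrow> f * g \<in> R" "r \<in> R" "f \<in> ideal_in R S"
  shows "r * f \<in> ideal_in R S"
proof -
  obtain G p where G: "finite G" "G \<subseteq> S" "\<And>x. x \<in> G \<Longrightarrow> p x \<in> R" "f = (\<Sum>x\<in>G. p x * x)"
    using assms(3) by (auto simp: ideal_in_def)
  have "r * f = (\<Sum>x\<in>G. (r * p x) * x)" unfolding G(4) by (simp add: sum_distrib_left mult.assoc)
  then show ?thesis unfolding ideal_in_def using G(1-3) assms(1,2)
    by (intro CollectI exI[of _ G] exI[of _ "\<lambda>x. r * p x"]) auto
qed

lemma ideal_in_0: "0 \<in> ideal_in R S"
  unfolding ideal_in_def by (rule CollectI, rule exI[of _ "{}"]) simp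

lemma ideal_in_base: "1 \<in> R \<Longrightarrow> f \<in> S \<Longrightarrow> f \<in> ideal_in R S"
  unfolding ideal_in_def by (intro CollectI exI[of _ "{f}"] exI[of _ "\<lambda>_. 1"]) auto

lemma ideal_in_induct [consumes 1, case_names zero add]:
  assumes "f \<in> ideal_in R S" "P 0" "\<And>q g f. q \<in> R \<Longrightarrow> g \<in> S \<Longrightarrow> P f \<Longrightarrow> P (q * g + f)"
  shows "P f"
proof -
  obtain G p where G: "finite G" "G \<subseteq> S" "\<And>x. x \<in> G \<Longrightarrow> p x \<in> R" "f = (\<Sum>x\<in>G. p x * x)"
    using assms(1) by (auto simp: ideal_in_def)
  have "P (\<Sum>x\<in>G. p x * x)" using G(1-3)
    by (induction G rule: finite_induct) (use assms(2,3) in auto)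
  then show ?thesis by (simp add: G(4))
qed

text \<open>There is no axiom that \<iota> 1 is the ambient unit: constant sections vanish outside
  the chambers. Hence a variable w evaluates to \<iota> 1 * w.\<close>

locale algebra_hom =
  fixes \<iota> :: "complex \<Rightarrow> 'b::comm_ring_1"
  assumes hom_add: "\<iota> (z + w) = \<iota> z + \<iota> w" and hom_mult: "\<iota> (z * w) = \<iota> z * \<iota> w"
begin

lemma hom_0: "\<iota> 0 = 0"
  using hom_add[of 0 0] by simp

lemma eval_alg_add: "eval_alg \<iota> (f + g) = eval_alg \<iota> f + eval_alg \<iota> g"
  unfolding eval_alg_def
  by (rule setsum_keys_plus_distrib[where f = "\<lambda>a c. \<iota> c * (\<Prod>w\<in>keys a. w ^ lookup a w)"])
    (simp_all add: hom_0 hom_add distrib_right)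

lemma eval_alg_0: "eval_alg \<iota> 0 = 0"
  by (simp add: eval_alg_def)

lemma eval_alg_single:
  "eval_alg \<iota> (single a c) = \<iota> c * (\<Prod>w\<in>keys a. w ^ lookup a w)"
  by (simp add: eval_alg_def hom_0)

lemma eval_alg_mult: "eval_alg \<iota> (f * g) = eval_alg \<iota> f * eval_alg \<iota> g"
proof (induction f rule: poly_mapping_add_induct)
  case (single a c)
  show ?case
  proof (induction g rule: poly_mapping_add_induct)
    case (single b d)
    show ?case by (simp add: mult_single eval_alg_single monomial_value_add hom_mult algebra_simps)
  qed (simp_all add: eval_alg_0 eval_alg_add distrib_left)
qed (simp_all add: eval_alg_0 eval_alg_add distrib_right)

lemma eval_alg_minus: "eval_alg \<iota> (- f) = - eval_alg \<iota> f"
  using eval_alg_add[of f "- f"] by (simp add: eval_alg_0 eq_neg_iff_add_eq_0 add.commute)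

lemma eval_alg_diff: "eval_alg \<iota> (f - g) = eval_alg \<iota> f - eval_alg \<iota> g"
  using eval_alg_add[of f "- g"] by (simp add: eval_alg_minus)

lemma eval_alg_const: "eval_alg \<iota> (single 0 c) = \<iota> c"
  by (simp add: eval_alg_single)

lemma eval_alg_variable: "eval_alg \<iota> (variable w) = \<iota> 1 * w"
  by (simp add: variable_def eval_alg_single)

lemma eval_alg_sum: "eval_alg \<iota> (sum f A) = (\<Sum>i\<in>A. eval_alg \<iota> (f i))"
  by (induction A rule: infinite_finite_induct) (simp_all add: eval_alg_0 eval_alg_add)

end

text \<open>A semigroup algebra in axiomatic form: the elements e t form a basis without structure
  constants, and the semigroup S is generated by its elements of degree one.\<close>

locale multiplicative_basis =
  fixes \<iota> :: "complex \<Rightarrow> 'b::comm_ring_1" and A :: "nat \<Rightarrow> 'b set"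
    and S :: "'t::comm_monoid_add set" and deg :: "'t \<Rightarrow> nat" and e :: "'t \<Rightarrow> 'b"
  assumes graded: "connected_graded_algebra \<iota> A"
    and e_0: "e 0 = \<iota> 1"
    and S_0: "0 \<in> S"
    and e_add: "\<And>s t. s \<in> S \<Longrightarrow> t \<in> S \<Longrightarrow> e (s + t) = e s * e t"
    and S_add: "\<And>s t. s \<in> S \<Longrightarrow> t \<in> S \<Longrightarrow> s + t \<in> S"
    and spanning: "\<And>m. A m = {\<Sum>t\<in>F. \<iota> (z t) * e t | F z. finite F \<and> F \<subseteq> S \<and> (\<forall>t\<in>F. deg t = m)}"
    and independent: "\<And>F z t. finite F \<Longrightarrow> F \<subseteq> S \<Longrightarrow> (\<Sum>t\<in>F. \<iota> (z t) * e t) = 0 \<Longrightarrow> t \<in> F \<Longrightarrow> z t = 0"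
    and generated: "\<And>t. t \<in> S \<Longrightarrow> \<exists>l. set l \<subseteq> {t \<in> S. deg t = 1} \<and> sum_list l = t"
begin

sublocale algebra_hom \<iota>
  using graded by unfold_locales (auto simp: connected_graded_algebra_def)

context notes One_nat_def[simp del] begin

abbreviation R :: "(('b \<Rightarrow>\<^sub>0 nat) \<Rightarrow>\<^sub>0 complex) set" where
  "R \<equiv> free_alg (A 1)"

abbreviation quadrics :: "(('b \<Rightarrow>\<^sub>0 nat) \<Rightarrow>\<^sub>0 complex) set" where
  "quadrics \<equiv> {f \<in> R. (\<forall>a\<in>keys f. monom_degree a = 2) \<and> eval_alg \<iota> f = 0}"

abbreviation I :: "(('b \<Rightarrow>\<^sub>0 nat) \<Rightarrow>\<^sub>0 complex) set" where
  "I \<equiv> ideal_in R (linear_relations \<iota> (A 1) \<union> quadrics)"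

abbreviation atoms :: "'t set" where
  "atoms \<equiv> {t \<in> S. deg t = 1}"

definition word :: "'t list \<Rightarrow> ('b \<Rightarrow>\<^sub>0 nat) \<Rightarrow>\<^sub>0 complex" where
  "word l = prod_list (map (\<lambda>t. variable (e t)) l)"

lemma unit_mult: "a \<in> A m \<Longrightarrow> \<iota> 1 * a = a"
  using graded by (auto simp: connected_graded_algebra_def)

lemma e_mem: "t \<in> S \<Longrightarrow> e t \<in> A (deg t)"
proof -
  assume t: "t \<in> S"
  have "\<iota> 1 * e t = e t" using e_add[OF S_0 t] e_0 by simp
  then have "e t = (\<Sum>s\<in>{t}. \<iota> 1 * e s)" by simp
  then show ?thesis unfolding spanning using t
    by (intro CollectI exI[of _ "{t}"] exI[of _ "\<lambda>_. 1"]) auto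
qed

lemma atom_mem: "t \<in> atoms \<Longrightarrow> e t \<in> A 1"
  using e_mem[of t] by simp

lemma A_add: "a \<in> A m \<Longrightarrow> b \<in> A m \<Longrightarrow> a + b \<in> A m" and A_0: "0 \<in> A m"
  using graded by (auto simp: connected_graded_algebra_def)

lemma A_scale: "a \<in> A m \<Longrightarrow> \<iota> z * a \<in> A m"
proof -
  assume a: "a \<in> A m"
  have "\<iota> z \<in> A 0" "\<And>m l a b. a \<in> A m \<Longrightarrow> b \<in> A l \<Longrightarrow> a * b \<in> A (m + l)"
    using graded by (auto simp: connected_graded_algebra_def)
  then show ?thesis using a by force
qed

lemma word_mem: "set l \<subseteq> atoms \<Longrightarrow> word l \<in> R"
  unfolding word_def by (rule free_alg_prod_list) (use atom_mem in \<open>auto intro: free_alg_variable\<close>)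

lemma sum_list_mem: "set l \<subseteq> atoms \<Longrightarrow> sum_list l \<in> S"
  by (induction l) (auto simp: S_0 S_add)

lemma eval_word: "set l \<subseteq> atoms \<Longrightarrow> eval_alg \<iota> (word l) = e (sum_list l)"
proof (induction l)
  case Nil
  then show ?case using eval_alg_const[of 1] by (simp add: word_def e_0)
next
  case (Cons t l)
  then have "eval_alg \<iota> (word (t # l)) = \<iota> 1 * e t * e (sum_list l)"
    by (simp add: word_def eval_alg_mult eval_alg_variable)
  then show ?case using Cons.prems unit_mult[OF e_mem] e_add sum_list_mem by simp
qed

lemma I_add: "f \<in> I \<Longrightarrow> g \<in> I \<Longrightarrow> f + g \<in> I"
  by (rule ideal_in_add) (auto simp: free_alg_0 free_alg_add)

lemma I_mult: "r \<in> R \<Longrightarrow> f \<in> I \<Longrightarrow> r * f \<in> I"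
  by (rule ideal_in_mult) (auto simp: free_alg_mult)

lemma const_mem: "single 0 c \<in> R"
  by (simp add: free_alg_single)

lemma linear_relations_subset: "linear_relations \<iota> (A 1) \<subseteq> {f \<in> R. eval_alg \<iota> f = 0}"
proof
  fix f assume "f \<in> linear_relations \<iota> (A 1)"
  then consider v w where "f = variable (v + w) - variable v - variable w" "v \<in> A 1" "w \<in> A 1"
    | z w where "f = variable (\<iota> z * w) - single 0 z * variable w" "w \<in> A 1"
    unfolding linear_relations_def by blast
  then show "f \<in> {f \<in> R. eval_alg \<iota> f = 0}"
  proof cases
    case 1
    then show ?thesis
      by (auto intro!: free_alg_diff free_alg_variable A_add simp: eval_alg_diff eval_alg_variable distrib_left)
  next
    case 2
    have "\<iota> 1 * (\<iota> z * w) = \<iota> z * (\<iota> 1 * w)" by (simp add: algebra_simps)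
    then show ?thesis using 2
      by (auto intro!: free_alg_diff free_alg_mult const_mem free_alg_variable A_scale
          simp: eval_alg_diff eval_alg_mult eval_alg_const eval_alg_variable)
  qed
qed

lemma I_subset: "I \<subseteq> {f \<in> R. eval_alg \<iota> f = 0}"
proof
  fix f assume "f \<in> I"
  then show "f \<in> {f \<in> R. eval_alg \<iota> f = 0}"
  proof (induction rule: ideal_in_induct)
    case zero
    then show ?case by (simp add: free_alg_0 eval_alg_0)
  next
    case (add q g f)
    then have "g \<in> R" "eval_alg \<iota> g = 0" using linear_relations_subset by auto
    then show ?case using add by (simp add: free_alg_add free_alg_mult eval_alg_add eval_alg_mult)
  qed
qed

lemma I_linear: "f \<in> linear_relations \<iota> (A 1) \<Longrightarrow> f \<in> I"
  by (intro ideal_in_base) (auto simp: free_alg_1)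

text \<open>The linear relations express each variable through variables of basis elements. The
  empty sum needs that the variable of the zero vector lies in I, which is the scalar relation with
  z = 0.\<close>

lemma variable_linear_comb:
  assumes "finite F" "F \<subseteq> atoms"
  shows "variable (\<Sum>t\<in>F. \<iota> (z t) * e t) - (\<Sum>t\<in>F. single 0 (z t) * variable (e t)) \<in> I"
  using assms
proof (induction F rule: finite_induct)
  case empty
  have "variable (\<iota> 0 * 0) - single 0 0 * variable 0 \<in> linear_relations \<iota> (A 1)"
    unfolding linear_relations_def using A_0 by blast
  then show ?case using I_linear by (simp add: hom_0)
next
  case (insert t F)
  let ?w = "\<Sum>t\<in>F. \<iota> (z t) * e t"
  have w: "?w \<in> A 1" unfolding spanning using insert by auto
  have t: "e t \<in> A 1" using insert.prems atom_mem by blast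
  have "variable (\<iota> (z t) * e t + ?w) - variable (\<iota> (z t) * e t) - variable ?w \<in> linear_relations \<iota> (A 1)"
    unfolding linear_relations_def using A_scale[OF t] w by blast
  then have 1: "variable (\<iota> (z t) * e t + ?w) - variable (\<iota> (z t) * e t) - variable ?w \<in> I" by (rule I_linear)
  have "variable (\<iota> (z t) * e t) - single 0 (z t) * variable (e t) \<in> linear_relations \<iota> (A 1)"
    unfolding linear_relations_def using t by blast
  then have 2: "variable (\<iota> (z t) * e t) - single 0 (z t) * variable (e t) \<in> I" by (rule I_linear)
  have 3: "variable ?w - (\<Sum>t\<in>F. single 0 (z t) * variable (e t)) \<in> I" using insert by blast
  show ?case using I_add[OF I_add[OF 1 2] 3] insert(1,2) by (simp add: algebra_simps)
qed

text \<open>An arbitrary choice of one monomial for each exponent; these serve as normal forms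
  modulo I.\<close>

definition normal :: "'t \<Rightarrow> ('b \<Rightarrow>\<^sub>0 nat) \<Rightarrow>\<^sub>0 complex" where
  "normal t = word (SOME l. set l \<subseteq> atoms \<and> sum_list l = t)"

lemma normal_word:
  assumes "t \<in> S"
  obtains l where "normal t = word l" "set l \<subseteq> atoms" "sum_list l = t"
  using someI_ex[OF generated[OF assms]] that unfolding normal_def by blast

definition comb :: "('t \<Rightarrow>\<^sub>0 complex) \<Rightarrow> ('b \<Rightarrow>\<^sub>0 nat) \<Rightarrow>\<^sub>0 complex" where
  "comb z = (\<Sum>t\<in>keys z. single 0 (lookup z t) * normal t)"

lemma comb_add: "comb (y + z) = comb y + comb z"
  unfolding comb_def
  by (rule setsum_keys_plus_distrib[where f = "\<lambda>t c. single 0 c * normal t"])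
    (simp_all add: single_add distrib_right)

lemma comb_single: "comb (single t c) = single 0 c * normal t"
  by (simp add: comb_def)

lemma eval_normal: "t \<in> S \<Longrightarrow> eval_alg \<iota> (normal t) = e t"
  by (metis eval_word normal_word)

lemma normal_mem: "t \<in> S \<Longrightarrow> normal t \<in> R"
  by (metis word_mem normal_word)

definition reducible :: "(('b \<Rightarrow>\<^sub>0 nat) \<Rightarrow>\<^sub>0 complex) \<Rightarrow> bool" where
  "reducible f \<longleftrightarrow> (\<exists>z. keys z \<subseteq> S \<and> f - comb z \<in> I)"

lemma reducible_add: "reducible f \<Longrightarrow> reducible g \<Longrightarrow> reducible (f + g)"
proof -
  assume "reducible f" "reducible g"
  then obtain y z where "keys y \<subseteq> S" "f - comb y \<in> I" "keys z \<subseteq> S" "g - comb z \<in> I"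
    by (auto simp: reducible_def)
  then have "keys (y + z) \<subseteq> S" "f + g - comb (y + z) \<in> I"
    using keys_add[of y z] I_add[of "f - comb y" "g - comb z"] by (auto simp: comb_add algebra_simps)
  then show ?thesis by (auto simp: reducible_def)
qed

lemma reducible_0: "reducible 0"
  unfolding reducible_def by (rule exI[of _ 0]) (simp add: comb_def ideal_in_0)

lemma reducible_sum: "(\<And>i. i \<in> F \<Longrightarrow> reducible (f i)) \<Longrightarrow> reducible (sum f F)"
  by (induction F rule: infinite_finite_induct) (auto simp: reducible_0 reducible_add)

lemma reducible_cong: "f - g \<in> I \<Longrightarrow> reducible g \<Longrightarrow> reducible f"
proof -
  assume fg: "f - g \<in> I" and "reducible g"
  then obtain z where z: "keys z \<subseteq> S" "g - comb z \<in> I" by (auto simp: reducible_def)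
  have "f - comb z \<in> I" using I_add[OF fg z(2)] by simp
  then show ?thesis using z(1) by (auto simp: reducible_def)
qed

lemma reducible_normal: "t \<in> S \<Longrightarrow> reducible (single 0 c * normal t)"
  unfolding reducible_def by (rule exI[of _ "single t c"]) (simp add: comb_single ideal_in_0)

text \<open>Modulo I every polynomial is a combination of normal words, one per exponent. Evaluation
  sends these to the independent elements e t, so for a polynomial in the kernel the combination is
  zero.\<close>

theorem quadratic:
  assumes words: "\<And>l l'. set l \<subseteq> atoms \<Longrightarrow> set l' \<subseteq> atoms \<Longrightarrow> sum_list l = sum_list l' \<Longrightarrow> word l - word l' \<in> I"
  shows "quadratic_algebra \<iota> A"
proof -
  have red: "reducible f" if "f \<in> R" for f
    using that
  proof (induction rule: free_alg_induct)
    case (const c)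
    obtain l where l: "normal 0 = word l" "set l \<subseteq> atoms" "sum_list l = 0" using normal_word[OF S_0] .
    have "word [] - word l \<in> I" using words[of "[]" l] l by simp
    then have "single 0 c * (1 - normal 0) \<in> I" using I_mult[OF const_mem] l(1) by (simp add: word_def)
    then have "single 0 c - single 0 c * normal 0 \<in> I" by (simp add: algebra_simps)
    then show ?case using reducible_cong reducible_normal[OF S_0] by blast
  next
    case (add f g)
    then show ?case by (rule reducible_add)
  next
    case (mult f w)
    obtain z where z: "keys z \<subseteq> S" "f - comb z \<in> I" using mult.IH by (auto simp: reducible_def)
    obtain F u where F: "finite F" "F \<subseteq> atoms" and w: "w = (\<Sum>t\<in>F. \<iota> (u t) * e t)"
      using mult.hyps(2) unfolding spanning by auto
    let ?u = "\<Sum>b\<in>F. single 0 (u b) * variable (e b)"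
    have combR: "comb z \<in> R" unfolding comb_def using z(1) normal_mem const_mem
      by (auto intro!: free_alg_sum free_alg_mult)
    \<comment> \<open>The variable is replaced by its expansion in basis variables and f by its
      normal form, both at once.\<close>
    have "variable w * (f - comb z) + comb z * (variable w - ?u) \<in> I"
      using variable_linear_comb[OF F, of u] z(2) combR free_alg_variable[OF mult.hyps(2)]
      unfolding w[symmetric] by (intro I_add I_mult)
    then have 1: "variable w * f - ?u * comb z \<in> I" by (simp add: algebra_simps)
    have "reducible (?u * comb z)"
      unfolding comb_def sum_product
    proof (intro reducible_sum)
      fix b t assume b: "b \<in> F" and t: "t \<in> keys z"
      let ?c = "lookup z t"
      have bS: "b \<in> atoms" and tS: "t \<in> S" using b t F z by auto
      then have btS: "b + t \<in> S" using S_add by blast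
      obtain l where l: "normal t = word l" "set l \<subseteq> atoms" "sum_list l = t" using normal_word[OF tS] .
      obtain l' where l': "normal (b + t) = word l'" "set l' \<subseteq> atoms" "sum_list l' = b + t" using normal_word[OF btS] .
      \<comment> \<open>A basis variable times a normal word is again a word, which
        \<open>words\<close> allows to be exchanged for the normal word of b + t.\<close>
      have "word (b # l) - word l' \<in> I" using l l' bS by (intro words) auto
      then have "single 0 (u b * ?c) * (variable (e b) * normal t - normal (b + t)) \<in> I"
        using I_mult[OF const_mem] l(1) l'(1) by (simp add: word_def)
      moreover have "(single 0 (u b * ?c) :: ('b \<Rightarrow>\<^sub>0 nat) \<Rightarrow>\<^sub>0 complex) =
          single 0 (u b) * single 0 ?c"
        by (simp add: mult_single)
      then have "single 0 (u b) * variable (e b) * (single 0 ?c * normal t) -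
          single 0 (u b * ?c) * normal (b + t) =
          single 0 (u b * ?c) * (variable (e b) * normal t - normal (b + t))"
        by (simp only:) (simp add: algebra_simps)
      ultimately have "single 0 (u b) * variable (e b) * (single 0 ?c * normal t) -
          single 0 (u b * ?c) * normal (b + t) \<in> I"
        by (simp only:)
      then show "reducible (single 0 (u b) * variable (e b) * (single 0 ?c * normal t))"
        using reducible_cong reducible_normal[OF btS] by blast
    qed
    then show ?case using reducible_cong[OF 1] by blast
  qed
  have eval_comb: "eval_alg \<iota> (comb z) = (\<Sum>t\<in>keys z. \<iota> (lookup z t) * e t)"
    if "keys z \<subseteq> S" for z
    unfolding comb_def eval_alg_sum using that eval_normal
    by (intro sum.cong) (auto simp: eval_alg_mult eval_alg_const)
  have "f \<in> I" if f: "f \<in> R" "eval_alg \<iota> f = 0" for f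
  proof -
    obtain z where z: "keys z \<subseteq> S" "f - comb z \<in> I" using red[OF f(1)] by (auto simp: reducible_def)
    have "eval_alg \<iota> (f - comb z) = 0" using z(2) I_subset by blast
    then have "(\<Sum>t\<in>keys z. \<iota> (lookup z t) * e t) = 0"
      using f(2) eval_comb[OF z(1)] by (simp add: eval_alg_diff)
    then have "lookup z t = 0" if "t \<in> keys z" for t
      using independent[OF _ z(1) _ that, of "lookup z"] by simp
    then have "keys z = {}" by (meson in_keys_iff equals0I)
    then have "comb z = 0" by (simp only: comb_def sum.empty)
    then show ?thesis using z(2) by simp
  qed
  then have kernel: "{f \<in> R. eval_alg \<iota> f = 0} = I" using I_subset by blast
  have "A m \<subseteq> eval_alg \<iota> ` R" for m
  proof
    fix a assume "a \<in> A m"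
    then obtain F z where F: "finite F" "F \<subseteq> S" and a: "a = (\<Sum>t\<in>F. \<iota> (z t) * e t)"
      unfolding spanning by auto
    have "eval_alg \<iota> (\<Sum>t\<in>F. single 0 (z t) * normal t) = a"
      unfolding a eval_alg_sum using F(2) eval_normal by (intro sum.cong) (auto simp: eval_alg_mult eval_alg_const)
    moreover have "(\<Sum>t\<in>F. single 0 (z t) * normal t) \<in> R"
      using F(2) normal_mem const_mem by (auto intro!: free_alg_sum free_alg_mult)
    ultimately show "a \<in> eval_alg \<iota> ` R" by blast
  qed
  then show ?thesis unfolding quadratic_algebra_def using graded kernel by blast
qed

end

end

section \<open>The ring of sections\<close>

lemma lookup_mult_single:
  fixes f :: "'k::ab_group_add \<Rightarrow>\<^sub>0 'v::comm_semiring_1"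
  shows "lookup (f * single b c) t = lookup f (t - b) * c"
proof (induction f rule: poly_mapping_add_induct)
  case (single a d)
  have "t = a + b \<longleftrightarrow> t - b = a" by (auto simp: algebra_simps)
  then show ?case by (auto simp: mult_single lookup_single when_def algebra_simps)
qed (simp_all add: lookup_add distrib_right)

lemma lookup_const_mult:
  fixes f :: "'k::comm_monoid_add \<Rightarrow>\<^sub>0 'v::comm_semiring_1"
  shows "lookup (single 0 c * f) t = c * lookup f t"
  by (induction f rule: poly_mapping_add_induct)
    (simp_all add: mult_single lookup_single when_def lookup_add distrib_left)

lemma prod_single:
  fixes c :: "'i \<Rightarrow> 'v::comm_semiring_1" and b :: "'i \<Rightarrow> 'k::comm_monoid_add"
  shows "(\<Prod>i\<in>F. single (b i) (c i)) = single (\<Sum>i\<in>F. b i) (\<Prod>i\<in>F. c i)"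
  by (induction F rule: infinite_finite_induct) (simp_all add: mult_single)

lemma single_power_scaleR:
  fixes b :: "'k::real_vector" and c :: "'v::comm_semiring_1"
  shows "single b c ^ n = single (real n *\<^sub>R b) (c ^ n)"
  by (induction n) (simp_all add: mult_single algebra_simps)

lemma single_power_nat:
  fixes c :: "'v::comm_semiring_1"
  shows "single (single j (1::nat)) c ^ n = single (single j n) (c ^ n)"
  by (induction n) (simp_all add: mult_single flip: single_add)

lemma monom_degree_eq_0: "monom_degree a = 0 \<Longrightarrow> a = 0"
  by (auto simp: monom_degree_def in_keys_iff intro!: poly_mapping_eqI)

lemma monom_degree_1:
  assumes "monom_degree a = 1"
  obtains j where "a = single j 1"
proof -
  have "keys a \<noteq> {}" using assms unfolding monom_degree_def by fastforce
  then obtain j where j: "j \<in> keys a" by blast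
  obtain b where a: "a = single j 1 + b" using nat_monom_split[OF j] .
  have "monom_degree b = 0" using assms unfolding a monom_degree_add by simp
  then have "b = 0" by (rule monom_degree_eq_0)
  then show ?thesis using a that by simp
qed

locale special_bundles = reduced_roots +
  fixes L :: "nat \<Rightarrow> 'a line_bundle_data" and k :: nat
  assumes bundles: "\<And>i. i < k \<Longrightarrow> special_ample_line_bundle \<Delta> (L i)"
begin

abbreviation sum_bundle :: "'a vector_bundle_data" where
  "sum_bundle \<equiv> direct_sum_line_bundles k L"

lemma special_weights: "i < k \<Longrightarrow> special_vertices \<Delta> (weight (L i))"
  using bundles[of i]
  by (auto simp: special_ample_line_bundle_def special_polytope_def ample_polytope_def special_vertices_def)

abbreviation const :: "complex \<Rightarrow> 'a sym_section" where
  "const \<equiv> constant_section \<Delta>"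

abbreviation H0 :: "nat \<Rightarrow> 'a sym_section set" where
  "H0 \<equiv> H0_Sym \<Delta> sum_bundle"

section \<open>Transition functions of products of the bundles\<close>

definition transition :: "nat \<Rightarrow> 'a set \<Rightarrow> 'a set \<Rightarrow> 'a \<Rightarrow>\<^sub>0 complex" where
  "transition j \<sigma> \<sigma>' = trans (L j) \<sigma> \<sigma>' 0 0"

lemma transition_facts:
  assumes "j < k" "\<sigma> \<in> chambers \<Delta>" "\<sigma>' \<in> chambers \<Delta>"
  shows "transition j \<sigma> \<sigma> = 1"
    and "\<sigma>'' \<in> chambers \<Delta> \<Longrightarrow> transition j \<sigma> \<sigma>' * transition j \<sigma>' \<sigma>'' = transition j \<sigma> \<sigma>''"
    and "\<exists>c. transition j \<sigma> \<sigma>' = single (weight (L j) \<sigma> - weight (L j) \<sigma>') c"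
proof -
  have v: "vector_bundle \<Delta> (L j)" "rank (L j) = 1"
    and e: "\<exists>c. trans (L j) \<sigma> \<sigma>' 0 0 = single (weight (L j) \<sigma> - weight (L j) \<sigma>') c"
    using bundles[OF assms(1)] assms(2,3)
    by (auto simp: special_ample_line_bundle_def equivariant_line_bundle_def)
  show "transition j \<sigma> \<sigma> = 1"
    using v assms(2) by (simp add: vector_bundle_def transition_def)
  show "transition j \<sigma> \<sigma>' * transition j \<sigma>' \<sigma>'' = transition j \<sigma> \<sigma>''" if "\<sigma>'' \<in> chambers \<Delta>"
    using v assms(2,3) that by (simp add: vector_bundle_def transition_def)
  show "\<exists>c. transition j \<sigma> \<sigma>' = single (weight (L j) \<sigma> - weight (L j) \<sigma>') c"
    using e by (simp add: transition_def)
qed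

text \<open>\<open>wt a\<close> and \<open>gp a\<close> are the vertices and the transition function
  of the line bundle spanned by the frame monomial with exponent a, the tensor product of the powers
  of the given bundles.\<close>

definition wt :: "(nat \<Rightarrow>\<^sub>0 nat) \<Rightarrow> 'a set \<Rightarrow> 'a" where
  "wt a \<sigma> = (\<Sum>j\<in>keys a. real (lookup a j) *\<^sub>R weight (L j) \<sigma>)"

definition gp :: "(nat \<Rightarrow>\<^sub>0 nat) \<Rightarrow> 'a set \<Rightarrow> 'a set \<Rightarrow> 'a \<Rightarrow>\<^sub>0 complex" where
  "gp a \<sigma> \<sigma>' = (\<Prod>j\<in>keys a. transition j \<sigma> \<sigma>' ^ lookup a j)"

lemma wt_add: "wt (a + b) \<sigma> = wt a \<sigma> + wt b \<sigma>"
  unfolding wt_def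
  by (rule setsum_keys_plus_distrib[where f = "\<lambda>j n. real n *\<^sub>R weight (L j) \<sigma>"])
    (simp_all add: scaleR_add_left)

lemma wt_0: "wt 0 \<sigma> = 0"
  by (simp add: wt_def)

lemma wt_single: "wt (single j 1) \<sigma> = weight (L j) \<sigma>"
  by (simp add: wt_def)

lemma gp_add: "gp (a + b) \<sigma> \<sigma>' = gp a \<sigma> \<sigma>' * gp b \<sigma> \<sigma>'"
  unfolding gp_def by (rule monomial_value_add)

lemma gp_0: "gp 0 \<sigma> \<sigma>' = 1"
  by (simp add: gp_def)

lemma gp_refl: "keys a \<subseteq> {..<k} \<Longrightarrow> \<sigma> \<in> chambers \<Delta> \<Longrightarrow> gp a \<sigma> \<sigma> = 1"
  unfolding gp_def using transition_facts(1) by (intro prod.neutral) (auto simp: subset_iff)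

lemma gp_cocycle:
  assumes "keys a \<subseteq> {..<k}" "\<sigma> \<in> chambers \<Delta>" "\<sigma>' \<in> chambers \<Delta>" "\<sigma>'' \<in> chambers \<Delta>"
  shows "gp a \<sigma> \<sigma>' * gp a \<sigma>' \<sigma>'' = gp a \<sigma> \<sigma>''"
  unfolding gp_def prod.distrib[symmetric] power_mult_distrib[symmetric]
  using assms transition_facts(2) by (intro prod.cong) (auto simp: subset_iff)

lemma gp_single:
  assumes "keys a \<subseteq> {..<k}" "\<sigma> \<in> chambers \<Delta>" "\<sigma>' \<in> chambers \<Delta>"
  obtains c where "gp a \<sigma> \<sigma>' = single (wt a \<sigma> - wt a \<sigma>') c" "c \<noteq> 0"
proof -
  have "\<forall>j\<in>keys a. \<exists>c. transition j \<sigma> \<sigma>' = single (weight (L j) \<sigma> - weight (L j) \<sigma>') c"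
    using assms transition_facts(3) by (auto simp: subset_iff)
  then obtain c where c: "\<And>j. j \<in> keys a \<Longrightarrow>
      transition j \<sigma> \<sigma>' = single (weight (L j) \<sigma> - weight (L j) \<sigma>') (c j)"
    by metis
  have "gp a \<sigma> \<sigma>' = (\<Prod>j\<in>keys a. single
      (real (lookup a j) *\<^sub>R (weight (L j) \<sigma> - weight (L j) \<sigma>')) (c j ^ lookup a j))"
    unfolding gp_def by (intro prod.cong) (simp_all add: c single_power_scaleR)
  also have "\<dots> = single (wt a \<sigma> - wt a \<sigma>') (\<Prod>j\<in>keys a. c j ^ lookup a j)"
    unfolding prod_single by (simp add: wt_def scaleR_diff_right sum_subtractf)
  finally have eq: "gp a \<sigma> \<sigma>' = single (wt a \<sigma> - wt a \<sigma>') (\<Prod>j\<in>keys a. c j ^ lookup a j)" .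
  \<comment> \<open>A transition function is invertible: passing to the other chart and back gives
    1.\<close>
  moreover have "gp a \<sigma> \<sigma>' \<noteq> 0"
    using gp_cocycle[OF assms(1-3,2)] gp_refl[OF assms(1,2)] by auto
  ultimately show ?thesis using that by force
qed

lemma prod_transition:
  assumes "keys a \<subseteq> {..<k}"
  shows "(\<Prod>j\<in>keys a.
           (\<Sum>i<k. single (single i 1) (trans sum_bundle \<sigma> \<sigma>' i j)) ^ lookup a j) =
    single a (gp a \<sigma> \<sigma>')"
proof -
  have 1: "(\<Sum>i<k. single (single i 1) (trans sum_bundle \<sigma> \<sigma>' i j)) =
      single (single j 1) (transition j \<sigma> \<sigma>')" if "j \<in> keys a" for j
  proof -
    have "(\<Sum>i<k. single (single i 1) (trans sum_bundle \<sigma> \<sigma>' i j)) =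
      (\<Sum>i<k. if i = j then single (single j 1) (transition j \<sigma> \<sigma>') else 0)"
      by (intro sum.cong) (auto simp: direct_sum_line_bundles_def transition_def)
    also have "\<dots> = single (single j 1) (transition j \<sigma> \<sigma>')"
      using that assms by (auto simp: subset_iff)
    finally show ?thesis .
  qed
  have "(\<Prod>j\<in>keys a.
      (\<Sum>i<k. single (single i 1) (trans sum_bundle \<sigma> \<sigma>' i j)) ^ lookup a j) =
    (\<Prod>j\<in>keys a. single (single j (lookup a j))
      (transition j \<sigma> \<sigma>' ^ lookup a j))"
    by (intro prod.cong refl) (simp only: 1 single_power_nat)
  also have "\<dots> = single a (gp a \<sigma> \<sigma>')"
    unfolding prod_single poly_mapping_sum_singles gp_def ..
  finally show ?thesis .
qed

lemma sym_map_sum_bundle: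
  assumes "\<And>a. a \<in> keys f \<Longrightarrow> keys a \<subseteq> {..<k}"
  shows "sym_map k (trans sum_bundle \<sigma> \<sigma>') f =
    (\<Sum>a\<in>keys f. single a (lookup f a * gp a \<sigma> \<sigma>'))"
  unfolding sym_map_def using assms
  by (intro sum.cong refl) (simp only: prod_transition mult_single add_0)

lemma lookup_sym_map_sum_bundle:
  assumes "\<And>a. a \<in> keys f \<Longrightarrow> keys a \<subseteq> {..<k}"
  shows "lookup (sym_map k (trans sum_bundle \<sigma> \<sigma>') f) a = lookup f a * gp a \<sigma> \<sigma>'"
  by (subst sym_map_sum_bundle[OF assms], assumption, subst lookup_sum_singles) (simp_all add: in_keys_iff)

lemma rank_bundle: "rank sum_bundle = k"
  by (simp add: direct_sum_line_bundles_def)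

lemma sym_free_module_keys:
  "f \<in> sym_free_module R k m \<Longrightarrow> a \<in> keys f \<Longrightarrow> keys a \<subseteq> {..<k}"
  by (auto simp: sym_free_module_def)

text \<open>The transition matrices are diagonal, so each frame monomial goes to a multiple of
  itself and sections glue monomial by monomial.\<close>

lemma H0_Sym_iff:
  "s \<in> H0 m \<longleftrightarrow>
    (\<forall>\<sigma>\<in>chambers \<Delta>. s \<sigma> \<in> sym_free_module (chart_ring \<Delta> \<sigma>) k m) \<and>
    (\<forall>\<sigma>\<in>chambers \<Delta>. \<forall>\<sigma>'\<in>chambers \<Delta>. \<forall>a.
       lookup (s \<sigma>) a = lookup (s \<sigma>') a * gp a \<sigma> \<sigma>') \<and>
    (\<forall>\<sigma>. \<sigma> \<notin> chambers \<Delta> \<longrightarrow> s \<sigma> = 0)"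
proof -
  have "s \<sigma> = sym_map k (trans sum_bundle \<sigma> \<sigma>') (s \<sigma>') \<longleftrightarrow>
      (\<forall>a. lookup (s \<sigma>) a = lookup (s \<sigma>') a * gp a \<sigma> \<sigma>')"
    if "s \<sigma>' \<in> sym_free_module (chart_ring \<Delta> \<sigma>') k m" for \<sigma> \<sigma>'
    using lookup_sym_map_sum_bundle[OF sym_free_module_keys[OF that], where \<sigma> = \<sigma> and \<sigma>' = \<sigma>']
    by (metis poly_mapping_eqI)
  then show ?thesis unfolding H0_Sym_def rank_bundle by blast
qed

section \<open>Linear structure of the spaces of sections\<close>

lemma chart_ring_add: "f \<in> chart_ring \<Delta> \<sigma> \<Longrightarrow> g \<in> chart_ring \<Delta> \<sigma> \<Longrightarrow> f + g \<in> chart_ring \<Delta> \<sigma>"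
  unfolding chart_ring_def using keys_add[of f g] by blast

lemma chart_ring_0: "0 \<in> chart_ring \<Delta> \<sigma>"
  by (simp add: chart_ring_def)

lemma chart_ring_scale: "f \<in> chart_ring \<Delta> \<sigma> \<Longrightarrow> single 0 z * f \<in> chart_ring \<Delta> \<sigma>"
  unfolding chart_ring_def by (auto simp: in_keys_iff lookup_const_mult)

lemma sym_free_module_lookup:
  assumes "f \<in> sym_free_module (chart_ring \<Delta> \<sigma>) k m"
  shows "lookup f a \<in> chart_ring \<Delta> \<sigma>"
  using assms chart_ring_0 by (cases "a \<in> keys f") (auto simp: sym_free_module_def in_keys_iff)

lemma sym_free_module_iff:
  "f \<in> sym_free_module (chart_ring \<Delta> \<sigma>) k m \<longleftrightarrow> (\<forall>a. lookup f a \<in> chart_ring \<Delta> \<sigma> \<and>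
     (lookup f a \<noteq> 0 \<longrightarrow> keys a \<subseteq> {..<k} \<and> monom_degree a = m))"
  using sym_free_module_lookup by (auto simp: sym_free_module_def in_keys_iff)

lemma sym_free_module_add:
  assumes "f \<in> sym_free_module (chart_ring \<Delta> \<sigma>) k m" "g \<in> sym_free_module (chart_ring \<Delta> \<sigma>) k m"
  shows "f + g \<in> sym_free_module (chart_ring \<Delta> \<sigma>) k m"
  unfolding sym_free_module_iff
proof (intro allI conjI impI)
  fix a
  show "lookup (f + g) a \<in> chart_ring \<Delta> \<sigma>"
    unfolding lookup_add by (intro chart_ring_add sym_free_module_lookup[OF assms(1)] sym_free_module_lookup[OF assms(2)])
  assume "lookup (f + g) a \<noteq> 0"
  then have "lookup f a \<noteq> 0 \<or> lookup g a \<noteq> 0" by (auto simp: lookup_add)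
  then show "keys a \<subseteq> {..<k}" "monom_degree a = m"
    using assms unfolding sym_free_module_iff by blast+
qed

lemma sym_free_module_scale:
  assumes "f \<in> sym_free_module (chart_ring \<Delta> \<sigma>) k m"
  shows "single 0 (single 0 z) * f \<in> sym_free_module (chart_ring \<Delta> \<sigma>) k m"
  unfolding sym_free_module_iff
proof (intro allI conjI impI)
  fix a
  show "lookup (single 0 (single 0 z) * f) a \<in> chart_ring \<Delta> \<sigma>"
    unfolding lookup_const_mult by (intro chart_ring_scale sym_free_module_lookup[OF assms])
  assume "lookup (single 0 (single 0 z) * f) a \<noteq> 0"
  then have "lookup f a \<noteq> 0" by (auto simp: lookup_const_mult)
  then show "keys a \<subseteq> {..<k}" "monom_degree a = m"
    using assms unfolding sym_free_module_iff by blast+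
qed

lemma H0_Sym_add:
  assumes "s \<in> H0 m" "t \<in> H0 m"
  shows "s + t \<in> H0 m"
  unfolding H0_Sym_iff
proof (intro conjI ballI allI impI)
  fix \<sigma> \<sigma>' a
  show "(s + t) \<sigma> \<in> sym_free_module (chart_ring \<Delta> \<sigma>) k m" if "\<sigma> \<in> chambers \<Delta>"
    using assms that unfolding H0_Sym_iff by (auto intro: sym_free_module_add)
  show "lookup ((s + t) \<sigma>) a = lookup ((s + t) \<sigma>') a * gp a \<sigma> \<sigma>'"
    if "\<sigma> \<in> chambers \<Delta>" "\<sigma>' \<in> chambers \<Delta>"
  proof -
    have "lookup (s \<sigma>) a = lookup (s \<sigma>') a * gp a \<sigma> \<sigma>'"
      "lookup (t \<sigma>) a = lookup (t \<sigma>') a * gp a \<sigma> \<sigma>'"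
      using assms that unfolding H0_Sym_iff by blast+
    then show ?thesis by (simp add: lookup_add distrib_right)
  qed
  show "(s + t) \<sigma> = 0" if "\<sigma> \<notin> chambers \<Delta>"
    using assms that unfolding H0_Sym_iff by simp
qed

lemma H0_Sym_scale:
  assumes "s \<in> H0 m"
  shows "const z * s \<in> H0 m"
  unfolding H0_Sym_iff
proof (intro conjI ballI allI impI)
  fix \<sigma> \<sigma>' a
  show "(const z * s) \<sigma> \<in> sym_free_module (chart_ring \<Delta> \<sigma>) k m" if "\<sigma> \<in> chambers \<Delta>"
    using assms that unfolding H0_Sym_iff by (auto simp: constant_section_def intro: sym_free_module_scale)
  show "lookup ((const z * s) \<sigma>) a =
      lookup ((const z * s) \<sigma>') a * gp a \<sigma> \<sigma>'"
    if "\<sigma> \<in> chambers \<Delta>" "\<sigma>' \<in> chambers \<Delta>"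
  proof -
    have "lookup (s \<sigma>) a = lookup (s \<sigma>') a * gp a \<sigma> \<sigma>'"
      using assms that unfolding H0_Sym_iff by blast
    then show ?thesis using that by (simp add: constant_section_def lookup_const_mult mult.assoc)
  qed
  show "(const z * s) \<sigma> = 0" if "\<sigma> \<notin> chambers \<Delta>"
    using that by (simp add: constant_section_def)
qed

lemma H0_Sym_0: "0 \<in> H0 m"
  unfolding H0_Sym_iff by (simp add: sym_free_module_def)

lemma H0_Sym_sum: "(\<And>i. i \<in> F \<Longrightarrow> f i \<in> H0 m) \<Longrightarrow> sum f F \<in> H0 m"
  by (induction F rule: infinite_finite_induct) (auto simp: H0_Sym_0 H0_Sym_add)

text \<open>One fixed chart in which all sections are compared; a section is determined by its
  restriction to it.\<close>

definition ref_chamber :: "'a set" where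
  "ref_chamber = (SOME \<sigma>. \<sigma> \<in> chambers \<Delta>)"

lemma ref_chamber: "ref_chamber \<in> chambers \<Delta>"
proof -
  obtain c where "regular c" using exists_regular by blast
  then have "chamber c \<in> chambers \<Delta>" by (simp add: chambers_eq)
  then show ?thesis unfolding ref_chamber_def by (rule someI)
qed

text \<open>The semigroup of the section ring: a frame monomial together with a torus weight
  occurring in its line bundle.\<close>

definition exponents :: "((nat \<Rightarrow>\<^sub>0 nat) \<times> 'a) set" where
  "exponents = {(a, x). keys a \<subseteq> {..<k} \<and> x \<in> weights (wt a)}"

text \<open>The torus eigensection of weight \<open>snd t\<close>, normalised to have coefficient 1
  over the reference chart. This normalisation makes products of basis sections basis sections
  again.\<close>

definition basis_section :: "(nat \<Rightarrow>\<^sub>0 nat) \<times> 'a \<Rightarrow> 'a sym_section" where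
  "basis_section t = (\<lambda>\<sigma>. if \<sigma> \<in> chambers \<Delta> then
     single (fst t) (single (wt (fst t) ref_chamber - snd t) 1 * gp (fst t) \<sigma> ref_chamber)
   else 0)"

lemma basis_section_add: "basis_section (s + t) = basis_section s * basis_section t"
proof
  fix \<sigma>
  show "basis_section (s + t) \<sigma> = (basis_section s * basis_section t) \<sigma>"
    by (simp add: basis_section_def mult_single gp_add wt_add algebra_simps flip: mult.assoc)
qed

lemma basis_section_0: "basis_section 0 = const 1"
  by (auto simp: basis_section_def constant_section_def gp_0 wt_0)

text \<open>Completeness of the fan: x lies in some chamber, and -x in its dual cone gives x
  \<bullet> x \<le> 0.\<close>

lemma section_weights_0: "weights (\<lambda>_. 0) = {0}"
proof -
  have "x = 0" if x: "x \<in> weights (\<lambda>_. 0)" for x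
  proof -
    obtain c where c: "regular c" "\<forall>\<alpha>\<in>pos c. 0 \<le> \<alpha> \<bullet> x" using exists_dominating_chamber by blast
    then have "x \<in> chamber c" by (simp add: chamber_def)
    moreover have "0 - x \<in> dual_cone (chamber c)" using x c(1) by (auto simp: section_weights_iff below_def)
    ultimately have "0 \<le> (0 - x) \<bullet> x" unfolding dual_cone_def by blast
    then have "x \<bullet> x \<le> 0" by (simp add: inner_diff_left)
    then show ?thesis by (metis inner_gt_zero_iff not_less)
  qed
  moreover have "0 \<in> weights (\<lambda>_. 0)"
    by (simp add: section_weights_def dual_cone_def root_lattice_0)
  ultimately show ?thesis by blast
qed

lemma wt_zero_fun: "wt 0 = (\<lambda>_. 0)"
  by (simp add: fun_eq_iff wt_0)

lemma exponents_keys: "t \<in> exponents \<Longrightarrow> keys (fst t) \<subseteq> {..<k}"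
  by (auto simp: exponents_def)

lemma exponents_0: "0 \<in> exponents"
  by (simp add: exponents_def zero_prod_def wt_zero_fun section_weights_0)

lemma exponents_deg_0: "t \<in> exponents \<Longrightarrow> monom_degree (fst t) = 0 \<Longrightarrow> t = 0"
  using section_weights_0 by (auto simp: exponents_def zero_prod_def wt_zero_fun dest!: monom_degree_eq_0)

lemma section_weights_add:
  assumes "x \<in> weights \<mu>" "y \<in> weights \<nu>"
  shows "x + y \<in> weights (\<lambda>\<sigma>. \<mu> \<sigma> + \<nu> \<sigma>)"
proof -
  have "\<mu> \<sigma> + \<nu> \<sigma> - (x + y) \<in> dual_cone \<sigma> \<inter> root_lattice \<Delta>" if s: "\<sigma> \<in> chambers \<Delta>" for \<sigma>
  proof -
    have eq: "\<mu> \<sigma> + \<nu> \<sigma> - (x + y) = (\<mu> \<sigma> - x) + (\<nu> \<sigma> - y)" by simp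
    have "\<mu> \<sigma> - x \<in> dual_cone \<sigma> \<inter> root_lattice \<Delta>" "\<nu> \<sigma> - y \<in> dual_cone \<sigma> \<inter> root_lattice \<Delta>"
      using assms s by (auto simp: section_weights_def)
    then show ?thesis unfolding eq
      by (auto simp: dual_cone_def inner_add_left root_lattice_add simp del: add_diff_eq)
  qed
  then show ?thesis by (simp add: section_weights_def)
qed

lemma exponents_add:
  assumes "s \<in> exponents" "t \<in> exponents"
  shows "s + t \<in> exponents"
proof -
  have "wt (fst s + fst t) = (\<lambda>\<sigma>. wt (fst s) \<sigma> + wt (fst t) \<sigma>)" by (simp add: fun_eq_iff wt_add)
  then have "snd s + snd t \<in> weights (wt (fst s + fst t))"
    using assms section_weights_add[of "snd s" "wt (fst s)" "snd t" "wt (fst t)"] by (auto simp: exponents_def)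
  then show ?thesis using exponents_keys[OF assms(1)] exponents_keys[OF assms(2)]
    by (simp add: exponents_def nat_keys_add case_prod_beta)
qed

lemma lookup_basis_section:
  "\<sigma> \<in> chambers \<Delta> \<Longrightarrow> lookup (basis_section t \<sigma>) a =
    (if a = fst t then single (wt a ref_chamber - snd t) 1 * gp a \<sigma> ref_chamber else 0)"
  by (auto simp: basis_section_def lookup_single when_def)

lemma basis_section_mem:
  assumes t: "t \<in> exponents"
  shows "basis_section t \<in> H0 (monom_degree (fst t))"
  unfolding H0_Sym_iff
proof (intro conjI ballI allI impI)
  have k: "keys (fst t) \<subseteq> {..<k}" and x: "snd t \<in> weights (wt (fst t))"
    using t by (auto simp: exponents_def)
  fix \<sigma> \<sigma>' a
  show "basis_section t \<sigma> \<in> sym_free_module (chart_ring \<Delta> \<sigma>) k (monom_degree (fst t))" if s: "\<sigma> \<in> chambers \<Delta>"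
  proof -
    obtain c where c: "gp (fst t) \<sigma> ref_chamber = single (wt (fst t) \<sigma> - wt (fst t) ref_chamber) c"
      using gp_single[OF k s ref_chamber] by blast
    have "single (wt (fst t) ref_chamber - snd t) 1 * gp (fst t) \<sigma> ref_chamber =
        single (wt (fst t) \<sigma> - snd t) c"
      unfolding c by (simp add: mult_single)
    moreover have "single (wt (fst t) \<sigma> - snd t) c \<in> chart_ring \<Delta> \<sigma>"
      using x s by (auto simp: chart_ring_def section_weights_def)
    ultimately show ?thesis
      using k by (simp add: sym_free_module_iff lookup_basis_section[OF s] chart_ring_0)
  qed
  show "lookup (basis_section t \<sigma>) a = lookup (basis_section t \<sigma>') a * gp a \<sigma> \<sigma>'"
    if s: "\<sigma> \<in> chambers \<Delta>" "\<sigma>' \<in> chambers \<Delta>"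
  proof (cases "a = fst t")
    case True
    have "gp a \<sigma> ref_chamber = gp a \<sigma> \<sigma>' * gp a \<sigma>' ref_chamber"
      using gp_cocycle[OF _ s ref_chamber] k True by simp
    then show ?thesis using True by (simp add: lookup_basis_section s mult.assoc mult.commute[of _ "gp a \<sigma> \<sigma>'"])
  next
    case False
    then show ?thesis by (simp add: lookup_basis_section s)
  qed
  show "basis_section t \<sigma> = 0" if "\<sigma> \<notin> chambers \<Delta>"
    using that by (simp add: basis_section_def)
qed

lemma scaled_basis_section:
  "\<sigma> \<in> chambers \<Delta> \<Longrightarrow> (const z * basis_section t) \<sigma> =
    single (fst t) (single (wt (fst t) ref_chamber - snd t) z * gp (fst t) \<sigma> ref_chamber)"
  by (simp add: constant_section_def basis_section_def mult_single flip: mult.assoc)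

lemma sum_fun_apply: "(\<Sum>i\<in>F. f i) \<sigma> = (\<Sum>i\<in>F. f i \<sigma>)"
  by (induction F rule: infinite_finite_induct) simp_all

text \<open>The coefficients over the reference chart are split into characters; each character,
  transported to the other charts, is itself a regular section.\<close>

lemma H0_Sym_spanning:
  "H0 m =
    {\<Sum>t\<in>F. const (z t) * basis_section t | F z.
       finite F \<and> F \<subseteq> exponents \<and> (\<forall>t\<in>F. monom_degree (fst t) = m)}"
    (is "?H = ?Span")
proof
  show "?Span \<subseteq> ?H"
  proof
    fix s assume "s \<in> ?Span"
    then obtain F z where F: "F \<subseteq> exponents" "\<forall>t\<in>F. monom_degree (fst t) = m"
      and s: "s = (\<Sum>t\<in>F. const (z t) * basis_section t)" by blast
    have "basis_section t \<in> ?H" if "t \<in> F" for t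
      using basis_section_mem[of t] F that by auto
    then show "s \<in> ?H" unfolding s by (intro H0_Sym_sum H0_Sym_scale)
  qed
next
  show "?H \<subseteq> ?Span"
  proof
    fix s assume s: "s \<in> ?H"
    define f where "f = s ref_chamber"
    have sf: "s \<sigma> \<in> sym_free_module (chart_ring \<Delta> \<sigma>) k m" if "\<sigma> \<in> chambers \<Delta>" for \<sigma>
      using s that unfolding H0_Sym_iff by blast
    have glue: "lookup (s \<sigma>) a = lookup f a * gp a \<sigma> ref_chamber" if "\<sigma> \<in> chambers \<Delta>" for \<sigma> a
      using s that ref_chamber unfolding H0_Sym_iff f_def by blast
    define P where "P = (SIGMA a:keys f. keys (lookup f a))"
    \<comment> \<open>Turns the exponent y of a character over the reference chart into the torus
      weight of the section.\<close>
    define \<phi> where "\<phi> = (\<lambda>(a, y). (a, wt a ref_chamber - y))"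
    define z where "z t = lookup (lookup f (fst t)) (wt (fst t) ref_chamber - snd t)" for t
    have fin: "finite P" by (simp add: P_def)
    have inj: "inj_on \<phi> P" by (auto simp: inj_on_def \<phi>_def)
    have ak: "keys a \<subseteq> {..<k}" "monom_degree a = m" if "a \<in> keys f" for a
      using sf[OF ref_chamber] that by (auto simp: f_def sym_free_module_def)
    have "\<phi> ` P \<subseteq> exponents"
    proof
      fix t assume "t \<in> \<phi> ` P"
      then obtain a y where t: "t = (a, wt a ref_chamber - y)" and a: "a \<in> keys f"
        and y: "lookup (lookup f a) y \<noteq> 0"
        by (auto simp: P_def \<phi>_def in_keys_iff)
      have "wt a \<sigma> - (wt a ref_chamber - y) \<in> dual_cone \<sigma> \<inter> root_lattice \<Delta>" if s': "\<sigma> \<in> chambers \<Delta>" for \<sigma>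
      proof -
        obtain c where c: "gp a \<sigma> ref_chamber = single (wt a \<sigma> - wt a ref_chamber) c" "c \<noteq> 0"
          using gp_single[OF ak(1)[OF a] s' ref_chamber] by blast
        \<comment> \<open>The transition function is a single nonzero term, so it shifts exponents
          without cancellation; membership of the coefficient in the chart ring then holds for each
          character separately.\<close>
        have "lookup (lookup (s \<sigma>) a) (wt a \<sigma> - (wt a ref_chamber - y)) \<noteq> 0"
          unfolding glue[OF s'] c(1) lookup_mult_single using y c(2) by simp
        then show ?thesis
          using sym_free_module_lookup[OF sf[OF s'], of a] by (auto simp: chart_ring_def in_keys_iff)
      qed
      then show "t \<in> exponents" using ak(1)[OF a] by (simp add: t exponents_def section_weights_def)
    qed
    moreover have "\<forall>t\<in>\<phi> ` P. monom_degree (fst t) = m" using ak(2) by (auto simp: P_def \<phi>_def)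
    moreover have "s = (\<Sum>t\<in>\<phi> ` P. const (z t) * basis_section t)"
    proof
      fix \<sigma>
      show "s \<sigma> = (\<Sum>t\<in>\<phi> ` P. const (z t) * basis_section t) \<sigma>"
      proof (cases "\<sigma> \<in> chambers \<Delta>")
        case False
        then have "s \<sigma> = 0" using s unfolding H0_Sym_iff by blast
        then show ?thesis using False by (simp add: sum_fun_apply constant_section_def)
      next
        case True
        have "(\<Sum>t\<in>\<phi> ` P. const (z t) * basis_section t) \<sigma> =
          (\<Sum>p\<in>P. (const (z (\<phi> p)) * basis_section (\<phi> p)) \<sigma>)"
          by (simp add: sum_fun_apply sum.reindex[OF inj])
        also have "\<dots> = (\<Sum>(a, y)\<in>P. single a
            (single y (lookup (lookup f a) y) * gp a \<sigma> ref_chamber))"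
        proof (intro sum.cong refl, clarify)
          fix a :: "nat \<Rightarrow>\<^sub>0 nat" and y :: 'a
          show "(const (z (\<phi> (a, y))) * basis_section (\<phi> (a, y))) \<sigma> = single a
              (single y (lookup (lookup f a) y) * gp a \<sigma> ref_chamber)"
            unfolding scaled_basis_section[OF True] by (simp add: \<phi>_def z_def)
        qed
        also have "\<dots> = (\<Sum>a\<in>keys f. \<Sum>y\<in>keys (lookup f a). single a
            (single y (lookup (lookup f a) y) * gp a \<sigma> ref_chamber))"
          unfolding P_def by (rule sum.Sigma[symmetric]) simp_all
        also have "\<dots> = (\<Sum>a\<in>keys f. single a (lookup f a * gp a \<sigma> ref_chamber))"
        proof (intro sum.cong refl)
          fix a :: "nat \<Rightarrow>\<^sub>0 nat"
          have single_sum: "(\<Sum>y\<in>Y. single a (h y)) = single a (\<Sum>y\<in>Y. h y)"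
            for Y and h :: "'a \<Rightarrow> 'a \<Rightarrow>\<^sub>0 complex"
            by (induction Y rule: infinite_finite_induct) (simp_all add: single_add)
          show "(\<Sum>y\<in>keys (lookup f a). single a
              (single y (lookup (lookup f a) y) * gp a \<sigma> ref_chamber)) =
            single a (lookup f a * gp a \<sigma> ref_chamber)"
            unfolding single_sum sum_distrib_right[symmetric] poly_mapping_sum_singles ..
        qed
        also have "\<dots> = s \<sigma>"
          by (intro poly_mapping_eqI, subst lookup_sum_singles) (simp_all add: in_keys_iff glue[OF True])
        finally show ?thesis by simp
      qed
    qed
    ultimately show "s \<in> ?Span" using fin by blast
  qed
qed

text \<open>Over the reference chart the transition factor is 1, and distinct exponents give
  distinct pairs of frame monomial and character.\<close>

lemma basis_section_independent:
  assumes F: "finite F" "F \<subseteq> exponents" and 0: "(\<Sum>t\<in>F. const (z t) * basis_section t) = 0"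
    and t: "t \<in> F"
  shows "z t = 0"
proof -
  define y where "y = wt (fst t) ref_chamber - snd t"
  have "0 = lookup (lookup
      ((\<Sum>t\<in>F. const (z t) * basis_section t) ref_chamber) (fst t)) y"
    by (simp add: 0)
  also have "\<dots> = (\<Sum>u\<in>F. lookup (lookup
      ((const (z u) * basis_section u) ref_chamber) (fst t)) y)"
    by (simp add: sum_fun_apply lookup_sum)
  also have "\<dots> = (\<Sum>u\<in>F. if u = t then z u else 0)"
  proof (intro sum.cong refl)
    fix u assume "u \<in> F"
    then have "gp (fst u) ref_chamber ref_chamber = 1"
      using F(2) by (intro gp_refl ref_chamber exponents_keys) blast
    then show "lookup (lookup
      ((const (z u) * basis_section u) ref_chamber) (fst t)) y = (if u = t then z u else 0)"
      unfolding scaled_basis_section[OF ref_chamber]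
      by (auto simp: lookup_single when_def y_def prod_eq_iff)
  qed
  also have "\<dots> = z t" using F(1) t by simp
  finally show ?thesis by simp
qed

section \<open>The graded algebra of sections\<close>

lemma constant_section_add: "const (z + w) = const z + const w"
  by (auto simp: constant_section_def single_add)

lemma constant_section_mult: "const (z * w) = const z * const w"
  by (auto simp: constant_section_def mult_single)

lemma constant_section_0: "const 0 = 0"
  by (auto simp: constant_section_def)

lemma inj_constant_section: "inj (const)"
proof (rule injI)
  fix z w assume "const z = const w"
  then have "const z ref_chamber = const w ref_chamber" by simp
  then have "lookup (lookup (const z ref_chamber) 0) 0 =
    lookup (lookup (const w ref_chamber) 0) 0" by simp
  then show "z = w" using ref_chamber by (simp add: constant_section_def)
qed

lemma unit_section_mult: "s \<in> H0 m \<Longrightarrow> const 1 * s = s"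
  unfolding H0_Sym_iff by (auto simp: constant_section_def fun_eq_iff)

lemma H0_Sym_degree_0: "H0 0 = range (const)"
proof
  show "range (const) \<subseteq> H0 0"
  proof
    fix s assume "s \<in> range (const)"
    then obtain z where "s = const z" by blast
    then have "s = const z * basis_section 0" by (simp add: basis_section_0 flip: constant_section_mult)
    then show "s \<in> H0 0"
      using H0_Sym_scale[OF basis_section_mem[OF exponents_0]] by simp
  qed
  show "H0 0 \<subseteq> range (const)"
  proof
    fix s assume "s \<in> H0 0"
    then obtain F z where F: "finite F" "F \<subseteq> exponents" "\<forall>t\<in>F. monom_degree (fst t) = 0"
      and s: "s = (\<Sum>t\<in>F. const (z t) * basis_section t)"
      unfolding H0_Sym_spanning by blast
    have "F \<subseteq> {0}" using F exponents_deg_0 by blast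
    then have "F = {} \<or> F = {0}" by blast
    then show "s \<in> range (const)"
      using constant_section_0 by (auto simp: s basis_section_0 range_eqI simp flip: constant_section_mult)
  qed
qed

lemma H0_Sym_mult:
  assumes "s \<in> H0 m" "t \<in> H0 l"
  shows "s * t \<in> H0 (m + l)"
proof -
  obtain F y where F: "F \<subseteq> exponents" "\<forall>t\<in>F. monom_degree (fst t) = m"
    and s: "s = (\<Sum>t\<in>F. const (y t) * basis_section t)"
    using assms(1) unfolding H0_Sym_spanning by blast
  obtain G z where G: "G \<subseteq> exponents" "\<forall>t\<in>G. monom_degree (fst t) = l"
    and t: "t = (\<Sum>t\<in>G. const (z t) * basis_section t)"
    using assms(2) unfolding H0_Sym_spanning by blast
  show ?thesis unfolding s t sum_product
  proof (intro H0_Sym_sum)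
    fix a b assume ab: "a \<in> F" "b \<in> G"
    have "const (y a) * basis_section a * (const (z b) * basis_section b) =
        const (y a * z b) * basis_section (a + b)"
      by (simp add: constant_section_mult basis_section_add algebra_simps)
    moreover have "basis_section (a + b) \<in> H0 (m + l)"
      using basis_section_mem[OF exponents_add, of a b] ab F G by (auto simp: monom_degree_add)
    ultimately show "const (y a) * basis_section a * (const (z b) * basis_section b)
        \<in> H0 (m + l)"
      by (simp add: H0_Sym_scale)
  qed
qed

lemma H0_Sym_direct:
  assumes "finite N" and a: "\<And>m. m \<in> N \<Longrightarrow> a m \<in> H0 m" and 0: "(\<Sum>m\<in>N. a m) = 0" and m: "m \<in> N"
  shows "a m = 0"
proof
  fix \<sigma>
  show "a m \<sigma> = 0 \<sigma>"
  proof (cases "\<sigma> \<in> chambers \<Delta>")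
    case True
    have deg: "lookup (a l \<sigma>) b = 0" if "l \<in> N" "l \<noteq> monom_degree b" for l b
      using a[OF that(1)] that(2) True unfolding H0_Sym_iff sym_free_module_iff by blast
    have "lookup (a m \<sigma>) b = 0" for b
    proof (cases "m = monom_degree b")
      case eq: True
      have "0 = lookup ((\<Sum>m\<in>N. a m) \<sigma>) b" by (simp add: 0)
      also have "\<dots> = (\<Sum>l\<in>N. lookup (a l \<sigma>) b)" by (simp add: sum_fun_apply lookup_sum)
      also have "\<dots> = (\<Sum>l\<in>N. if l = m then lookup (a m \<sigma>) b else 0)"
        using deg eq by (intro sum.cong) auto
      also have "\<dots> = lookup (a m \<sigma>) b" using assms(1) m by simp
      finally show ?thesis by simp
    qed (use deg m in auto)
    then show ?thesis by (simp add: poly_mapping_eqI)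
  next
    case False
    then show ?thesis using a[OF m] unfolding H0_Sym_iff by simp
  qed
qed

lemma H0_Sym_graded: "connected_graded_algebra (const) (H0)"
  unfolding connected_graded_algebra_def
proof (intro conjI allI ballI impI)
  show "a m = 0" if "finite N \<and> (\<forall>m\<in>N. a m \<in> H0 m) \<and> (\<Sum>m\<in>N. a m) = 0" "m \<in> N" for N a m
    using H0_Sym_direct[of N a m] that by blast
qed (use inj_constant_section constant_section_add constant_section_mult H0_Sym_degree_0 H0_Sym_0
    H0_Sym_add H0_Sym_mult unit_section_mult in blast)+

context notes One_nat_def [simp del] begin

lemma wt_sum_list: "wt (\<Sum>j\<leftarrow>js. single j (1::nat)) \<sigma> = (\<Sum>i<length js. weight (L (js ! i)) \<sigma>)"
proof -
  have "wt (\<Sum>j\<leftarrow>js. single j (1::nat)) \<sigma> = (\<Sum>j\<leftarrow>js. weight (L j) \<sigma>)"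
    by (induction js) (simp_all add: wt_0 wt_add wt_single)
  then show ?thesis by (simp add: sum_list_sum_nth atLeast0LessThan)
qed

lemma atom_iff: "(single j (1::nat), x) \<in> exponents \<longleftrightarrow> j < k \<and> x \<in> weights (weight (L j))"
proof -
  have "wt (single j (1::nat)) = weight (L j)" by (simp add: fun_eq_iff wt_single)
  then show ?thesis by (simp add: exponents_def)
qed

abbreviation factors :: "nat list \<Rightarrow> nat \<Rightarrow> 'a set \<Rightarrow> 'a" where
  "factors js i \<equiv> weight (L (js ! i))"

lemma special_family: "set js \<subseteq> {..<k} \<Longrightarrow> special_family \<Delta> (factors js) (length js)"
  by unfold_locales (use special_weights nth_mem in blast)

lemma exists_index_list:
  fixes a :: "nat \<Rightarrow>\<^sub>0 nat"
  assumes "keys a \<subseteq> {..<k}"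
  shows "\<exists>js. set js \<subseteq> {..<k} \<and> (\<Sum>j\<leftarrow>js. single j (1::nat)) = a"
  using assms
proof (induction "monom_degree a" arbitrary: a)
  case 0
  then have "a = 0" by (simp add: monom_degree_eq_0)
  then show ?case by (intro exI[of _ "[]"]) simp
next
  case (Suc n)
  have "keys a \<noteq> {}" using Suc.hyps(2) unfolding monom_degree_def by fastforce
  then obtain j where j: "j \<in> keys a" by blast
  obtain b where a: "a = single j 1 + b" using nat_monom_split[OF j] .
  have "monom_degree b = n" using Suc.hyps(2) unfolding a monom_degree_add by simp
  moreover have "keys b \<subseteq> {..<k}" using Suc.prems unfolding a nat_keys_add by auto
  ultimately obtain js where "set js \<subseteq> {..<k}" "(\<Sum>j\<leftarrow>js. single j (1::nat)) = b" using Suc.hyps(1) by blast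
  then show ?case using j Suc.prems by (intro exI[of _ "j # js"]) (auto simp: a)
qed

lemma sum_list_Pair: "(\<Sum>i\<leftarrow>xs. (f i, g i)) = (\<Sum>i\<leftarrow>xs. f i, \<Sum>i\<leftarrow>xs. g i)"
  by (induction xs) (simp_all add: zero_prod_def)

text \<open>The frame monomial is spelled as a list of bundle indices, and
  \<open>tuples_nonempty\<close> splits the weight accordingly.\<close>

lemma exponents_generated:
  assumes t: "t \<in> exponents"
  shows "\<exists>l. set l \<subseteq> {t \<in> exponents. monom_degree (fst t) = 1} \<and> sum_list l = t"
proof -
  obtain js where js: "set js \<subseteq> {..<k}" "(\<Sum>j\<leftarrow>js. single j (1::nat)) = fst t"
    using exists_index_list[OF exponents_keys[OF t]] by blast
  interpret T: special_family \<Delta> "factors js" "length js" by (rule special_family[OF js(1)])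
  have "T.total = wt (fst t)" by (simp add: fun_eq_iff T.total_def wt_sum_list flip: js(2))
  then have "snd t \<in> weights T.total" using t by (auto simp: exponents_def)
  then obtain y where y: "y \<in> T.tuples (snd t)" using T.tuples_nonempty by blast
  let ?l = "map (\<lambda>i. (single (js ! i) (1::nat), y i)) [0..<length js]"
  have "set ?l \<subseteq> {t \<in> exponents. monom_degree (fst t) = 1}"
    using js(1) T.tuples_weight[OF y] by (auto simp: atom_iff subset_iff)
  moreover have "sum_list ?l = t"
  proof -
    have "(\<Sum>i\<leftarrow>[0..<length js]. single (js ! i) (1::nat)) = (\<Sum>j\<leftarrow>map ((!) js) [0..<length js]. single j (1::nat))"
      by (simp add: comp_def)
    then have "(\<Sum>i\<leftarrow>[0..<length js]. single (js ! i) (1::nat)) = fst t" by (simp add: map_nth js(2))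
    moreover have "(\<Sum>i\<leftarrow>[0..<length js]. y i) = snd t"
      using T.tuples_sum[OF y] by (simp add: interv_sum_list_conv_sum_set_nat atLeast0LessThan)
    ultimately show ?thesis by (simp add: sum_list_Pair)
  qed
  ultimately show ?thesis by blast
qed

end

sublocale basis: multiplicative_basis "const" "H0" exponents
  "\<lambda>t. monom_degree (fst t)" basis_section
proof
  show "basis_section (s + t) = basis_section s * basis_section t" for s t by (rule basis_section_add)
  show "H0 m = {\<Sum>t\<in>F. const (z t) * basis_section t | F z.
       finite F \<and> F \<subseteq> exponents \<and> (\<forall>t\<in>F. monom_degree (fst t) = m)}" for m
    by (rule H0_Sym_spanning)
  show "\<exists>l. set l \<subseteq> {t \<in> exponents. monom_degree (fst t) = 1} \<and> sum_list l = t" if "t \<in> exponents" for t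
    by (rule exponents_generated[OF that])
qed (use H0_Sym_graded basis_section_0 exponents_0 exponents_add basis_section_independent in blast)+

context notes One_nat_def [simp del] begin

definition linear_form :: "nat \<Rightarrow> 'a \<Rightarrow> ('a sym_section \<Rightarrow>\<^sub>0 nat) \<Rightarrow>\<^sub>0 complex" where
  "linear_form j x = variable (basis_section (single j (1::nat), x))"

text \<open>The list js fixes the bundle of each factor, so that only the weights vary, as in the
  tuples of \<open>special_family\<close>.\<close>

definition tuple_word :: "nat list \<Rightarrow> (nat \<Rightarrow> 'a) \<Rightarrow> ('a sym_section \<Rightarrow>\<^sub>0 nat) \<Rightarrow>\<^sub>0 complex" where
  "tuple_word js x = (\<Prod>i<length js. linear_form (js ! i) (x i))"

lemma linear_form_mem:
  assumes "j < k" "x \<in> weights (weight (L j))"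
  shows "linear_form j x \<in> basis.R"
  unfolding linear_form_def using assms
  by (intro free_alg_variable basis.atom_mem) (simp add: atom_iff)

text \<open>Both products evaluate to the same basis section. These exchanges of weight between two
  factors are the quadratic relations that the proof uses.\<close>

lemma quadric_mem:
  assumes j: "j < k" "j' < k"
    and x: "x \<in> weights (weight (L j))" "x' \<in> weights (weight (L j'))"
    and y: "y \<in> weights (weight (L j))" "y' \<in> weights (weight (L j'))"
    and eq: "x + x' = y + y'"
  shows "linear_form j x * linear_form j' x' - linear_form j y * linear_form j' y' \<in> basis.I"
    (is "?f - ?g \<in> _")
proof (rule ideal_in_base[OF free_alg_1 UnI2])
  have R: "?f \<in> basis.R" "?g \<in> basis.R" using assms by (auto intro!: free_alg_mult linear_form_mem)
  have ev: "eval_alg (const) (linear_form i u * linear_form i' u') =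
      basis_section (single i (1::nat) + single i' (1::nat), u + u')"
    if "i < k" "i' < k" "u \<in> weights (weight (L i))" "u' \<in> weights (weight (L i'))" for i i' u u'
  proof -
    have "const 1 * basis_section (single i (1::nat), u) = basis_section (single i (1::nat), u)"
      if "i < k" "u \<in> weights (weight (L i))" for i u
      using that by (intro unit_section_mult[where m = 1] basis.atom_mem) (simp add: atom_iff)
    then show ?thesis using that
      by (simp add: linear_form_def basis.eval_alg_mult basis.eval_alg_variable flip: basis_section_add)
  qed
  have deg: "monom_degree a = 2" if "a \<in> keys (linear_form i u * linear_form i' u')" for a i u i' u'
    using that by (auto simp: linear_form_def variable_def mult_single monom_degree_add split: if_splits)
  have "keys (?f - ?g) \<subseteq> keys ?f \<union> keys ?g"
    by (auto simp: in_keys_iff lookup_minus)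
  then have "\<forall>a\<in>keys (?f - ?g). monom_degree a = 2" using deg by blast
  moreover have "eval_alg (const) (?f - ?g) = 0"
    using ev[OF j x] ev[OF j y] eq by (simp add: basis.eval_alg_diff)
  ultimately show "?f - ?g \<in> basis.quadrics" using free_alg_diff[OF R] by blast
qed

lemma tuple_word_adjacent:
  assumes js: "set js \<subseteq> {..<k}"
    and adj: "special_family.adj \<Delta> (factors js) (length js) s x y"
  shows "tuple_word js x - tuple_word js y \<in> basis.I"
proof -
  interpret T: special_family \<Delta> "factors js" "length js" by (rule special_family[OF js])
  let ?n = "length js"
  have x: "x \<in> T.tuples s" and y: "y \<in> T.tuples s" using T.adj_tuples adj by auto
  have jk: "js ! i < k" if "i < ?n" for i using js that nth_mem by blast
  have xm: "x i \<in> weights (weight (L (js ! i)))" and ym: "y i \<in> weights (weight (L (js ! i)))"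
    if "i < ?n" for i using T.tuples_weight x y that by auto
  obtain i j where ij: "\<And>l. l < ?n \<Longrightarrow> l \<noteq> i \<Longrightarrow> l \<noteq> j \<Longrightarrow> x l = y l"
    using adj by (auto simp: T.adj_def)
  \<comment> \<open>Adjacency permits equal or out-of-range indices; then at most one entry could
    differ, and equality of the sums makes it agree as well.\<close>
  have one: "tuple_word js x - tuple_word js y \<in> basis.I" if p: "\<And>l. l < ?n \<Longrightarrow> l \<noteq> p \<Longrightarrow> x l = y l" for p
  proof -
    have "x p = y p" if pn: "p < ?n"
    proof -
      have "sum x ({..<?n} - {p}) = sum y ({..<?n} - {p})" using p by (intro sum.cong) auto
      moreover have "sum x {..<?n} = sum y {..<?n}" using T.tuples_sum x y by simp
      ultimately show ?thesis using pn sum.remove[of "{..<?n}" p x] sum.remove[of "{..<?n}" p y] by simp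
    qed
    then have "x l = y l" if "l < ?n" for l using p that by (cases "l = p") auto
    then have "tuple_word js x = tuple_word js y" by (simp add: tuple_word_def)
    then show ?thesis by (simp add: ideal_in_0)
  qed
  consider "i = j \<or> \<not> j < ?n" | "\<not> i < ?n" | "i < ?n" "j < ?n" "i \<noteq> j" by blast
  then show ?thesis
  proof cases
    case 1
    then show ?thesis using one[of i] ij by metis
  next
    case 2
    then show ?thesis using one[of j] ij by metis
  next
    case 3
    define A where "A = {..<?n} - {i} - {j}"
    have rem: "sum z {..<?n} = z i + (z j + sum z A)" for z :: "nat \<Rightarrow> 'a"
      using 3 sum.remove[of "{..<?n}" i z] sum.remove[of "{..<?n} - {i}" j z] by (simp add: A_def)
    have remp: "prod z {..<?n} = z i * (z j * prod z A)" for z :: "nat \<Rightarrow> ('a sym_section \<Rightarrow>\<^sub>0 nat) \<Rightarrow>\<^sub>0 complex"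
      using 3 prod.remove[of "{..<?n}" i z] prod.remove[of "{..<?n} - {i}" j z] by (simp add: A_def)
    have same: "x l = y l" if "l \<in> A" for l using ij[of l] that by (auto simp: A_def)
    then have "sum x A = sum y A" by simp
    moreover have "sum x {..<?n} = sum y {..<?n}" using T.tuples_sum x y by simp
    ultimately have eq: "x i + x j = y i + y j" unfolding rem by (simp flip: add.assoc)
    define r where "r = (\<Prod>l\<in>A. linear_form (js ! l) (x l))"
    have ry: "r = (\<Prod>l\<in>A. linear_form (js ! l) (y l))" unfolding r_def using same by simp
    have "finite A" by (simp add: A_def)
    moreover have "linear_form (js ! l) (x l) \<in> basis.R" if "l \<in> A" for l
      using that jk xm by (auto simp: A_def intro!: linear_form_mem)
    ultimately have "r \<in> basis.R" unfolding r_def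
      by (induction A rule: finite_induct) (auto simp: free_alg_1 free_alg_mult)
    moreover have "linear_form (js ! i) (x i) * linear_form (js ! j) (x j) -
        linear_form (js ! i) (y i) * linear_form (js ! j) (y j) \<in> basis.I"
      using 3 jk xm ym eq by (intro quadric_mem) auto
    ultimately have "r * (linear_form (js ! i) (x i) * linear_form (js ! j) (x j) -
        linear_form (js ! i) (y i) * linear_form (js ! j) (y j)) \<in> basis.I" by (rule basis.I_mult)
    moreover have "tuple_word js x - tuple_word js y = r * (linear_form (js ! i) (x i) * linear_form (js ! j) (x j) -
        linear_form (js ! i) (y i) * linear_form (js ! j) (y j))"
      unfolding tuple_word_def remp r_def[symmetric] ry[symmetric] by (simp add: algebra_simps)
    ultimately show ?thesis by simp
  qed
qed

lemma tuple_word_cong: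
  assumes js: "set js \<subseteq> {..<k}"
    and x: "x \<in> special_family.tuples \<Delta> (factors js) (length js) s"
    and y: "y \<in> special_family.tuples \<Delta> (factors js) (length js) s"
  shows "tuple_word js x - tuple_word js y \<in> basis.I"
proof -
  interpret T: special_family \<Delta> "factors js" "length js" by (rule special_family[OF js])
  have "(T.adj s)\<^sup>*\<^sup>* x y" using T.tuples_connected x y by blast
  then show ?thesis
  proof (induction rule: rtranclp_induct)
    case base
    then show ?case by (simp add: ideal_in_0)
  next
    case (step y z)
    have "tuple_word js x - tuple_word js z = (tuple_word js x - tuple_word js y) + (tuple_word js y - tuple_word js z)"
      by simp
    then show ?case using basis.I_add[OF step.IH tuple_word_adjacent[OF js step.hyps(2)]] by (simp only:)
  qed
qed

lemma mset_index_list: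
  assumes "(\<Sum>j\<leftarrow>js. single j (1::nat)) = (\<Sum>j\<leftarrow>js'. single j (1::nat))"
  shows "mset js = mset js'"
proof (rule multiset_eqI)
  have "lookup (\<Sum>j\<leftarrow>js. single j (1::nat)) i = count (mset js) i" for js i
    by (induction js) (auto simp: lookup_add lookup_single when_def One_nat_def)
  then show "count (mset js) i = count (mset js') i" for i using assms by metis
qed

lemma sum_list_sort_key:
  fixes f :: "'b \<Rightarrow> 'c::comm_monoid_add"
  shows "(\<Sum>x\<leftarrow>sort_key g xs. f x) = (\<Sum>x\<leftarrow>xs. f x)"
proof -
  have "mset (map f (sort_key g xs)) = mset (map f xs)" by simp
  then show ?thesis unfolding sum_mset_sum_list[symmetric] by (rule arg_cong)
qed

lemma map_sort_key: "map f (sort_key f xs) = sort (map f xs)"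
  by (rule properties_for_sort[symmetric]) (simp_all add: mset_map[symmetric] del: mset_map, simp)

text \<open>Factors of a word may be reordered by bundle index. As the sum of a word determines the
  multiset of its bundle indices, all words with the same sum become tuple words over one sorted
  list.\<close>

lemma word_eq_tuple_word:
  assumes l: "set l \<subseteq> basis.atoms" "sum_list l = t"
    and js: "sorted js" "(\<Sum>j\<leftarrow>js. single j (1::nat)) = fst t"
  shows "set js \<subseteq> {..<k} \<and> (\<exists>x\<in>special_family.tuples \<Delta> (factors js) (length js) (snd t).
    basis.word l = tuple_word js x)"
proof -
  define h :: "nat \<times> 'a \<Rightarrow> (nat \<Rightarrow>\<^sub>0 nat) \<times> 'a" where "h = (\<lambda>p. (single (fst p) (1::nat), snd p))"
  have "\<exists>ps. l = map h ps \<and> (\<forall>p\<in>set ps. fst p < k \<and> snd p \<in> weights (weight (L (fst p))))"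
    using l(1)
  proof (induction l)
    case (Cons u l)
    then obtain ps where ps: "l = map h ps" "\<forall>p\<in>set ps. fst p < k \<and> snd p \<in> weights (weight (L (fst p)))"
      by auto
    have u: "u \<in> exponents" "monom_degree (fst u) = 1" using Cons.prems by auto
    obtain j where j: "fst u = single j (1::nat)" using monom_degree_1[OF u(2)] .
    then have uj: "u = (single j (1::nat), snd u)" by (simp add: prod_eq_iff)
    then have "j < k \<and> snd u \<in> weights (weight (L j))" using u(1) atom_iff by metis
    then show ?case using ps uj by (intro exI[of _ "(j, snd u) # ps"]) (simp add: h_def)
  qed simp
  then obtain ps where ps: "l = map h ps" "\<And>p. p \<in> set ps \<Longrightarrow> fst p < k"
    "\<And>p. p \<in> set ps \<Longrightarrow> snd p \<in> weights (weight (L (fst p)))" by blast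
  have sums: "(\<Sum>p\<leftarrow>ps. single (fst p) (1::nat)) = fst t" "(\<Sum>p\<leftarrow>ps. snd p) = snd t"
    using l(2) by (auto simp: ps(1) h_def sum_list_Pair comp_def)
  define qs where "qs = sort_key fst ps"
  have "(\<Sum>j\<leftarrow>map fst ps. single j (1::nat)) = (\<Sum>j\<leftarrow>js. single j (1::nat))"
    using sums(1) js(2) by (simp add: comp_def)
  then have "mset js = mset (map fst ps)" using mset_index_list by metis
  then have fq: "map fst qs = js"
    unfolding qs_def map_sort_key using js(1) by (intro properties_for_sort) simp_all
  have len: "length qs = length js" using fq length_map by metis
  have fst_q: "fst (qs ! i) = js ! i" if "i < length js" for i
    using nth_map[of i qs fst] that unfolding fq len by simp
  have set_q: "qs ! i \<in> set ps" if "i < length js" for i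
    using that len nth_mem[of i qs] by (simp add: qs_def)
  define x where "x i = snd (qs ! i)" for i
  have "set js \<subseteq> {..<k}" using ps(2) by (auto simp: qs_def simp flip: fq)
  then interpret T: special_family \<Delta> "factors js" "length js" by (rule special_family)
  have "(\<Sum>i<length js. x i) = (\<Sum>p\<leftarrow>qs. snd p)"
    by (simp add: sum_list_sum_nth len x_def atLeast0LessThan)
  also have "\<dots> = snd t" by (simp add: qs_def sum_list_sort_key sums(2))
  finally have "(\<Sum>i<length js. x i) = snd t" .
  moreover have "x i \<in> weights (weight (L (js ! i)))" if "i < length js" for i
    using ps(3)[OF set_q[OF that]] fst_q[OF that] by (simp add: x_def)
  ultimately have xt: "x \<in> T.tuples (snd t)" by (simp add: T.tuples_def)
  have "basis.word l = prod_list (map (\<lambda>p. linear_form (fst p) (snd p)) ps)"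
    by (simp add: basis.word_def ps(1) h_def linear_form_def comp_def)
  also have "\<dots> = prod_list (map (\<lambda>p. linear_form (fst p) (snd p)) qs)"
  proof -
    have "mset (map (\<lambda>p. linear_form (fst p) (snd p)) ps) = mset (map (\<lambda>p. linear_form (fst p) (snd p)) qs)"
      by (simp add: qs_def)
    then show ?thesis unfolding prod_mset_prod_list[symmetric] by (rule arg_cong)
  qed
  also have "\<dots> = (\<Prod>i<length js. linear_form (fst (qs ! i)) (snd (qs ! i)))"
    by (simp add: prod.list_conv_set_nth len atLeast0LessThan)
  also have "\<dots> = tuple_word js x" unfolding tuple_word_def x_def using fst_q by (intro prod.cong) auto
  finally show ?thesis using xt \<open>set js \<subseteq> {..<k}\<close> by blast
qed

theorem quadratic_section_ring: "quadratic_algebra (const) (H0)"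
proof (rule basis.quadratic)
  fix l l' assume l: "set l \<subseteq> basis.atoms" and l': "set l' \<subseteq> basis.atoms" and eq: "sum_list l = sum_list l'"
  obtain js0 where js0: "(\<Sum>j\<leftarrow>js0. single j (1::nat)) = fst (sum_list l)"
    using exists_index_list[OF exponents_keys[OF basis.sum_list_mem[OF l]]] by blast
  define js where "js = sort js0"
  have js: "sorted js" "(\<Sum>j\<leftarrow>js. single j (1::nat)) = fst (sum_list l)"
    using js0 by (simp_all add: js_def sum_list_sort_key)
  show "basis.word l - basis.word l' \<in> basis.I"
    using word_eq_tuple_word[OF l refl js] word_eq_tuple_word[OF l' eq[symmetric] js] tuple_word_cong by fastforce
qed

end

end

theorem corollary1p15:
  fixes \<Delta> :: "'a::euclidean_space set"
    and L :: "nat \<Rightarrow> 'a line_bundle_data"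
    and k :: nat
  assumes "reduced_root_system \<Delta>"
    and "irreducible_root_system \<Delta>"
    and "\<And>i. i < k \<Longrightarrow> special_ample_line_bundle \<Delta> (L i)"
  shows "quadratic_algebra (constant_section \<Delta>)
           (\<lambda>m. H0_Sym \<Delta> (direct_sum_line_bundles k L) m)"
proof -
  interpret special_bundles \<Delta> L k
    using assms by unfold_locales auto
  show ?thesis by (rule quadratic_section_ring)
qed

end
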